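(* Let $(I,<)$ be a well-ordered set and let $S$ be a free pro-$2$ group on generators $x_i$, $i\in I$. Let $\mathcal{R}$ be a set of elements of $S_{(2)}$. Assume there exist $r\in\mathcal{R}$ and distinct indices $i<j$ in $I$ such that: (i) in the canonical decomposition modulo $S_{(4)}$ of $r$, $a_i=a_j=u_{ij}=u_{il}=u_{jl}=0$ for all $l\neq i,j$, and $c_{iji}\neq 0$ (respectively, $c_{ijj}\neq0$); and (ii) for every $s\in\mathcal{R}$ different from $r$, the factors $[x_i,x_j]$ and $x_i^2$ (respectively, $[x_i,x_j]$ and $x_j^2$) do not occur in the canonical decomposition modulo $S_{(4)}$ of $s$. Then $G=S/\langle\mathcal{R}\rangle$ is not isomorphic to $G_F(2)$ for any field $F$.
   Context: $[x,y]=x^{-1}y^{-1}xy$. The $2$-Zassenhaus filtration of $S$: $S_{(1)}=S$, $S_{(n)}=S_{(\lceil n/2\rceil)}^2\prod_{i+j=n}[S_{(i)},S_{(j)}]$. Every $r\in S_{(2)}$ can be written uniquely as $r=\prod_{i\in I}x_i^{2a_i}\prod_{i<j}[x_i,x_j]^{b_{ij}}\prod_{i<j,\,k\le j}[[x_i,x_j],x_k]^{c_{ijk}}\cdot r'$ with $a_i,b_{ij},c_{ijk}\in\{0,1\}$ and $r'\in S_{(4)}$ (products in a fixed order); this is the canonical decomposition modulo $S_{(4)}$ of $r$, and a factor "does not occur" if its exponent is $0$. Set $u_{ij}=b_{ij}$ if $i<j$ and $u_{ij}=b_{ji}$ if $j<i$. $\langle\mathcal{R}\rangle$ is the closed normal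 subgroup generated by $\mathcal{R}$; $G_F(2)$ is the maximal pro-$2$ quotient of the absolute Galois group of $F$. *)

theory Defs
  imports "HOL-Analysis.Analysis" "HOL-Algebra.Algebraic_Closure_Type"
begin

section \<open>Profinite groups\<close>

text \<open>A topological group is given by a group \<open>G\<close> and a topology \<open>T\<close> on its carrier.\<close>

definition topological_group :: "('a, 'm) monoid_scheme \<Rightarrow> 'a topology \<Rightarrow> bool" where
  "topological_group G T \<longleftrightarrow>
     group G \<and> topspace T = carrier G \<and>
     continuous_map (prod_topology T T) T (\<lambda>(x, y). x \<otimes>\<^bsub>G\<^esub> y) \<and>
     continuous_map T T (\<lambda>x. inv\<^bsub>G\<^esub> x)"

definition totally_disconnected_topology :: "'a topology \<Rightarrow> bool" where
  "totally_disconnected_topology T \<longleftrightarrow>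
     (\<forall>x\<in>topspace T. connected_component_of_set T x = {x})"

definition profinite_group :: "('a, 'm) monoid_scheme \<Rightarrow> 'a topology \<Rightarrow> bool" where
  "profinite_group G T \<longleftrightarrow>
     topological_group G T \<and> compact_space T \<and> Hausdorff_space T \<and>
     totally_disconnected_topology T"

definition pro_p_group :: "nat \<Rightarrow> ('a, 'm) monoid_scheme \<Rightarrow> 'a topology \<Rightarrow> bool" where
  "pro_p_group p G T \<longleftrightarrow>
     profinite_group G T \<and>
     (\<forall>N. N \<lhd> G \<and> openin T N \<longrightarrow> (\<exists>k. card (rcosets\<^bsub>G\<^esub> N) = p ^ k))"

definition topologically_isomorphic ::
    "('a, 'm) monoid_scheme \<Rightarrow> 'a topology \<Rightarrow> ('b, 'n) monoid_scheme \<Rightarrow> 'b topology \<Rightarrow> bool" where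
  "topologically_isomorphic G T H T' \<longleftrightarrow> (\<exists>h. h \<in> iso G H \<and> homeomorphic_map T T' h)"

text \<open>The quotient topology on \<open>G Mod N\<close>, whose elements are the cosets of \<open>N\<close>:
  the preimage in \<open>G\<close> of a set \<open>U\<close> of cosets is \<open>\<Union>U\<close>.\<close>

definition quotient_group_topology ::
    "('a, 'm) monoid_scheme \<Rightarrow> 'a topology \<Rightarrow> 'a set \<Rightarrow> 'a set topology" where
  "quotient_group_topology G T N =
     topology (\<lambda>U. U \<subseteq> carrier (G Mod N) \<and> openin T (\<Union>U))"

lemma openin_quotient_group_topology:
  assumes "group G" and "N \<lhd> G"
  shows "openin (quotient_group_topology G T N) U \<longleftrightarrow>
           U \<subseteq> carrier (G Mod N) \<and> openin T (\<Union>U)"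
proof -
  have disj: "A = B" if "A \<in> rcosets\<^bsub>G\<^esub> N" "B \<in> rcosets\<^bsub>G\<^esub> N" "z \<in> A" "z \<in> B" for A B z
    using group.rcos_disjoint[OF assms(1) normal_imp_subgroup[OF assms(2)]] that
    by (auto simp: pairwise_def disjnt_def)
  have "istopology (\<lambda>U. U \<subseteq> carrier (G Mod N) \<and> openin T (\<Union>U))"
    unfolding istopology_def
  proof (intro conjI allI impI)
    fix U V
    assume U: "U \<subseteq> carrier (G Mod N) \<and> openin T (\<Union>U)"
      and V: "V \<subseteq> carrier (G Mod N) \<and> openin T (\<Union>V)"
    have "\<Union>(U \<inter> V) = \<Union>U \<inter> \<Union>V"
    proof (intro equalityI subsetI)
      fix z assume "z \<in> \<Union>U \<inter> \<Union>V"
      then obtain A B where AB: "A \<in> U" "B \<in> V" "z \<in> A" "z \<in> B" by blast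
      moreover from AB U V have "A \<in> rcosets\<^bsub>G\<^esub> N" "B \<in> rcosets\<^bsub>G\<^esub> N"
        by (auto simp: FactGroup_def)
      ultimately have "A = B" using disj by blast
      with AB show "z \<in> \<Union>(U \<inter> V)" by blast
    qed blast
    with U V show "openin T (\<Union>(U \<inter> V))" by auto
    show "U \<inter> V \<subseteq> carrier (G Mod N)" using U by auto
  next
    fix K
    assume K: "\<forall>U\<in>K. U \<subseteq> carrier (G Mod N) \<and> openin T (\<Union>U)"
    have "\<Union>(\<Union>K) = \<Union>(Union ` K)" by auto
    with K show "openin T (\<Union>(\<Union>K))" by auto
    show "\<Union>K \<subseteq> carrier (G Mod N)" using K by auto
  qed
  then show ?thesis
    by (simp add: quotient_group_topology_def topology_inverse')
qed

definition closed_subgroup_generated ::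
    "('a, 'm) monoid_scheme \<Rightarrow> 'a topology \<Rightarrow> 'a set \<Rightarrow> 'a set" where
  "closed_subgroup_generated G T A = \<Inter>{H. subgroup H G \<and> closedin T H \<and> A \<subseteq> H}"

definition closed_normal_subgroup_generated ::
    "('a, 'm) monoid_scheme \<Rightarrow> 'a topology \<Rightarrow> 'a set \<Rightarrow> 'a set" where
  "closed_normal_subgroup_generated G T A = \<Inter>{H. H \<lhd> G \<and> closedin T H \<and> A \<subseteq> H}"

text \<open>The maximal pro-\<open>p\<close> quotient of \<open>(G, T)\<close> is the quotient by the intersection of all open
  normal subgroups of \<open>p\<close>-power index.\<close>

definition pro_p_kernel :: "nat \<Rightarrow> ('a, 'm) monoid_scheme \<Rightarrow> 'a topology \<Rightarrow> 'a set" where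
  "pro_p_kernel p G T =
     \<Inter>{N. N \<lhd> G \<and> openin T N \<and> (\<exists>k. card (rcosets\<^bsub>G\<^esub> N) = p ^ k)}"

definition maximal_pro_p_quotient :: "nat \<Rightarrow> ('a, 'm) monoid_scheme \<Rightarrow> 'a topology \<Rightarrow> 'a set monoid" where
  "maximal_pro_p_quotient p G T = G Mod pro_p_kernel p G T"

definition maximal_pro_p_quotient_topology ::
    "nat \<Rightarrow> ('a, 'm) monoid_scheme \<Rightarrow> 'a topology \<Rightarrow> 'a set topology" where
  "maximal_pro_p_quotient_topology p G T = quotient_group_topology G T (pro_p_kernel p G T)"

section \<open>Free pro-p groups\<close>

definition family_converges_to_one ::
    "('a, 'm) monoid_scheme \<Rightarrow> 'a topology \<Rightarrow> ('i \<Rightarrow> 'a) \<Rightarrow> bool" where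
  "family_converges_to_one G T y \<longleftrightarrow>
     (\<forall>i. y i \<in> carrier G) \<and>
     (\<forall>U. openin T U \<and> \<one>\<^bsub>G\<^esub> \<in> U \<longrightarrow> finite {i. y i \<notin> U})"

text \<open>The universal property among pro-\<open>p\<close> groups. A definition cannot quantify over types, so the
  carriers of the test groups are subsets of the type \<open>('i + nat) set\<close>. This loses nothing: a
  pro-\<open>p\<close> group topologically generated by a family indexed by \<open>'i\<close> and converging to \<open>1\<close> has at
  most \<open>max |'i| \<aleph>\<^sub>0\<close> open normal subgroups, hence embeds into a product of that many finite groups,
  and so has an isomorphic copy carried by this type.\<close>

definition free_pro_p_group ::
    "nat \<Rightarrow> ('s, 'm) monoid_scheme \<Rightarrow> 's topology \<Rightarrow> ('i \<Rightarrow> 's) \<Rightarrow> bool" where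
  "free_pro_p_group p S T x \<longleftrightarrow>
     pro_p_group p S T \<and> family_converges_to_one S T x \<and>
     (\<forall>(H :: ('i + nat) set monoid) T' y.
        pro_p_group p H T' \<and> family_converges_to_one H T' y \<longrightarrow>
        (\<exists>!\<phi>. \<phi> \<in> extensional (carrier S) \<and> \<phi> \<in> hom S H \<and> continuous_map T T' \<phi> \<and>
              (\<forall>i. \<phi> (x i) = y i)))"

section \<open>The 2-Zassenhaus filtration\<close>

definition commutator :: "('a, 'm) monoid_scheme \<Rightarrow> 'a \<Rightarrow> 'a \<Rightarrow> 'a" where
  "commutator G x y = inv\<^bsub>G\<^esub> x \<otimes>\<^bsub>G\<^esub> inv\<^bsub>G\<^esub> y \<otimes>\<^bsub>G\<^esub> x \<otimes>\<^bsub>G\<^esub> y"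

text \<open>As usual for profinite groups, \<open>H\<^sup>2\<close> and \<open>[H, K]\<close> denote closed subgroups.\<close>

definition closed_square_subgroup ::
    "('a, 'm) monoid_scheme \<Rightarrow> 'a topology \<Rightarrow> 'a set \<Rightarrow> 'a set" where
  "closed_square_subgroup G T H = closed_subgroup_generated G T {h [^]\<^bsub>G\<^esub> (2::nat) | h. h \<in> H}"

definition closed_commutator_subgroup ::
    "('a, 'm) monoid_scheme \<Rightarrow> 'a topology \<Rightarrow> 'a set \<Rightarrow> 'a set \<Rightarrow> 'a set" where
  "closed_commutator_subgroup G T H K =
     closed_subgroup_generated G T {commutator G h k | h k. h \<in> H \<and> k \<in> K}"

text \<open>\<open>(n + 1) div 2\<close> is \<open>n / 2\<close> rounded up; the list runs over the pairs \<open>(i, n - i)\<close> with both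
  entries positive. The value at \<open>0\<close> is irrelevant.\<close>

function zassenhaus :: "('a, 'm) monoid_scheme \<Rightarrow> 'a topology \<Rightarrow> nat \<Rightarrow> 'a set" where
  "zassenhaus G T n =
     (if n \<le> 1 then carrier G
      else foldl (\<lambda>A B. A <#>\<^bsub>G\<^esub> B)
             (closed_square_subgroup G T (zassenhaus G T ((n + 1) div 2)))
             (map (\<lambda>i. closed_commutator_subgroup G T (zassenhaus G T i) (zassenhaus G T (n - i)))
                  [1..<n]))"
  by pat_completeness auto
termination
  by (relation "Wellfounded.measure (\<lambda>(G, T, n). n)") auto

declare zassenhaus.simps [simp del]

section \<open>Canonical decomposition modulo the fourth term\<close>

text \<open>Finite products are taken in increasing order with respect to a strict linear order \<open>L\<close>;
  a possibly infinite product is the limit of the net of its finite subproducts.\<close>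

definition ordered_finite_product ::
    "('a, 'm) monoid_scheme \<Rightarrow> ('j \<times> 'j) set \<Rightarrow> ('j \<Rightarrow> 'a) \<Rightarrow> 'j set \<Rightarrow> 'a" where
  "ordered_finite_product G L f F =
     foldr (\<lambda>j z. f j \<otimes>\<^bsub>G\<^esub> z)
       (THE js. set js = F \<and> sorted_wrt (\<lambda>u v. (u, v) \<in> L) js) \<one>\<^bsub>G\<^esub>"

definition has_ordered_product ::
    "('a, 'm) monoid_scheme \<Rightarrow> 'a topology \<Rightarrow> ('j \<times> 'j) set \<Rightarrow> ('j \<Rightarrow> 'a) \<Rightarrow> 'j set \<Rightarrow> 'a \<Rightarrow> bool" where
  "has_ordered_product G T L f A z \<longleftrightarrow>
     limitin T (ordered_finite_product G L f) z (finite_subsets_at_top A)"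

abbreviation less_rel :: "('i::ord \<times> 'i) set" where
  "less_rel \<equiv> {(i, j). i < j}"

text \<open>The exponents \<open>b i j\<close> and \<open>c i j k\<close> are meaningful only for \<open>i < j\<close> and for \<open>i < j\<close>, \<open>k \<le> j\<close>
  respectively. Index pairs and triples are ordered lexicographically.\<close>

definition canonical_decomposition ::
    "('s, 'm) monoid_scheme \<Rightarrow> 's topology \<Rightarrow> ('i::wellorder \<Rightarrow> 's) \<Rightarrow> 's \<Rightarrow>
     ('i \<Rightarrow> nat) \<Rightarrow> ('i \<Rightarrow> 'i \<Rightarrow> nat) \<Rightarrow> ('i \<Rightarrow> 'i \<Rightarrow> 'i \<Rightarrow> nat) \<Rightarrow> bool" where
  "canonical_decomposition S T x r a b c \<longleftrightarrow>
     (\<forall>i. a i \<in> {0, 1}) \<and>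
     (\<forall>i j. i < j \<longrightarrow> b i j \<in> {0, 1}) \<and>
     (\<forall>i j k. i < j \<and> k \<le> j \<longrightarrow> c i j k \<in> {0, 1}) \<and>
     (\<exists>z1 z2 z3 r'.
        has_ordered_product S T less_rel
          (\<lambda>i. x i [^]\<^bsub>S\<^esub> (2 * a i)) UNIV z1 \<and>
        has_ordered_product S T (less_rel <*lex*> less_rel)
          (\<lambda>(i, j). commutator S (x i) (x j) [^]\<^bsub>S\<^esub> b i j) {(i, j). i < j} z2 \<and>
        has_ordered_product S T (less_rel <*lex*> less_rel <*lex*> less_rel)
          (\<lambda>(i, j, k). commutator S (commutator S (x i) (x j)) (x k) [^]\<^bsub>S\<^esub> c i j k)
          {(i, j, k). i < j \<and> k \<le> j} z3 \<and>
        r' \<in> zassenhaus S T 4 \<and>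
        r = z1 \<otimes>\<^bsub>S\<^esub> z2 \<otimes>\<^bsub>S\<^esub> z3 \<otimes>\<^bsub>S\<^esub> r')"

definition sym_exponent :: "('i::linorder \<Rightarrow> 'i \<Rightarrow> nat) \<Rightarrow> 'i \<Rightarrow> 'i \<Rightarrow> nat" where
  "sym_exponent b i j = (if i < j then b i j else b j i)"

section \<open>The absolute Galois group\<close>

text \<open>The separable closure of the field \<open>'f\<close> inside its algebraic closure: the elements whose
  minimal polynomial over \<open>'f\<close> has only simple roots.\<close>

definition separable_closure :: "'f::field alg_closure set" where
  "separable_closure =
     {z. \<exists>p :: 'f poly. Factorial_Ring.irreducible p \<and> rsquarefree (map_poly to_ac p) \<and>
                        poly (map_poly to_ac p) z = 0}"

definition absolute_galois_group ::
    "'f::field itself \<Rightarrow> ('f alg_closure \<Rightarrow> 'f alg_closure) monoid" where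
  "absolute_galois_group _ =
     \<lparr>carrier = {\<sigma>. \<sigma> \<in> extensional separable_closure \<and>
                    bij_betw \<sigma> separable_closure separable_closure \<and>
                    (\<forall>y\<in>separable_closure. \<forall>z\<in>separable_closure.
                       \<sigma> (y + z) = \<sigma> y + \<sigma> z \<and> \<sigma> (y * z) = \<sigma> y * \<sigma> z) \<and>
                    (\<forall>c::'f. \<sigma> (to_ac c) = to_ac c)},
      monoid.mult = (\<lambda>\<sigma> \<tau>. compose separable_closure \<sigma> \<tau>),
      one = restrict (\<lambda>z. z) separable_closure\<rparr>"

text \<open>The Krull topology: a neighbourhood base of \<open>\<sigma>\<close> is given by the sets of all \<open>\<tau>\<close> that agree
  with \<open>\<sigma>\<close> on a finite subset \<open>A\<close> of the separable closure, i.e. by the cosets of the subgroups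
  fixing the finite extension generated by \<open>A\<close>.\<close>

definition krull_topology :: "'f::field itself \<Rightarrow> ('f alg_closure \<Rightarrow> 'f alg_closure) topology" where
  "krull_topology F =
     subtopology
       (product_topology (\<lambda>_. discrete_topology separable_closure) separable_closure)
       (carrier (absolute_galois_group F))"

definition galois_group_maximal_pro_p ::
    "nat \<Rightarrow> 'f::field itself \<Rightarrow> ('f alg_closure \<Rightarrow> 'f alg_closure) set monoid" where
  "galois_group_maximal_pro_p p F =
     maximal_pro_p_quotient p (absolute_galois_group F) (krull_topology F)"

definition galois_group_maximal_pro_p_topology ::
    "nat \<Rightarrow> 'f::field itself \<Rightarrow> ('f alg_closure \<Rightarrow> 'f alg_closure) set topology" where
  "galois_group_maximal_pro_p_topology p F =
     maximal_pro_p_quotient_topology p (absolute_galois_group F) (krull_topology F)"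

end

theory Submission
  imports Defs "HOL-Library.Z2"
begin

text \<open>
  Let \<open>p\<close> be the index with \<open>c\<^sub>i\<^sub>j\<^sub>p \<noteq> 0\<close>, let \<open>q\<close> be the other element of \<open>{i, j}\<close>, and let
  \<open>\<alpha>, \<beta>\<close> be the characters dual to \<open>x\<^sub>p, x\<^sub>q\<close>. The hypotheses on squares and simple commutators
  say that \<open>\<alpha> \<union> \<alpha> = 0\<close> and \<open>\<alpha> \<union> \<beta> = 0\<close> in \<open>S/\<langle>R\<rangle>\<close>, while the triple commutator in \<open>r\<close> prevents
  the triple Massey product \<open>\<langle>\<alpha>, \<alpha>, \<beta>\<rangle>\<close> from vanishing.

  Over a field this Massey product always vanishes. In characteristic other than \<open>2\<close>, Hilbert 90
  turns the two cup products into elements \<open>\<theta> \<in> F(\<surd>a)\<close> and \<open>\<omega> \<in> F(\<surd>b)\<close> of the quadratic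
  extensions cut out by \<open>\<alpha>\<close> and \<open>\<beta>\<close> with the same norm \<open>\<nu>\<^sup>2\<close>, where \<open>\<nu>\<close> is a multiple of \<open>\<surd>a\<close>.
  Then \<open>(\<theta> + \<omega>) (\<theta> + \<omega>') = \<theta> (tr \<theta> + tr \<omega>)\<close>, so the square roots of the four conjugates of
  \<open>\<theta> + \<omega>\<close> have product \<open>\<plusminus> \<nu> (tr \<theta> + tr \<omega>)\<close>, and the signs in the Galois action on them define a
  homomorphism to unitriangular \<open>4 \<times> 4\<close> matrices over \<open>\<int>/2\<close> with superdiagonal \<open>\<alpha>, \<alpha>, \<beta>\<close>. In
  characteristic \<open>2\<close> the four roots of \<open>y\<^sup>2 + y = (u\<^sup>2 + u) (u + k) (v + l)\<close> with \<open>k, l \<in> {0, 1}\<close>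
  play the same role, where \<open>u, v\<close> are Artin-Schreier generators for \<open>\<alpha>, \<beta>\<close>.
\<close>


hide_const (open) Polynomials.degree Polynomials.lead_coeff UnivPoly.coeff UnivPoly.monom
  Module.smult Divisibility.irreducible Divisibility.prime Coset.order

section \<open>Separable elements of the algebraic closure\<close>

definition ac_eval :: "'f::field poly \<Rightarrow> 'f alg_closure \<Rightarrow> 'f alg_closure" where
  "ac_eval p z = poly (map_poly to_ac p) z"

lemma ac_eval_0 [simp]: "ac_eval 0 z = 0"
  by (simp add: ac_eval_def)

lemma ac_eval_pCons [simp]: "ac_eval (pCons a p) z = to_ac a + z * ac_eval p z"
  by (simp add: ac_eval_def map_poly_pCons)

lemma ac_eval_add [simp]: "ac_eval (p + q) z = ac_eval p z + ac_eval q z"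
  by (induction p q rule: poly_induct2) (simp_all add: algebra_simps)

lemma ac_eval_sum: "ac_eval (sum p I) z = (\<Sum>i\<in>I. ac_eval (p i) z)"
  by (induction I rule: infinite_finite_induct) simp_all

lemma ac_eval_smult [simp]: "ac_eval (smult c p) z = to_ac c * ac_eval p z"
  by (induction p) (simp_all add: algebra_simps)

lemma ac_eval_mult [simp]: "ac_eval (p * q) z = ac_eval p z * ac_eval q z"
  by (induction p) (simp_all add: algebra_simps)

lemma ac_eval_monom [simp]: "ac_eval (monom c n) z = to_ac c * z ^ n"
  by (simp add: ac_eval_def map_poly_monom poly_monom)

lemma ac_eval_pcompose: "ac_eval (pcompose p q) z = ac_eval p (ac_eval q z)"
  by (induction p) (simp_all add: pcompose_pCons)

lemma ac_eval_altdef: "ac_eval p z = (\<Sum>k\<le>degree p. to_ac (coeff p k) * z ^ k)"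
  by (simp add: ac_eval_def poly_altdef degree_map_poly coeff_map_poly)

definition is_min_poly :: "'f::field poly \<Rightarrow> 'f alg_closure \<Rightarrow> bool" where
  "is_min_poly m z \<longleftrightarrow> m \<noteq> 0 \<and> (\<forall>q. ac_eval q z = 0 \<longleftrightarrow> m dvd q)"

lemma is_min_polyD:
  assumes "is_min_poly m z"
  shows "m \<noteq> 0" and "ac_eval m z = 0" and "ac_eval q z = 0 \<longleftrightarrow> m dvd q"
  using assms by (auto simp: is_min_poly_def)

lemma ex_is_min_poly: "\<exists>m. is_min_poly m z"
proof -
  obtain p where p: "p \<noteq> 0 \<and> ac_eval p z = 0"
    using alg_closure_algebraic[of z] by (metis ac_eval_def)
  obtain m where m: "m \<noteq> 0" "ac_eval m z = 0"
    and least: "\<And>q. q \<noteq> 0 \<Longrightarrow> ac_eval q z = 0 \<Longrightarrow> degree m \<le> degree q"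
    using ex_has_least_nat[where P = "\<lambda>p. p \<noteq> 0 \<and> ac_eval p z = 0" and m = degree, OF p] by blast
  have "m dvd q" if "ac_eval q z = 0" for q
  proof -
    have "ac_eval (q div m * m + q mod m) z = 0"
      using that by simp
    then have "ac_eval (q mod m) z = 0"
      using m(2) by (simp only: ac_eval_add ac_eval_mult) simp
    then have "q mod m = 0"
      using least[of "q mod m"] degree_mod_less[OF m(1), of q] by fastforce
    then show ?thesis by auto
  qed
  then show ?thesis
    using m by (auto simp: is_min_poly_def intro!: exI[of _ m])
qed

lemma is_min_poly_degree_pos:
  assumes "is_min_poly m z"
  shows "0 < degree m"
proof (rule ccontr)
  assume "\<not> 0 < degree m"
  then have "m dvd 1"
    using is_min_polyD(1)[OF assms] by (simp add: is_unit_iff_degree)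
  then have "ac_eval 1 z = 0"
    using is_min_polyD(3)[OF assms] by blast
  then show False by (simp add: ac_eval_def)
qed

lemma is_min_poly_irreducible:
  assumes "is_min_poly m z"
  shows "irreducible m"
proof (rule Factorial_Ring.irreducibleI)
  show "\<not> is_unit m"
    using is_min_poly_degree_pos[OF assms] is_min_polyD(1)[OF assms]
    by (simp add: is_unit_iff_degree)
  fix a b assume ab: "m = a * b"
  then have "ac_eval a z = 0 \<or> ac_eval b z = 0"
    using is_min_polyD(2)[OF assms] by simp
  then have "a * b dvd a \<or> a * b dvd b"
    using is_min_polyD(3)[OF assms] ab by simp
  then show "is_unit a \<or> is_unit b"
    using is_min_polyD(1)[OF assms] ab by auto
qed (rule is_min_polyD(1)[OF assms])

lemma irreducible_is_min_poly:
  assumes f: "irreducible f" and root: "ac_eval f z = 0"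
  shows "is_min_poly f z"
proof -
  obtain m where m: "is_min_poly m z" using ex_is_min_poly by blast
  have "m dvd f" using is_min_polyD(3)[OF m] root by blast
  then have "f dvd m"
    using f is_min_poly_irreducible[OF m] irreducibleD' irreducible_not_unit by blast
  then show ?thesis
    using m f \<open>m dvd f\<close> by (auto simp: is_min_poly_def intro: dvd_trans)
qed

lemma inseparable_imp_pderiv_eq_0:
  fixes f :: "'f::field poly"
  assumes f: "irreducible f" and inseparable: "\<not> rsquarefree (map_poly to_ac f)"
  shows "pderiv f = 0"
proof (rule ccontr)
  assume "pderiv f \<noteq> 0"
  let ?F = "map_poly to_ac f"
  have "?F \<noteq> 0" using f by (auto simp: map_poly_eq_0_iff)
  with inseparable obtain y where "Polynomial.order y ?F \<noteq> 0" "Polynomial.order y ?F \<noteq> 1"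
    by (auto simp: rsquarefree_def)
  then have "2 \<le> Polynomial.order y ?F" by linarith
  then have "[:-y, 1:] ^ 2 dvd ?F" by (rule dvd_trans[OF le_imp_power_dvd order_1])
  then obtain k where k: "?F = [:-y, 1:] ^ 2 * k" by blast
  have "map_poly to_ac (pderiv f) = pderiv ?F"
    by (intro poly_eqI) (simp add: coeff_map_poly coeff_pderiv)
  also have "poly (pderiv ?F) y = 0"
    unfolding k power2_eq_square pderiv_mult by simp
  finally have "ac_eval (pderiv f) y = 0" by (simp add: ac_eval_def)
  moreover have m: "is_min_poly f y"
    by (rule irreducible_is_min_poly[OF f]) (simp add: ac_eval_def k)
  ultimately have "degree f \<le> degree (pderiv f)"
    using is_min_polyD(3) \<open>pderiv f \<noteq> 0\<close> by (metis dvd_imp_degree_le)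
  also have "degree (pderiv f) \<le> degree f - 1"
    by (rule degree_le) (simp add: coeff_pderiv coeff_eq_0)
  finally show False
    using is_min_poly_degree_pos[OF m] by linarith
qed

lemma inseparable_coeff_char_dvd:
  fixes w :: "'f::field alg_closure"
  assumes w: "w \<notin> separable_closure" and m: "is_min_poly m w" and k: "coeff m k \<noteq> 0"
  shows "CHAR('f) dvd k"
proof (cases k)
  case (Suc l)
  have "\<not> rsquarefree (map_poly to_ac m)"
    using w is_min_poly_irreducible[OF m] is_min_polyD(2)[OF m]
    by (auto simp: separable_closure_def ac_eval_def)
  then have "coeff (pderiv m) l = 0"
    using inseparable_imp_pderiv_eq_0[OF is_min_poly_irreducible[OF m]] by simp
  then have "(of_nat k :: 'f) = 0"
    using k Suc by (simp add: coeff_pderiv)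
  then show ?thesis by (simp add: of_nat_eq_0_iff_char_dvd)
qed simp

lemma separable_closure_char_0:
  assumes "CHAR('f::field) = 0"
  shows "separable_closure = (UNIV :: 'f alg_closure set)"
proof (intro equalityI subset_UNIV subsetI, rule ccontr)
  fix w :: "'f alg_closure" assume w: "w \<notin> separable_closure"
  obtain m where m: "is_min_poly m w" using ex_is_min_poly by blast
  have "CHAR('f) dvd degree m"
    by (rule inseparable_coeff_char_dvd[OF w m]) (use is_min_polyD(1)[OF m] in simp)
  then show False
    using assms is_min_poly_degree_pos[OF m] by simp
qed

interpretation ac: vector_space "\<lambda>(c::'f::field) (z::'f alg_closure). to_ac c * z"
  by unfold_locales (simp_all add: algebra_simps)

lemma ac_eval_in_span_powers:
  assumes "degree q < n"
  shows "ac_eval q z \<in> ac.span ((\<lambda>l. z ^ l) ` {..<n})"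
  unfolding ac_eval_altdef by (intro ac.span_sum ac.span_scale ac.span_base) (use assms in auto)

lemma power_in_span_powers:
  assumes m: "is_min_poly m z"
  shows "z ^ k \<in> ac.span ((\<lambda>l. z ^ l) ` {..<degree m})"
proof -
  let ?q = "monom 1 k"
  have "z ^ k = ac_eval (?q div m * m + ?q mod m) z" by simp
  also have "\<dots> = ac_eval (?q mod m) z"
    unfolding ac_eval_add ac_eval_mult is_min_polyD(2)[OF m] by simp
  also have "\<dots> \<in> ac.span ((\<lambda>l. z ^ l) ` {..<degree m})"
    using degree_mod_less[OF is_min_polyD(1)[OF m], of ?q] is_min_poly_degree_pos[OF m]
    by (intro ac_eval_in_span_powers) auto
  finally show ?thesis .
qed

definition independent_powers :: "nat \<Rightarrow> 'f::field alg_closure \<Rightarrow> bool" where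
  "independent_powers n z \<longleftrightarrow>
     inj_on (\<lambda>l. z ^ l) {..<n} \<and> ac.independent ((\<lambda>l. z ^ l) ` {..<n})"

lemma independent_powers_imp_degree_ge:
  assumes indep: "independent_powers n z" and q: "q \<noteq> 0" "ac_eval q z = 0"
  shows "n \<le> degree q"
proof (rule ccontr)
  assume "\<not> n \<le> degree q"
  let ?g = "\<lambda>v. coeff q (the_inv_into {..<n} (\<lambda>l. z ^ l) v)"
  have inj: "inj_on (\<lambda>l. z ^ l) {..<n}" using indep by (simp add: independent_powers_def)
  have "0 = (\<Sum>l\<le>degree q. to_ac (coeff q l) * z ^ l)"
    using q(2) by (simp add: ac_eval_altdef)
  also have "\<dots> = (\<Sum>l<n. to_ac (coeff q l) * z ^ l)"
    by (rule sum.mono_neutral_left) (use \<open>\<not> n \<le> degree q\<close> in \<open>auto simp: coeff_eq_0\<close>)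
  also have "\<dots> = (\<Sum>v\<in>(\<lambda>l. z ^ l) ` {..<n}. to_ac (?g v) * v)"
    using inj by (simp add: sum.reindex the_inv_into_f_f)
  finally have "?g (z ^ degree q) = 0"
    using indep \<open>\<not> n \<le> degree q\<close>
    by (intro ac.independentD[of "(\<lambda>l. z ^ l) ` {..<n}"]) (auto simp: independent_powers_def)
  then have "coeff q (degree q) = 0"
    using inj \<open>\<not> n \<le> degree q\<close> by (simp add: the_inv_into_f_f)
  then show False using q(1) by simp
qed

lemma degree_ge_imp_independent_powers:
  assumes min: "\<And>q. q \<noteq> 0 \<Longrightarrow> ac_eval q z = 0 \<Longrightarrow> n \<le> degree q"
  shows "independent_powers n z"
proof -
  have trivial: "\<forall>l<n. c l = 0" if "(\<Sum>l<n. to_ac (c l) * z ^ l) = 0" for c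
  proof (rule ccontr)
    let ?q = "\<Sum>l<n. monom (c l) l"
    assume "\<not> (\<forall>l<n. c l = 0)"
    then obtain l where "l < n" "c l \<noteq> 0" by blast
    then have "coeff ?q l \<noteq> 0" by (simp add: coeff_sum)
    then have "?q \<noteq> 0" by (metis coeff_0)
    moreover have "ac_eval ?q z = 0" using that by (simp add: ac_eval_sum)
    ultimately have "n \<le> degree ?q" by (rule min)
    moreover have "degree ?q < n"
      using \<open>l < n\<close> by (intro degree_sum_less) (auto intro: le_less_trans[OF degree_monom_le])
    ultimately show False by simp
  qed
  have inj: "inj_on (\<lambda>l. z ^ l) {..<n}"
  proof (rule inj_onI, rule ccontr)
    fix k l assume kl: "k \<in> {..<n}" "l \<in> {..<n}" "z ^ k = z ^ l" "k \<noteq> l"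
    let ?c = "\<lambda>i. if i = k then 1 else if i = l then -1 else 0"
    have "(\<Sum>i<n. to_ac (?c i) * z ^ i) = (\<Sum>i\<in>{k, l}. to_ac (?c i) * z ^ i)"
      by (rule sum.mono_neutral_right) (use kl in auto)
    then show False using trivial[of ?c] kl by auto
  qed
  moreover have "ac.independent ((\<lambda>l. z ^ l) ` {..<n})"
    unfolding ac.dependent_finite[OF finite_imageI[OF finite_lessThan]]
    using trivial inj by (fastforce simp: sum.reindex)
  ultimately show ?thesis by (simp add: independent_powers_def)
qed

lemma ac_span_mult:
  assumes "u \<in> ac.span A" and "v \<in> ac.span B"
  shows "u * v \<in> ac.span ((\<lambda>(a, b). a * b) ` (A \<times> B))"
  using assms(1)
proof (induction rule: ac.span_induct_alt)
  case (step c a u)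
  have "a * v \<in> ac.span ((\<lambda>(a, b). a * b) ` (A \<times> B))"
    using assms(2)
  proof (induction rule: ac.span_induct_alt)
    case (step c b v)
    have "a * (to_ac c * b + v) = to_ac c * (a * b) + a * v" by (simp add: algebra_simps)
    with step \<open>a \<in> A\<close> show ?case
      by (auto intro!: ac.span_add ac.span_scale intro: ac.span_base)
  qed (simp add: ac.span_zero)
  with step show ?case
    by (simp add: distrib_right mult.assoc) (intro ac.span_add ac.span_scale)
qed (simp add: ac.span_zero)

inductive_set ac_adjoin :: "'f::field alg_closure set \<Rightarrow> 'f alg_closure set" for G where
  const: "to_ac c \<in> ac_adjoin G"
| gen: "g \<in> G \<Longrightarrow> g \<in> ac_adjoin G"
| add: "u \<in> ac_adjoin G \<Longrightarrow> v \<in> ac_adjoin G \<Longrightarrow> u + v \<in> ac_adjoin G"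
| mult: "u \<in> ac_adjoin G \<Longrightarrow> v \<in> ac_adjoin G \<Longrightarrow> u * v \<in> ac_adjoin G"

lemma ac_adjoin_0: "0 \<in> ac_adjoin G" and ac_adjoin_1: "1 \<in> ac_adjoin G"
  using ac_adjoin.const[of 0 G] ac_adjoin.const[of 1 G] by simp_all

lemma ac_adjoin_minus: "u \<in> ac_adjoin G \<Longrightarrow> - u \<in> ac_adjoin G"
  using ac_adjoin.mult[OF ac_adjoin.const[of "-1"], of u G] by simp

lemma ac_adjoin_power: "u \<in> ac_adjoin G \<Longrightarrow> u ^ n \<in> ac_adjoin G"
  by (induction n) (auto intro: ac_adjoin_1 ac_adjoin.mult)

lemma ac_adjoin_subset:
  assumes "G \<subseteq> ac_adjoin H"
  shows "ac_adjoin G \<subseteq> ac_adjoin H"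
proof
  fix u assume "u \<in> ac_adjoin G"
  then show "u \<in> ac_adjoin H"
    by induction (use assms in \<open>auto intro: ac_adjoin.intros\<close>)
qed

lemma ac_adjoin_mono: "G \<subseteq> H \<Longrightarrow> ac_adjoin G \<subseteq> ac_adjoin H"
  by (rule ac_adjoin_subset) (auto intro: ac_adjoin.gen)

lemma ac_eval_in_ac_adjoin: "z \<in> ac_adjoin G \<Longrightarrow> ac_eval q z \<in> ac_adjoin G"
  by (induction q) (auto intro: ac_adjoin.intros ac_adjoin_0)

lemma subspace_ac_adjoin: "ac.subspace (ac_adjoin G)"
  by (intro ac.subspaceI) (auto intro: ac_adjoin.const ac_adjoin.add ac_adjoin.mult ac_adjoin_0)

lemma ac_adjoin_subset_span:
  assumes one: "1 \<in> S" and mult: "\<And>u v. u \<in> S \<Longrightarrow> v \<in> S \<Longrightarrow> u * v \<in> S" and G: "G \<subseteq> S"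
  shows "ac_adjoin G \<subseteq> ac.span S"
proof
  fix u assume "u \<in> ac_adjoin G"
  then show "u \<in> ac.span S"
  proof induction
    case (const c)
    show ?case using ac.span_scale[OF ac.span_base[OF one], of c] by simp
  next
    case (gen g)
    then show ?case using G by (auto intro: ac.span_base)
  next
    case (add u v)
    then show ?case by (blast intro: ac.span_add)
  next
    case (mult u v)
    have "(\<lambda>(a, b). a * b) ` (S \<times> S) \<subseteq> S" using assms(2) by auto
    then show ?case using ac_span_mult[OF mult.IH] ac.span_mono by blast
  qed
qed

lemma ac_adjoin_finite_dim:
  fixes G :: "'f::field alg_closure set"
  assumes "finite G"
  shows "\<exists>B. finite B \<and> ac_adjoin G \<subseteq> ac.span B"
  using assms
proof (induction G)
  case empty
  show ?case by (intro exI[of _ "{1}"] conjI ac_adjoin_subset_span) auto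
next
  case (insert g G)
  then obtain B where B: "finite B" "ac_adjoin G \<subseteq> ac.span B" by blast
  obtain m where m: "is_min_poly m g" using ex_is_min_poly by blast
  let ?P = "(\<lambda>l. g ^ l) ` {..<degree m}"
  let ?S = "{u * g ^ k | u k. u \<in> ac_adjoin G}"
  let ?C = "(\<lambda>(a, b). a * b) ` (B \<times> ?P)"
  have "ac_adjoin (insert g G) \<subseteq> ac.span ?S"
  proof (rule ac_adjoin_subset_span)
    show "1 \<in> ?S" by (rule CollectI) (metis ac_adjoin_1 mult_1 power_0)
    show "u * v \<in> ?S" if uv: "u \<in> ?S" "v \<in> ?S" for u v
    proof -
      obtain a k b l where "u = a * g ^ k" "v = b * g ^ l" "a \<in> ac_adjoin G" "b \<in> ac_adjoin G"
        using uv by blast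
      then show ?thesis
        by (intro CollectI exI[of _ "a * b"] exI[of _ "k + l"])
          (auto simp: power_add mult_ac intro: ac_adjoin.mult)
    qed
    show "insert g G \<subseteq> ?S"
    proof (intro insert_subsetI subsetI)
      show "g \<in> ?S" by (rule CollectI) (metis ac_adjoin_1 mult_1 power_one_right)
      show "h \<in> ?S" if "h \<in> G" for h
        using ac_adjoin.gen[OF that] by (intro CollectI exI[of _ h] exI[of _ 0]) simp
    qed
  qed
  also have "\<dots> \<subseteq> ac.span ?C"
    using B(2) power_in_span_powers[OF m] by (intro ac.span_minimal) (auto intro!: ac_span_mult)
  finally show ?case
    using B(1) by (intro exI[of _ ?C]) simp
qed

lemma inverse_in_ac_adjoin: "inverse z \<in> ac_adjoin {z}"
proof (cases "z = 0")
  case False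
  obtain m where m: "is_min_poly m z" using ex_is_min_poly by blast
  obtain c q where q: "m = pCons c q" by (cases m)
  have eq: "to_ac c + z * ac_eval q z = 0"
    using is_min_polyD(2)[OF m] q by simp
  have "c \<noteq> 0"
  proof
    assume "c = 0"
    with eq False is_min_polyD(3)[OF m] have "m dvd q" by simp
    moreover have "q \<noteq> 0" using is_min_polyD(1)[OF m] q \<open>c = 0\<close> by auto
    ultimately show False using dvd_imp_degree_le[of m q] q by simp
  qed
  then have "inverse z = to_ac (- inverse c) * ac_eval q z"
    using eq False by (simp add: field_simps eq_neg_iff_add_eq_0)
  also have "\<dots> \<in> ac_adjoin {z}"
    by (intro ac_adjoin.mult ac_adjoin.const ac_eval_in_ac_adjoin ac_adjoin.gen) simp
  finally show ?thesis .
qed (simp add: ac_adjoin_0)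

lemma size_proots_alg_closed:
  fixes P :: "'a::alg_closed_field poly"
  shows "size (proots P) = degree P"
proof (cases "P = 0")
  case False
  then obtain A where A: "size A = degree P" "P = smult (lead_coeff P) (\<Prod>x\<in>#A. [:-x, 1:])"
    using alg_closed_imp_factorization by blast
  have "proots P = proots (\<Prod>x\<in>#A. [:-x, 1:])"
    using False by (subst A(2), subst proots_smult) auto
  also have "\<dots> = A"
  proof (induction A)
    case (add x A)
    have "(\<Prod>x\<in>#A. [:-x, 1:]) \<noteq> 0" by (auto simp: prod_mset_zero_iff)
    then show ?case using add by (simp add: proots_mult del: mult_pCons_left)
  qed simp
  finally show ?thesis using A(1) by simp
qed simp

lemma rsquarefree_card_roots:
  fixes P :: "'a::alg_closed_field poly"
  assumes P: "rsquarefree P"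
  shows "card {y. poly P y = 0} = degree P"
proof -
  have "P \<noteq> 0" using P by (simp add: rsquarefree_def)
  then have "proots P = mset_set {y. poly P y = 0}"
    using rsquarefree_root_order[OF P] poly_roots_finite
    by (intro multiset_eqI) (auto simp: count_mset_set' order_0I)
  then show ?thesis
    using size_proots_alg_closed[of P] by simp
qed

text \<open>In characteristic \<open>p > 0\<close> an element \<open>z\<close> is separable over \<open>k\<close> exactly if
  \<open>k[z] = k[z\<^sup>p]\<close>. If the generators of a finite-dimensional algebra \<open>E\<close> have this property, then
  \<open>E\<close> is spanned by \<open>p\<close>-th powers, so by counting dimensions Frobenius preserves linear independence
  in \<open>E\<close>. This excludes elements whose minimal polynomial is a polynomial in \<open>X\<^sup>p\<close>.\<close>

context
  fixes p :: nat and field_type :: "'f::field itself"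
  assumes p: "p = CHAR('f)" "p > 0"
begin

lemma prime_char: "prime p"
  using prime_CHAR_semidom[where ?'a = 'f] p by simp

lemma frobenius_add: "(u + v) ^ p = u ^ p + v ^ p" for u v :: "'f alg_closure"
  using freshmans_dream[of p u v] prime_char p by simp

lemma frobenius_eq_iff: "u ^ p = v ^ p \<longleftrightarrow> u = v" for u v :: "'f alg_closure"
  using frobenius_add[of v "u - v"] p(2) by auto

lemma frobenius_in_span:
  fixes u :: "'f alg_closure"
  assumes "u \<in> ac.span B"
  shows "u ^ p \<in> ac.span ((\<lambda>b. b ^ p) ` B)"
  using assms
proof (induction rule: ac.span_induct_alt)
  case (step c b u)
  have "(to_ac c * b + u) ^ p = to_ac (c ^ p) * b ^ p + u ^ p"
    by (simp add: frobenius_add power_mult_distrib)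
  with step show ?case
    by (auto intro!: ac.span_add ac.span_scale intro: ac.span_base simp del: to_ac_power)
qed (use p(2) in \<open>simp add: ac.span_zero zero_power\<close>)

lemma independent_frobenius_image:
  fixes E :: "'f alg_closure set"
  assumes fin: "finite C" "E \<subseteq> ac.span C" and frob: "E \<subseteq> ac.span ((\<lambda>u. u ^ p) ` E)"
    and I: "I \<subseteq> E" "ac.independent I"
  shows "ac.independent ((\<lambda>u. u ^ p) ` I)"
proof
  assume dep: "ac.dependent ((\<lambda>u. u ^ p) ` I)"
  obtain B where B: "I \<subseteq> B" "B \<subseteq> E" "ac.independent B" "E \<subseteq> ac.span B"
    using ac.maximal_independent_subset_extend[OF I] by blast
  have "finite B"
    using ac.independent_span_bound[OF fin(1) B(3)] B(2) fin(2) by auto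
  let ?B' = "(\<lambda>u. u ^ p) ` B"
  have "ac.dependent ?B'"
    by (rule ac.dependent_mono[OF dep image_mono[OF B(1)]])
  then obtain b where b: "b \<in> ?B'" "b \<in> ac.span (?B' - {b})"
    by (auto simp: ac.dependent_def)
  have "B \<subseteq> ac.span ?B'"
  proof -
    have "(\<lambda>u. u ^ p) ` E \<subseteq> ac.span ?B'"
      using B(4) frobenius_in_span by blast
    then show ?thesis
      using B(2) frob ac.span_minimal[OF _ ac.subspace_span] by blast
  qed
  also have "\<dots> \<subseteq> ac.span (?B' - {b})"
    using b(2) ac.span_superset[of "?B' - {b}"] by (intro ac.span_minimal ac.subspace_span) blast
  finally have "card B \<le> card (?B' - {b})"
    using ac.independent_span_bound[OF _ B(3), of "?B' - {b}"] \<open>finite B\<close> by simp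
  also have "\<dots> < card ?B'"
    using b(1) \<open>finite B\<close> by (intro card_Diff1_less) auto
  also have "\<dots> \<le> card B"
    by (rule card_image_le[OF \<open>finite B\<close>])
  finally show False by simp
qed

lemma inseparable_imp_frobenius_root:
  fixes w :: "'f alg_closure"
  assumes w: "w \<notin> separable_closure" and m: "is_min_poly m w"
  shows "\<exists>q. q \<noteq> 0 \<and> degree q < degree m \<and> ac_eval q (w ^ p) = 0"
proof -
  have dvd: "p dvd k" if "coeff m k \<noteq> 0" for k
    using inseparable_coeff_char_dvd[OF w m that] p(1) by simp
  have "coeff m (degree m) \<noteq> 0" using is_min_polyD(1)[OF m] by simp
  from dvd[OF this] obtain d where d: "degree m = p * d" by blast
  define q where "q = (\<Sum>k\<le>d. monom (coeff m (p * k)) k)"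
  have "coeff q d \<noteq> 0"
    using is_min_polyD(1)[OF m] d by (simp add: q_def coeff_sum_monom flip: d)
  then have "q \<noteq> 0" by auto
  moreover have "degree q < degree m"
  proof -
    have "degree q \<le> d"
      unfolding q_def by (intro degree_sum_le) (auto intro: order_trans[OF degree_monom_le])
    also have "d < p * d"
      using is_min_poly_degree_pos[OF m] d prime_gt_1_nat[OF prime_char] by simp
    finally show ?thesis using d by simp
  qed
  moreover have "ac_eval q (w ^ p) = 0"
  proof -
    have "ac_eval q (w ^ p) = (\<Sum>k\<in>(\<lambda>k. p * k) ` {..d}. to_ac (coeff m k) * w ^ k)"
      by (subst sum.reindex) (use p(2) in \<open>auto simp: inj_on_def q_def ac_eval_sum power_mult\<close>)
    also have "\<dots> = (\<Sum>k\<le>degree m. to_ac (coeff m k) * w ^ k)"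
    proof (rule sum.mono_neutral_left)
      show "\<forall>k\<in>{..degree m} - (\<lambda>k. p * k) ` {..d}. to_ac (coeff m k) * w ^ k = 0"
      proof
        fix k assume k: "k \<in> {..degree m} - (\<lambda>k. p * k) ` {..d}"
        then have "\<not> p dvd k" using d p(2) by (auto elim!: dvdE)
        then show "to_ac (coeff m k) * w ^ k = 0" using dvd[of k] by auto
      qed
    qed (use d in auto)
    also have "\<dots> = 0"
      using is_min_polyD(2)[OF m] by (simp add: ac_eval_altdef)
    finally show ?thesis .
  qed
  ultimately show ?thesis by blast
qed

lemma ac_adjoin_subset_separable_closure:
  fixes G :: "'f alg_closure set"
  assumes fin: "finite G" and gen: "G \<subseteq> ac_adjoin ((\<lambda>g. g ^ p) ` G)"
  shows "ac_adjoin G \<subseteq> separable_closure"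
proof (rule subsetI, rule ccontr)
  fix w assume w: "w \<in> ac_adjoin G" "w \<notin> separable_closure"
  obtain m where m: "is_min_poly m w" using ex_is_min_poly by blast
  obtain q where q: "q \<noteq> 0" "degree q < degree m" "ac_eval q (w ^ p) = 0"
    using inseparable_imp_frobenius_root[OF w(2) m] by blast
  have powers: "independent_powers (degree m) w"
    by (rule degree_ge_imp_independent_powers)
      (use is_min_polyD(3)[OF m] in \<open>auto intro: dvd_imp_degree_le\<close>)
  obtain C where C: "finite C" "ac_adjoin G \<subseteq> ac.span C"
    using ac_adjoin_finite_dim[OF fin] by blast
  have "ac_adjoin G \<subseteq> ac_adjoin ((\<lambda>g. g ^ p) ` G)"
    by (rule ac_adjoin_subset[OF gen])
  also have "\<dots> \<subseteq> ac.span ((\<lambda>u. u ^ p) ` ac_adjoin G)"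
  proof (rule ac_adjoin_subset_span)
    show "1 \<in> (\<lambda>u. u ^ p) ` ac_adjoin G"
      using ac_adjoin_1 by (intro image_eqI[of _ _ 1]) auto
  qed (auto simp flip: power_mult_distrib intro: ac_adjoin.mult ac_adjoin.gen)
  finally have "ac.independent ((\<lambda>u. u ^ p) ` (\<lambda>l. w ^ l) ` {..<degree m})"
    using powers w(1)
    by (intro independent_frobenius_image[OF C]) (auto simp: independent_powers_def ac_adjoin_power)
  moreover have "inj_on (\<lambda>l. (w ^ p) ^ l) {..<degree m}"
  proof -
    have "inj_on (\<lambda>l. (w ^ l) ^ p) {..<degree m}"
      using powers by (simp add: independent_powers_def inj_on_def frobenius_eq_iff)
    then show ?thesis by (simp add: power_commutes flip: power_mult) (simp add: mult.commute)
  qed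
  ultimately have "independent_powers (degree m) (w ^ p)"
    by (simp add: independent_powers_def image_image mult.commute flip: power_mult)
  then have "degree m \<le> degree q"
    by (rule independent_powers_imp_degree_ge[OF _ q(1,3)])
  then show False using q(2) by simp
qed

lemma separable_frobenius_degree_ge:
  fixes z :: "'f alg_closure"
  assumes f: "irreducible f" "rsquarefree (map_poly to_ac f)" "ac_eval f z = 0"
    and q: "q \<noteq> 0" "ac_eval q (z ^ p) = 0"
  shows "degree f \<le> degree q"
proof -
  let ?roots = "\<lambda>h. {y. poly (map_poly to_ac h) y = 0}"
  have "ac_eval (pcompose q (monom 1 p)) z = 0"
    using q(2) by (simp add: ac_eval_pcompose)
  then have "f dvd pcompose q (monom 1 p)"
    using is_min_polyD(3)[OF irreducible_is_min_poly[OF f(1,3)]] by blast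
  then obtain k where k: "pcompose q (monom 1 p) = f * k" by blast
  have "ac_eval q (y ^ p) = 0" if "ac_eval f y = 0" for y
    using arg_cong[OF k, of "\<lambda>h. ac_eval h y"] that by (simp add: ac_eval_pcompose)
  then have "(\<lambda>y. y ^ p) ` ?roots f \<subseteq> ?roots q"
    by (auto simp: ac_eval_def)
  then have "card ((\<lambda>y. y ^ p) ` ?roots f) \<le> card (?roots q)"
    using q(1) by (intro card_mono poly_roots_finite) (auto simp: map_poly_eq_0_iff)
  also have "card (?roots q) \<le> degree q"
    using q(1) card_poly_roots_bound[of "map_poly to_ac q"]
    by (simp add: map_poly_eq_0_iff degree_map_poly)
  also have "card ((\<lambda>y. y ^ p) ` ?roots f) = degree f"
    using rsquarefree_card_roots[OF f(2)]
    by (simp add: card_image inj_on_def frobenius_eq_iff degree_map_poly)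
  finally show ?thesis .
qed

lemma separable_imp_in_ac_adjoin_frobenius:
  fixes z :: "'f alg_closure"
  assumes z: "z \<in> separable_closure"
  shows "z \<in> ac_adjoin {z ^ p}"
proof -
  obtain f where f: "irreducible f" "rsquarefree (map_poly to_ac f)" "ac_eval f z = 0"
    using z by (auto simp: separable_closure_def ac_eval_def)
  let ?P = "(\<lambda>l. (z ^ p) ^ l) ` {..<degree f}"
  let ?Q = "(\<lambda>l. z ^ l) ` {..<degree f}"
  note span = power_in_span_powers[OF irreducible_is_min_poly[OF f(1,3)]]
  have "independent_powers (degree f) (z ^ p)"
    by (intro degree_ge_imp_independent_powers separable_frobenius_degree_ge[OF f])
  then have P: "ac.independent ?P" "card ?P = degree f"
    by (auto simp: independent_powers_def card_image)
  have "z \<in> ac.span ?P"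
  proof (rule ccontr)
    assume "z \<notin> ac.span ?P"
    then have "ac.independent (insert z ?P)" using P(1) ac.independent_insertI by blast
    moreover have "insert z ?P \<subseteq> ac.span ?Q"
      using span[of 1] span by (auto simp flip: power_mult)
    ultimately have "card (insert z ?P) \<le> card ?Q"
      using ac.independent_span_bound[of ?Q "insert z ?P"] by simp
    also have "\<dots> \<le> card ?P"
      using card_image_le[of "{..<degree f}" "\<lambda>l. z ^ l"] P(2) by simp
    also have "\<dots> < card (insert z ?P)"
      using \<open>z \<notin> ac.span ?P\<close> ac.span_base[of z ?P] by (subst card_insert_disjoint) auto
    finally show False by simp
  qed
  also have "\<dots> \<subseteq> ac_adjoin {z ^ p}"
    by (rule ac.span_minimal[OF _ subspace_ac_adjoin]) (auto intro: ac_adjoin_power ac_adjoin.gen)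
  finally show ?thesis .
qed

lemma separable_subset_ac_adjoin_frobenius_image:
  fixes G H :: "'f alg_closure set"
  assumes "G \<subseteq> separable_closure" and "G \<subseteq> H"
  shows "G \<subseteq> ac_adjoin ((\<lambda>g. g ^ p) ` H)"
proof
  fix g assume "g \<in> G"
  then have "g \<in> ac_adjoin {g ^ p}"
    using separable_imp_in_ac_adjoin_frobenius assms(1) by blast
  also have "\<dots> \<subseteq> ac_adjoin ((\<lambda>g. g ^ p) ` H)"
    using \<open>g \<in> G\<close> assms(2) by (intro ac_adjoin_mono) auto
  finally show "g \<in> ac_adjoin ((\<lambda>g. g ^ p) ` H)" .
qed

lemma separable_over_separable:
  fixes y :: "'f alg_closure"
  assumes G: "finite G" "G \<subseteq> separable_closure" and y: "y \<in> ac_adjoin (insert (y ^ p) G)"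
  shows "y \<in> separable_closure"
proof -
  have G': "G \<subseteq> ac_adjoin ((\<lambda>g. g ^ p) ` insert y G)"
    by (rule separable_subset_ac_adjoin_frobenius_image[OF G(2)]) blast
  then have "insert (y ^ p) G \<subseteq> ac_adjoin ((\<lambda>g. g ^ p) ` insert y G)"
    by (auto intro: ac_adjoin.gen)
  then have "y \<in> ac_adjoin ((\<lambda>g. g ^ p) ` insert y G)"
    using ac_adjoin_subset y by blast
  with G' have "ac_adjoin (insert y G) \<subseteq> separable_closure"
    using G(1) by (intro ac_adjoin_subset_separable_closure) auto
  then show ?thesis by (auto intro: ac_adjoin.gen)
qed

end

lemma ac_adjoin_separable:
  fixes G :: "'f::field alg_closure set"
  assumes "finite G" "G \<subseteq> separable_closure"
  shows "ac_adjoin G \<subseteq> separable_closure"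
proof (cases "CHAR('f) = 0")
  case False
  then show ?thesis
    using assms
    by (intro ac_adjoin_subset_separable_closure[OF refl]
        separable_subset_ac_adjoin_frobenius_image[OF refl]) auto
qed (simp add: separable_closure_char_0)

lemma separable_closure_add:
  "u \<in> separable_closure \<Longrightarrow> v \<in> separable_closure \<Longrightarrow> u + v \<in> separable_closure"
  by (rule subsetD[OF ac_adjoin_separable[of "{u, v}"]]) (auto intro: ac_adjoin.intros)

lemma separable_closure_mult:
  "u \<in> separable_closure \<Longrightarrow> v \<in> separable_closure \<Longrightarrow> u * v \<in> separable_closure"
  by (rule subsetD[OF ac_adjoin_separable[of "{u, v}"]]) (auto intro: ac_adjoin.intros)

lemma separable_closure_to_ac: "to_ac c \<in> separable_closure"
  by (rule subsetD[OF ac_adjoin_separable[of "{}"]]) (auto intro: ac_adjoin.intros)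

lemma separable_closure_minus: "u \<in> separable_closure \<Longrightarrow> - u \<in> separable_closure"
  by (rule subsetD[OF ac_adjoin_separable[of "{u}"]]) (auto intro: ac_adjoin.intros ac_adjoin_minus)

lemma separable_closure_inverse: "u \<in> separable_closure \<Longrightarrow> inverse u \<in> separable_closure"
  by (rule subsetD[OF ac_adjoin_separable[of "{u}"]]) (auto intro: inverse_in_ac_adjoin)

lemma separable_closure_sqrt:
  fixes y :: "'f::field alg_closure"
  assumes char: "CHAR('f) \<noteq> 2" and y: "y * y \<in> separable_closure"
  shows "y \<in> separable_closure"
proof (cases "CHAR('f) = 0 \<or> y = 0")
  case True
  then show ?thesis
    using separable_closure_char_0[where 'f = 'f] separable_closure_to_ac[of 0] by auto
next
  case False
  then have "prime (CHAR('f))" by (simp add: prime_CHAR_semidom)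
  then have "odd (CHAR('f))"
    using char prime_odd_nat[of "CHAR('f)"] prime_ge_2_nat[of "CHAR('f)"] by linarith
  then obtain k where k: "CHAR('f) = 2 * k + 1" by (auto elim: oddE)
  have "y ^ CHAR('f) = y * (y * y) ^ k" by (simp add: k power_mult power2_eq_square)
  then have "y = y ^ CHAR('f) * inverse (y * y) ^ k"
    using False by (simp add: field_simps flip: power_inverse)
  also have "\<dots> \<in> ac_adjoin (insert (y ^ CHAR('f)) {inverse (y * y)})"
    by (intro ac_adjoin.mult ac_adjoin_power[of "inverse (y * y)"] ac_adjoin.gen) auto
  finally show ?thesis
    using False y
    by (intro separable_over_separable[OF refl]) (auto dest: separable_closure_inverse)
qed

lemma separable_closure_artin_schreier:
  fixes y :: "'f::field alg_closure"
  assumes "CHAR('f) = 2" and y: "y * y + y \<in> separable_closure"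
  shows "y \<in> separable_closure"
proof -
  have "y = (y * y + y) + - (y ^ 2)" by (simp add: power2_eq_square)
  also have "\<dots> \<in> ac_adjoin (insert (y ^ 2) {y * y + y})"
    by (intro ac_adjoin.add[of "y * y + y"] ac_adjoin_minus ac_adjoin.gen) auto
  finally show ?thesis
    using assms by (intro separable_over_separable[of 2 "{y * y + y}" y]) auto
qed

section \<open>Unitriangular matrices over the field with two elements\<close>

declare add_bit_eq_xor [simp del] mult_bit_eq_and [simp del]

lemma bit_add_self [simp]: "x + x = 0" "x + (x + y) = y" for x y :: bit
  by (cases x; simp add: add.assoc[symmetric])+

lemma bit_mult_self [simp]: "x * x = x" "x * (x * y) = x * y" for x y :: bit
  by (cases x; simp)+

lemma UNIV_bit: "(UNIV :: bit set) = {0, 1}"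
  by (auto intro: bit.exhaust)

instance bit :: finite
  by standard (simp add: UNIV_bit)

text \<open>\<open>((a, b, c), (d, e), f)\<close> stands for the upper unitriangular \<open>4 \<times> 4\<close> matrix with
  superdiagonals \<open>(a, b, c)\<close>, \<open>(d, e)\<close> and \<open>(f)\<close>. Omitting \<open>f\<close> is dividing out the center.\<close>

definition U4 :: "((bit \<times> bit \<times> bit) \<times> (bit \<times> bit) \<times> bit) monoid" where
  "U4 = \<lparr>carrier = UNIV,
     monoid.mult = (\<lambda>((a, b, c), (d, e), f) ((a', b', c'), (d', e'), f').
       ((a + a', b + b', c + c'), (d + d' + a * b', e + e' + b * c'), f + f' + a * e' + d * c')),
     one = ((0, 0, 0), (0, 0), 0)\<rparr>"

definition U4_mod_center :: "((bit \<times> bit \<times> bit) \<times> bit \<times> bit) monoid" where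
  "U4_mod_center = \<lparr>carrier = UNIV,
     monoid.mult = (\<lambda>((a, b, c), (d, e)) ((a', b', c'), (d', e')).
       ((a + a', b + b', c + c'), (d + d' + a * b', e + e' + b * c'))),
     one = ((0, 0, 0), (0, 0))\<rparr>"

definition forget_corner :: "'a \<times> 'b \<times> 'c \<Rightarrow> 'a \<times> 'b" where
  "forget_corner = (\<lambda>(x, y, z). (x, y))"

lemma carrier_U4 [simp]: "carrier U4 = UNIV"
  and one_U4: "\<one>\<^bsub>U4\<^esub> = ((0, 0, 0), (0, 0), 0)"
  and mult_U4: "((a, b, c), (d, e), f) \<otimes>\<^bsub>U4\<^esub> ((a', b', c'), (d', e'), f') =
      ((a + a', b + b', c + c'), (d + d' + a * b', e + e' + b * c'), f + f' + a * e' + d * c')"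
  by (simp_all add: U4_def)

lemma carrier_U4_mod_center [simp]: "carrier U4_mod_center = UNIV"
  and one_U4_mod_center: "\<one>\<^bsub>U4_mod_center\<^esub> = ((0, 0, 0), (0, 0))"
  and mult_U4_mod_center: "((a, b, c), (d, e)) \<otimes>\<^bsub>U4_mod_center\<^esub> ((a', b', c'), (d', e')) =
      ((a + a', b + b', c + c'), (d + d' + a * b', e + e' + b * c'))"
  by (simp_all add: U4_mod_center_def)

lemma group_U4: "group U4"
proof (rule groupI)
  fix x assume "x \<in> carrier U4"
  obtain a b c d e f where x: "x = ((a, b, c), (d, e), f)" by (metis prod.exhaust)
  show "\<exists>y\<in>carrier U4. y \<otimes>\<^bsub>U4\<^esub> x = \<one>\<^bsub>U4\<^esub>"
    by (intro bexI[of _ "((a, b, c), (d + a * b, e + b * c), f + a * e + (d + a * b) * c)"])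
      (simp_all add: x mult_U4 one_U4)
qed (auto simp: split_paired_all mult_U4 one_U4 algebra_simps)

lemma inv_U4:
  "inv\<^bsub>U4\<^esub> ((a, b, c), (d, e), f) =
     ((a, b, c), (d + a * b, e + b * c), f + a * e + (d + a * b) * c)"
  by (rule group.inv_equality[OF group_U4]) (simp_all add: mult_U4 one_U4)

lemma group_U4_mod_center: "group U4_mod_center"
proof (rule groupI)
  fix x assume "x \<in> carrier U4_mod_center"
  obtain a b c d e where x: "x = ((a, b, c), (d, e))" by (metis prod.exhaust)
  show "\<exists>y\<in>carrier U4_mod_center. y \<otimes>\<^bsub>U4_mod_center\<^esub> x = \<one>\<^bsub>U4_mod_center\<^esub>"
    by (intro bexI[of _ "((a, b, c), (d + a * b, e + b * c))"])
      (simp_all add: x mult_U4_mod_center one_U4_mod_center)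
qed (auto simp: split_paired_all mult_U4_mod_center one_U4_mod_center algebra_simps)

lemma card_U4: "card (carrier U4) = 2 ^ 6"
proof -
  have "CARD(bit) = 2" by (simp add: UNIV_bit)
  then show ?thesis by simp
qed

lemma forget_corner_hom: "forget_corner \<in> hom U4 U4_mod_center"
  by (auto simp: hom_def forget_corner_def mult_U4 mult_U4_mod_center)

lemma (in group) commutator_eqI:
  assumes "x \<in> carrier G" "y \<in> carrier G" "z \<in> carrier G" and "y \<otimes> x \<otimes> z = x \<otimes> y"
  shows "commutator G x y = z"
proof -
  have "commutator G x y = inv (y \<otimes> x) \<otimes> (x \<otimes> y)"
    using assms(1,2) by (simp add: commutator_def inv_mult_group m_assoc)
  also have "\<dots> = inv (y \<otimes> x) \<otimes> (y \<otimes> x) \<otimes> z"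
    using assms(1-3) by (simp only: assms(4)[symmetric] m_assoc m_closed inv_closed)
  also have "\<dots> = z"
    using assms(1-3) by simp
  finally show ?thesis .
qed

lemma commutator_U4:
  "commutator U4 ((a, b, c), (d, e), f) ((a', b', c'), (d', e'), f') =
     ((0, 0, 0), (a * b' + a' * b, b * c' + b' * c),
      a * e' + a' * e + d * c' + d' * c + (a + a') * (b * c' + b' * c))"
  by (rule group.commutator_eqI[OF group_U4]) (simp_all add: mult_U4 algebra_simps)

lemma commutator_U4_mod_center:
  "commutator U4_mod_center ((a, b, c), (d, e)) ((a', b', c'), (d', e')) =
     ((0, 0, 0), (a * b' + a' * b, b * c' + b' * c))"
  by (rule group.commutator_eqI[OF group_U4_mod_center])
    (simp_all add: mult_U4_mod_center algebra_simps)

text \<open>The lower central series of \<^const>\<open>U4\<close>; it is also its Zassenhaus filtration.\<close>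

definition U4_filtration :: "nat \<Rightarrow> ((bit \<times> bit \<times> bit) \<times> (bit \<times> bit) \<times> bit) set" where
  "U4_filtration n = {((a, b, c), (d, e), f).
     (2 \<le> n \<longrightarrow> a = 0 \<and> b = 0 \<and> c = 0) \<and> (3 \<le> n \<longrightarrow> d = 0 \<and> e = 0) \<and> (4 \<le> n \<longrightarrow> f = 0)}"

lemma mem_U4_filtration [simp]:
  "((a, b, c), (d, e), f) \<in> U4_filtration n \<longleftrightarrow>
     (2 \<le> n \<longrightarrow> a = 0 \<and> b = 0 \<and> c = 0) \<and> (3 \<le> n \<longrightarrow> d = 0 \<and> e = 0) \<and> (4 \<le> n \<longrightarrow> f = 0)"
  by (simp add: U4_filtration_def)

lemma U4_filtration_4: "U4_filtration 4 = {\<one>\<^bsub>U4\<^esub>}"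
  by (auto simp: U4_filtration_def one_U4)

lemma subgroup_U4_filtration: "subgroup (U4_filtration n) U4"
proof (rule group.subgroupI[OF group_U4])
  have "\<one>\<^bsub>U4\<^esub> \<in> U4_filtration n" by (simp add: one_U4)
  then show "U4_filtration n \<noteq> {}" by blast
  show "inv\<^bsub>U4\<^esub> x \<in> U4_filtration n" if "x \<in> U4_filtration n" for x
    using that by (cases x) (auto simp: split_paired_all inv_U4)
qed (auto simp: split_paired_all mult_U4)

lemma U4_filtration_square:
  assumes "x \<in> U4_filtration m" and "n \<le> 2 * m"
  shows "x \<otimes>\<^bsub>U4\<^esub> x \<in> U4_filtration n"
proof -
  obtain a b c d e f where x: "x = ((a, b, c), (d, e), f)" by (metis prod.exhaust)
  have "3 \<le> n \<Longrightarrow> 2 \<le> m" using assms(2) by linarith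
  then show ?thesis using assms(1) by (auto simp: x mult_U4)
qed

lemma U4_filtration_commutator:
  assumes "x \<in> U4_filtration m" and "y \<in> U4_filtration n" and "0 < m" and "0 < n"
  shows "commutator U4 x y \<in> U4_filtration (m + n)"
proof -
  obtain a b c d e f where x: "x = ((a, b, c), (d, e), f)" by (metis prod.exhaust)
  obtain a' b' c' d' e' f' where y: "y = ((a', b', c'), (d', e'), f')" by (metis prod.exhaust)
  have "3 \<le> m + n \<Longrightarrow> 2 \<le> m \<or> 2 \<le> n" "4 \<le> m + n \<Longrightarrow> 2 \<le> m \<and> 2 \<le> n \<or> 3 \<le> m \<or> 3 \<le> n"
    using assms(3,4) by linarith+
  then show ?thesis using assms(1,2) by (auto simp: x y commutator_U4)
qed

section \<open>Fixed fields and Hilbert 90\<close>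

locale ring_endomorphism =
  fixes K :: "'a::idom set" and \<sigma> :: "'a \<Rightarrow> 'a"
  assumes zero_closed: "0 \<in> K" and one_closed: "1 \<in> K"
    and add_closed: "\<And>u v. u \<in> K \<Longrightarrow> v \<in> K \<Longrightarrow> u + v \<in> K"
    and mult_closed: "\<And>u v. u \<in> K \<Longrightarrow> v \<in> K \<Longrightarrow> u * v \<in> K"
    and uminus_closed: "\<And>u. u \<in> K \<Longrightarrow> - u \<in> K"
    and hom_closed: "\<And>u. u \<in> K \<Longrightarrow> \<sigma> u \<in> K"
    and hom_one: "\<sigma> 1 = 1"
    and hom_add: "\<And>u v. u \<in> K \<Longrightarrow> v \<in> K \<Longrightarrow> \<sigma> (u + v) = \<sigma> u + \<sigma> v"
    and hom_mult: "\<And>u v. u \<in> K \<Longrightarrow> v \<in> K \<Longrightarrow> \<sigma> (u * v) = \<sigma> u * \<sigma> v"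
begin

lemma hom_zero: "\<sigma> 0 = 0"
  using hom_add[OF zero_closed zero_closed] by (metis add_0 add_cancel_left_left)

lemma hom_uminus: "u \<in> K \<Longrightarrow> \<sigma> (- u) = - \<sigma> u"
  using hom_add[of u "- u"] uminus_closed hom_zero by (simp add: eq_neg_iff_add_eq_0 add.commute)

lemma sum_closed: "(\<And>i. i \<in> I \<Longrightarrow> f i \<in> K) \<Longrightarrow> sum f I \<in> K"
  by (induction I rule: infinite_finite_induct) (auto intro: zero_closed add_closed)

lemma hom_sum: "(\<And>i. i \<in> I \<Longrightarrow> f i \<in> K) \<Longrightarrow> \<sigma> (sum f I) = (\<Sum>i\<in>I. \<sigma> (f i))"
  by (induction I rule: infinite_finite_induct) (auto simp: hom_zero hom_add sum_closed)

lemma prod_closed: "(\<And>i. i \<in> I \<Longrightarrow> f i \<in> K) \<Longrightarrow> prod f I \<in> K"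
  by (induction I rule: infinite_finite_induct) (auto intro: one_closed mult_closed)

lemma hom_prod: "(\<And>i. i \<in> I \<Longrightarrow> f i \<in> K) \<Longrightarrow> \<sigma> (prod f I) = (\<Prod>i\<in>I. \<sigma> (f i))"
  by (induction I rule: infinite_finite_induct) (auto simp: hom_one hom_mult prod_closed)

lemma coeff_map_poly_hom: "coeff (map_poly \<sigma> P) n = \<sigma> (coeff P n)"
  by (simp add: coeff_map_poly hom_zero)

lemma ring_endomorphism_map_poly: "ring_endomorphism {P. \<forall>n. coeff P n \<in> K} (map_poly \<sigma>)"
proof
  fix P Q assume P: "P \<in> {P. \<forall>n. coeff P n \<in> K}" and Q: "Q \<in> {P. \<forall>n. coeff P n \<in> K}"
  then have "coeff P k * coeff Q l \<in> K" for k l by (auto intro: mult_closed)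
  then show "P * Q \<in> {P. \<forall>n. coeff P n \<in> K}"
    by (auto simp: coeff_mult intro: sum_closed)
  show "map_poly \<sigma> (P * Q) = map_poly \<sigma> P * map_poly \<sigma> Q"
    using P Q \<open>\<And>k l. coeff P k * coeff Q l \<in> K\<close>
    by (intro poly_eqI) (simp add: coeff_map_poly_hom coeff_mult hom_sum hom_mult)
  show "map_poly \<sigma> (P + Q) = map_poly \<sigma> P + map_poly \<sigma> Q"
    using P Q by (intro poly_eqI) (simp add: coeff_map_poly_hom hom_add)
qed (auto simp: coeff_map_poly_hom one_pCons coeff_pCons map_poly_pCons hom_one hom_zero
    zero_closed one_closed add_closed uminus_closed hom_closed split: nat.splits)

lemma hom_poly:
  assumes P: "\<And>n. coeff P n \<in> K" and u: "u \<in> K"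
  shows "poly P u \<in> K" and "\<sigma> (poly P u) = poly (map_poly \<sigma> P) (\<sigma> u)"
proof -
  have "poly P u \<in> K \<and> \<sigma> (poly P u) = poly (map_poly \<sigma> P) (\<sigma> u)"
    using P
  proof (induction P)
    case (pCons a P)
    have "a \<in> K" "\<And>n. coeff P n \<in> K"
      using pCons.prems[of 0] pCons.prems[of "Suc _"] by auto
    with pCons.IH u show ?case
      by (simp add: map_poly_pCons hom_zero hom_add hom_mult add_closed mult_closed)
  qed (simp add: zero_closed hom_zero)
  then show "poly P u \<in> K" and "\<sigma> (poly P u) = poly (map_poly \<sigma> P) (\<sigma> u)" by blast+
qed

lemma map_poly_hom_linear_factors:
  assumes "Z \<subseteq> K"
  shows "map_poly \<sigma> (\<Prod>z\<in>Z. [:-z, 1:]) = (\<Prod>z\<in>Z. [:-\<sigma> z, 1:])"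
    and "coeff (\<Prod>z\<in>Z. [:-z, 1:]) n \<in> K"
proof -
  interpret K_X: ring_endomorphism "{P. \<forall>n. coeff P n \<in> K}" "map_poly \<sigma>"
    by (rule ring_endomorphism_map_poly)
  have linear: "[:-z, 1:] \<in> {P. \<forall>n. coeff P n \<in> K}" if "z \<in> Z" for z
    using that assms
    by (auto simp: coeff_pCons zero_closed one_closed uminus_closed split: nat.splits)
  have "map_poly \<sigma> (\<Prod>z\<in>Z. [:-z, 1:]) = (\<Prod>z\<in>Z. map_poly \<sigma> [:-z, 1:])"
    by (rule K_X.hom_prod[OF linear])
  also have "\<dots> = (\<Prod>z\<in>Z. [:-\<sigma> z, 1:])"
    using assms by (intro prod.cong) (auto simp: map_poly_pCons hom_zero hom_one hom_uminus)
  finally show "map_poly \<sigma> (\<Prod>z\<in>Z. [:-z, 1:]) = (\<Prod>z\<in>Z. [:-\<sigma> z, 1:])" .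
  have "(\<Prod>z\<in>Z. [:-z, 1:]) \<in> {P. \<forall>n. coeff P n \<in> K}"
    by (rule K_X.prod_closed[OF linear])
  then show "coeff (\<Prod>z\<in>Z. [:-z, 1:]) n \<in> K" by simp
qed

end

text \<open>The polynomial whose roots are the points of an orbit has invariant coefficients.\<close>

lemma orbit_stable_of_fixing_invariants:
  fixes K :: "'a::idom set"
  assumes N: "\<And>\<nu>. \<nu> \<in> N \<Longrightarrow> ring_endomorphism K \<nu>" and \<tau>: "ring_endomorphism K \<tau>"
    and Z: "finite Z" "Z \<subseteq> K" "\<And>\<nu>. \<nu> \<in> N \<Longrightarrow> \<nu> ` Z = Z"
    and fixed: "\<And>u. u \<in> K \<Longrightarrow> (\<forall>\<nu>\<in>N. \<nu> u = u) \<Longrightarrow> \<tau> u = u"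
    and "z \<in> Z"
  shows "\<tau> z \<in> Z"
proof -
  interpret \<tau>: ring_endomorphism K \<tau> by (rule \<tau>)
  define P where "P = (\<Prod>z\<in>Z. [:-z, 1:])"
  have P_K: "coeff P n \<in> K" for n
    unfolding P_def by (rule \<tau>.map_poly_hom_linear_factors(2)[OF Z(2)])
  have "map_poly \<nu> P = P" if "\<nu> \<in> N" for \<nu>
  proof -
    interpret ring_endomorphism K \<nu> by (rule N[OF that])
    have "inj_on \<nu> Z" using Z(1,3) that by (simp add: eq_card_imp_inj_on)
    have "map_poly \<nu> P = (\<Prod>z\<in>Z. [:-\<nu> z, 1:])"
      unfolding P_def by (rule map_poly_hom_linear_factors(1)[OF Z(2)])
    also have "\<dots> = (\<Prod>z\<in>\<nu> ` Z. [:-z, 1:])"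
      by (simp add: prod.reindex[OF \<open>inj_on \<nu> Z\<close>])
    finally show ?thesis using Z(3)[OF that] by (simp add: P_def)
  qed
  then have "\<nu> (coeff P n) = coeff P n" if "\<nu> \<in> N" for \<nu> n
    using ring_endomorphism.coeff_map_poly_hom[OF N[OF that], of P n] that by simp
  then have "map_poly \<tau> P = P"
    using fixed P_K by (intro poly_eqI) (simp add: \<tau>.coeff_map_poly_hom)
  then have "poly P (\<tau> z) = \<tau> (poly P z)"
    using \<tau>.hom_poly(2)[of P z] P_K Z(2) \<open>z \<in> Z\<close> by auto
  also have "poly P z = 0"
    using Z(1) \<open>z \<in> Z\<close> by (auto simp: P_def poly_prod)
  finally have "poly P (\<tau> z) = 0" by (simp add: \<tau>.hom_zero)
  then show ?thesis
    using Z(1) by (auto simp: P_def poly_prod)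
qed

locale galois_action = group G for G :: "('a::field \<Rightarrow> 'a) monoid" (structure) +
  fixes K :: "'a set"
  assumes K_one: "1 \<in> K"
    and K_add: "\<And>u v. u \<in> K \<Longrightarrow> v \<in> K \<Longrightarrow> u + v \<in> K"
    and K_mult: "\<And>u v. u \<in> K \<Longrightarrow> v \<in> K \<Longrightarrow> u * v \<in> K"
    and K_uminus: "\<And>u. u \<in> K \<Longrightarrow> - u \<in> K"
    and K_inverse: "\<And>u. u \<in> K \<Longrightarrow> inverse u \<in> K"
    and act_closed: "\<And>\<sigma> u. \<sigma> \<in> carrier G \<Longrightarrow> u \<in> K \<Longrightarrow> \<sigma> u \<in> K"
    and act_add: "\<And>\<sigma> u v. \<sigma> \<in> carrier G \<Longrightarrow> u \<in> K \<Longrightarrow> v \<in> K \<Longrightarrow> \<sigma> (u + v) = \<sigma> u + \<sigma> v"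
    and act_mult: "\<And>\<sigma> u v. \<sigma> \<in> carrier G \<Longrightarrow> u \<in> K \<Longrightarrow> v \<in> K \<Longrightarrow> \<sigma> (u * v) = \<sigma> u * \<sigma> v"
    and act_comp: "\<And>\<sigma> \<tau> u. \<sigma> \<in> carrier G \<Longrightarrow> \<tau> \<in> carrier G \<Longrightarrow> u \<in> K \<Longrightarrow> (\<sigma> \<otimes> \<tau>) u = \<sigma> (\<tau> u)"
    and act_one: "\<And>u. u \<in> K \<Longrightarrow> \<one> u = u"
    and finite_orbit: "\<And>u. u \<in> K \<Longrightarrow> finite ((\<lambda>\<sigma>. \<sigma> u) ` carrier G)"
begin

definition locally_constant :: "(('a \<Rightarrow> 'a) \<Rightarrow> 'b) \<Rightarrow> bool" where
  "locally_constant f \<longleftrightarrow> (\<exists>A. finite A \<and> A \<subseteq> K \<and>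
     (\<forall>\<sigma>\<in>carrier G. \<forall>\<tau>\<in>carrier G. (\<forall>z\<in>A. \<sigma> z = \<tau> z) \<longrightarrow> f \<sigma> = f \<tau>))"

lemma locally_constantE:
  assumes "locally_constant f"
  obtains A where "finite A" "A \<subseteq> K"
    "\<And>\<sigma> \<tau>. \<sigma> \<in> carrier G \<Longrightarrow> \<tau> \<in> carrier G \<Longrightarrow> (\<forall>z\<in>A. \<sigma> z = \<tau> z) \<Longrightarrow> f \<sigma> = f \<tau>"
  using assms unfolding locally_constant_def by blast

lemma locally_constant_apply:
  fixes u :: "'i::finite \<Rightarrow> 'a"
  assumes "\<And>i. u i \<in> K"
  shows "locally_constant (\<lambda>\<sigma> i. \<sigma> (u i))"
  unfolding locally_constant_def by (rule exI[of _ "range u"]) (use assms in auto)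

lemma locally_constant_comp: "locally_constant f \<Longrightarrow> locally_constant (\<lambda>\<sigma>. g (f \<sigma>))"
  unfolding locally_constant_def by metis

lemma locally_constant_Pair:
  assumes "locally_constant f" and "locally_constant g"
  shows "locally_constant (\<lambda>\<sigma>. (f \<sigma>, g \<sigma>))"
proof -
  obtain A where A: "finite A" "A \<subseteq> K"
    "\<And>\<sigma> \<tau>. \<sigma> \<in> carrier G \<Longrightarrow> \<tau> \<in> carrier G \<Longrightarrow> (\<forall>z\<in>A. \<sigma> z = \<tau> z) \<Longrightarrow> f \<sigma> = f \<tau>"
    using locally_constantE[OF assms(1)] by blast
  obtain B where B: "finite B" "B \<subseteq> K"
    "\<And>\<sigma> \<tau>. \<sigma> \<in> carrier G \<Longrightarrow> \<tau> \<in> carrier G \<Longrightarrow> (\<forall>z\<in>B. \<sigma> z = \<tau> z) \<Longrightarrow> g \<sigma> = g \<tau>"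
    using locally_constantE[OF assms(2)] by blast
  show ?thesis
    unfolding locally_constant_def
  proof (intro exI[of _ "A \<union> B"] conjI ballI impI)
    fix \<sigma> \<tau> assume "\<sigma> \<in> carrier G" "\<tau> \<in> carrier G" "\<forall>z\<in>A \<union> B. \<sigma> z = \<tau> z"
    then show "(f \<sigma>, g \<sigma>) = (f \<tau>, g \<tau>)"
      using A(3)[of \<sigma> \<tau>] B(3)[of \<sigma> \<tau>] by simp
  qed (use A(1,2) B(1,2) in auto)
qed

lemma K_zero: "0 \<in> K"
  using K_add[OF K_one K_uminus[OF K_one]] by simp

lemma act_inv_cancel: "\<sigma> \<in> carrier G \<Longrightarrow> u \<in> K \<Longrightarrow> (inv \<sigma>) (\<sigma> u) = u"
  by (metis act_comp act_one inv_closed l_inv)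

lemma act_unit:
  assumes "\<sigma> \<in> carrier G"
  shows "\<sigma> 1 = 1"
proof -
  have "\<sigma> 0 = 0" "(inv \<sigma>) 0 = 0"
    using act_add[OF _ K_zero K_zero] assms by (metis add_0 add_cancel_left_left inv_closed)+
  then have "\<sigma> 1 \<noteq> 0" using act_inv_cancel[OF assms K_one] by auto
  then show ?thesis using act_mult[OF assms K_one K_one] by simp
qed

lemma ring_endomorphism_act: "\<sigma> \<in> carrier G \<Longrightarrow> ring_endomorphism K \<sigma>"
  by standard (auto intro: K_zero K_one K_add K_mult K_uminus act_closed act_unit act_add act_mult)

lemma act_zero: "\<sigma> \<in> carrier G \<Longrightarrow> \<sigma> 0 = 0"
  using ring_endomorphism.hom_zero[OF ring_endomorphism_act] .

lemma act_uminus: "\<sigma> \<in> carrier G \<Longrightarrow> u \<in> K \<Longrightarrow> \<sigma> (- u) = - \<sigma> u"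
  using ring_endomorphism.hom_uminus[OF ring_endomorphism_act] .

lemma act_eq_0_iff: "\<sigma> \<in> carrier G \<Longrightarrow> u \<in> K \<Longrightarrow> \<sigma> u = 0 \<longleftrightarrow> u = 0"
  by (metis act_inv_cancel act_zero inv_closed)

lemma act_inverse: "\<sigma> \<in> carrier G \<Longrightarrow> u \<in> K \<Longrightarrow> \<sigma> (inverse u) = inverse (\<sigma> u)"
  using act_mult[OF _ _ K_inverse, of \<sigma> u u] act_unit[of \<sigma>] act_zero[of \<sigma>]
  by (cases "u = 0") (auto intro: inverse_unique[symmetric])

lemma map_poly_act_comp:
  assumes "\<sigma> \<in> carrier G" "\<tau> \<in> carrier G" and "set xs \<subseteq> K"
  shows "map_poly \<sigma> (map_poly \<tau> (Poly xs)) = map_poly (\<sigma> \<otimes> \<tau>) (Poly xs)"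
proof -
  have "coeff (Poly xs) n \<in> K" for n
    using assms(3) K_zero nth_mem[of n xs] by (auto simp: nth_default_def)
  then show ?thesis
    using assms(1,2) by (intro poly_eqI) (simp add: coeff_map_poly act_zero act_comp)
qed

lemma finite_map_poly_orbit:
  assumes "set xs \<subseteq> K"
  shows "finite ((\<lambda>\<sigma>. map_poly \<sigma> (Poly xs)) ` carrier G)"
proof (rule finite_subset)
  let ?lists = "{ys. set ys \<subseteq> (\<Union>z\<in>set xs. (\<lambda>\<sigma>. \<sigma> z) ` carrier G) \<and> length ys = length xs}"
  show "(\<lambda>\<sigma>. map_poly \<sigma> (Poly xs)) ` carrier G \<subseteq> Poly ` ?lists"
  proof (intro image_subsetI image_eqI)
    fix \<sigma> assume "\<sigma> \<in> carrier G"
    then show "map_poly \<sigma> (Poly xs) = Poly (map \<sigma> xs)"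
      by (intro poly_eqI) (auto simp: coeff_map_poly act_zero nth_default_def)
    show "map \<sigma> xs \<in> ?lists"
      using \<open>\<sigma> \<in> carrier G\<close> by auto
  qed
  show "finite (Poly ` ?lists)"
    using assms finite_orbit by (intro finite_imageI finite_lists_length_eq) auto
qed

lemma map_poly_orbit_translate:
  assumes N: "subgroup N G" and \<nu>: "\<nu> \<in> N" and xs: "set xs \<subseteq> K"
  shows "map_poly \<nu> ` (\<lambda>\<rho>. map_poly \<rho> (Poly xs)) ` N = (\<lambda>\<rho>. map_poly \<rho> (Poly xs)) ` N"
proof -
  note N_G = subgroup.mem_carrier[OF N]
  have "map_poly \<nu> ` (\<lambda>\<rho>. map_poly \<rho> (Poly xs)) ` N = (\<lambda>\<rho>. map_poly (\<nu> \<otimes> \<rho>) (Poly xs)) ` N"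
    unfolding image_image using \<nu> N_G xs by (intro image_cong refl map_poly_act_comp) auto
  also have "\<dots> = (\<lambda>\<rho>. map_poly \<rho> (Poly xs)) ` ((\<lambda>\<rho>. \<nu> \<otimes> \<rho>) ` N)"
    by (simp add: image_image)
  also have "(\<lambda>\<rho>. \<nu> \<otimes> \<rho>) ` N = N"
    using coset_join3[OF N_G[OF \<nu>] N \<nu>] by (auto simp: l_coset_def)
  finally show ?thesis .
qed

lemma map_poly_orbit_stable_of_fixing_fixed_field:
  assumes N: "subgroup N G" and \<tau>: "\<tau> \<in> carrier G" and xs: "set xs \<subseteq> K"
    and fixed: "\<And>u. u \<in> K \<Longrightarrow> (\<forall>\<nu>\<in>N. \<nu> u = u) \<Longrightarrow> \<tau> u = u"
  shows "map_poly \<tau> (Poly xs) \<in> (\<lambda>\<nu>. map_poly \<nu> (Poly xs)) ` N"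
proof (rule orbit_stable_of_fixing_invariants[where N = "map_poly ` N" and \<tau> = "map_poly \<tau>"])
  note N_G = subgroup.mem_carrier[OF N]
  let ?K_X = "{P. \<forall>n. coeff P n \<in> K}"
  have coeff_xs: "coeff (Poly xs) n \<in> K" for n
    using xs K_zero nth_mem[of n xs] by (auto simp: nth_default_def)
  show "ring_endomorphism ?K_X (map_poly \<tau>)"
    by (intro ring_endomorphism.ring_endomorphism_map_poly ring_endomorphism_act \<tau>)
  show "ring_endomorphism ?K_X \<mu>" if "\<mu> \<in> map_poly ` N" for \<mu>
    using that N_G
    by (auto intro!: ring_endomorphism.ring_endomorphism_map_poly ring_endomorphism_act)
  show "finite ((\<lambda>\<nu>. map_poly \<nu> (Poly xs)) ` N)"
    by (rule finite_subset[OF image_mono finite_map_poly_orbit[OF xs]]) (use N_G in blast)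
  show "(\<lambda>\<nu>. map_poly \<nu> (Poly xs)) ` N \<subseteq> ?K_X"
    using coeff_xs N_G by (auto simp: coeff_map_poly act_zero act_closed)
  show "\<mu> ` (\<lambda>\<nu>. map_poly \<nu> (Poly xs)) ` N = (\<lambda>\<nu>. map_poly \<nu> (Poly xs)) ` N"
    if "\<mu> \<in> map_poly ` N" for \<mu>
    using that map_poly_orbit_translate[OF N _ xs] by blast
  show "map_poly \<tau> P = P" if P: "P \<in> ?K_X" "\<forall>\<mu>\<in>map_poly ` N. \<mu> P = P" for P
  proof (rule poly_eqI)
    fix n
    have "\<nu> (coeff P n) = coeff P n" if "\<nu> \<in> N" for \<nu>
      using P(2) that N_G coeff_map_poly[of \<nu> P n] by (auto simp: act_zero)
    then show "coeff (map_poly \<tau> P) n = coeff P n"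
      using P(1) fixed \<tau> by (simp add: coeff_map_poly act_zero)
  qed
  have "map_poly \<one> (Poly xs) = Poly xs"
    using coeff_xs by (intro poly_eqI) (simp add: coeff_map_poly act_zero act_one)
  then show "Poly xs \<in> (\<lambda>\<nu>. map_poly \<nu> (Poly xs)) ` N"
    using subgroup.one_closed[OF N] by (metis image_eqI)
qed

text \<open>The orbit of the polynomial whose coefficients are the elements of \<open>A\<close> moves all of them at
  the same time.\<close>

lemma agrees_on_finite_of_fixing_fixed_field:
  assumes N: "subgroup N G" and \<tau>: "\<tau> \<in> carrier G" and A: "finite A" "A \<subseteq> K"
    and fixed: "\<And>u. u \<in> K \<Longrightarrow> (\<forall>\<nu>\<in>N. \<nu> u = u) \<Longrightarrow> \<tau> u = u"
  shows "\<exists>\<nu>\<in>N. \<forall>z\<in>A. \<nu> z = \<tau> z"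
proof -
  obtain xs where xs: "set xs = A" using finite_list[OF A(1)] by blast
  then have "map_poly \<tau> (Poly xs) \<in> (\<lambda>\<nu>. map_poly \<nu> (Poly xs)) ` N"
    using A(2) by (intro map_poly_orbit_stable_of_fixing_fixed_field[OF N \<tau> _ fixed]) auto
  then obtain \<nu> where \<nu>: "\<nu> \<in> N" "map_poly \<tau> (Poly xs) = map_poly \<nu> (Poly xs)" by blast
  have "\<nu> z = \<tau> z" if z: "z \<in> A" for z
  proof -
    obtain n where "n < length xs" "xs ! n = z" using z xs by (auto simp: in_set_conv_nth)
    then show ?thesis
      using arg_cong[OF \<nu>(2), of "\<lambda>P. coeff P n"] \<tau> subgroup.mem_carrier[OF N \<nu>(1)]
      by (simp add: coeff_map_poly act_zero nth_default_nth)
  qed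
  then show ?thesis using \<nu>(1) by blast
qed

end

context group
begin

definition additive_on :: "'a set \<Rightarrow> ('a \<Rightarrow> bit) \<Rightarrow> bool" where
  "additive_on H \<xi> \<longleftrightarrow> (\<forall>\<sigma>\<in>H. \<forall>\<tau>\<in>H. \<xi> (\<sigma> \<otimes> \<tau>) = \<xi> \<sigma> + \<xi> \<tau>)"

definition trivializes_cup :: "('a \<Rightarrow> bit) \<Rightarrow> ('a \<Rightarrow> bit) \<Rightarrow> ('a \<Rightarrow> bit) \<Rightarrow> bool" where
  "trivializes_cup \<gamma> \<alpha> \<beta> \<longleftrightarrow>
     (\<forall>\<sigma>\<in>carrier G. \<forall>\<tau>\<in>carrier G. \<gamma> (\<sigma> \<otimes> \<tau>) = \<gamma> \<sigma> + \<gamma> \<tau> + \<alpha> \<sigma> * \<beta> \<tau>)"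

lemma additive_onD: "additive_on H \<xi> \<Longrightarrow> \<sigma> \<in> H \<Longrightarrow> \<tau> \<in> H \<Longrightarrow> \<xi> (\<sigma> \<otimes> \<tau>) = \<xi> \<sigma> + \<xi> \<tau>"
  by (simp add: additive_on_def)

lemma trivializes_cupD:
  "trivializes_cup \<gamma> \<alpha> \<beta> \<Longrightarrow> \<sigma> \<in> carrier G \<Longrightarrow> \<tau> \<in> carrier G \<Longrightarrow>
     \<gamma> (\<sigma> \<otimes> \<tau>) = \<gamma> \<sigma> + \<gamma> \<tau> + \<alpha> \<sigma> * \<beta> \<tau>"
  by (simp add: trivializes_cup_def)

lemma additive_on_inv:
  assumes H: "subgroup H G" and \<xi>: "additive_on H \<xi>" and \<sigma>: "\<sigma> \<in> H"
  shows "\<xi> (inv \<sigma>) = \<xi> \<sigma>"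
proof -
  have \<sigma>_G: "\<sigma> \<in> carrier G" by (rule subgroup.mem_carrier[OF H \<sigma>])
  have "\<xi> \<one> = \<xi> \<one> + \<xi> \<one>"
    using additive_onD[OF \<xi> subgroup.one_closed[OF H] subgroup.one_closed[OF H]] by simp
  moreover have "\<xi> \<one> = \<xi> \<sigma> + \<xi> (inv \<sigma>)"
    using additive_onD[OF \<xi> \<sigma> subgroup.m_inv_closed[OF H \<sigma>]] \<sigma>_G by simp
  ultimately show ?thesis
    by (cases "\<xi> \<sigma>"; cases "\<xi> (inv \<sigma>)") simp_all
qed

lemma subgroup_kernel_additive_on:
  assumes H: "subgroup H G" and \<xi>: "additive_on H \<xi>"
  shows "subgroup {\<sigma> \<in> H. \<xi> \<sigma> = 0} G"
proof (rule subgroupI)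
  have "\<xi> \<one> = 0"
    using additive_onD[OF \<xi> subgroup.one_closed[OF H] subgroup.one_closed[OF H]] by simp
  then show "{\<sigma> \<in> H. \<xi> \<sigma> = 0} \<noteq> {}" using subgroup.one_closed[OF H] by blast
qed (auto simp: additive_on_inv[OF H \<xi>] additive_onD[OF \<xi>] subgroup.m_closed[OF H]
    subgroup.m_inv_closed[OF H] subgroup.mem_carrier[OF H])

end

definition bit_sign :: "bit \<Rightarrow> 'a::ring_1" where
  "bit_sign b = (if b = 0 then 1 else - 1)"

lemma bit_sign_0 [simp]: "bit_sign 0 = 1"
  by (simp add: bit_sign_def)

lemma bit_sign_add: "bit_sign (b + c) = bit_sign b * bit_sign c"
  by (cases b; cases c) (simp_all add: bit_sign_def)

lemma bit_sign_neq_0 [simp]: "bit_sign b \<noteq> (0 :: 'a::{ring_1, zero_neq_one})"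
  by (simp add: bit_sign_def)

lemma add_self_char_2:
  fixes u v :: "'a::ring_1"
  assumes "(2::'a) = 0"
  shows "u + u = 0" and "u + (u + v) = v"
  using assms by (metis mult_2 mult_zero_left, metis add.assoc add_0 mult_2 mult_zero_left)

context galois_action
begin

lemma bit_sign_K: "bit_sign b \<in> K"
  by (simp add: bit_sign_def K_one K_uminus)

lemma act_bit_sign: "\<sigma> \<in> carrier G \<Longrightarrow> u \<in> K \<Longrightarrow> \<sigma> (bit_sign b * u) = bit_sign b * \<sigma> u"
  by (simp add: bit_sign_def act_uminus)

lemma ex_moved_by_character:
  assumes H: "subgroup H G" and \<psi>: "additive_on H \<psi>" "locally_constant \<psi>"
    and \<tau>: "\<tau> \<in> H" "\<psi> \<tau> = 1"
  obtains z where "z \<in> K" "\<tau> z \<noteq> z"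
    "\<And>\<sigma>. \<sigma> \<in> H \<Longrightarrow> \<sigma> z = (if \<psi> \<sigma> = 0 then z else \<tau> z)"
    "\<And>\<sigma>. \<sigma> \<in> H \<Longrightarrow> \<sigma> (\<tau> z) = (if \<psi> \<sigma> = 0 then \<tau> z else z)"
proof -
  note H_G = subgroup.mem_carrier[OF H]
  let ?N = "{\<sigma> \<in> H. \<psi> \<sigma> = 0}"
  obtain A where A: "finite A" "A \<subseteq> K"
    "\<And>\<sigma> \<tau>. \<sigma> \<in> carrier G \<Longrightarrow> \<tau> \<in> carrier G \<Longrightarrow> (\<forall>z\<in>A. \<sigma> z = \<tau> z) \<Longrightarrow> \<psi> \<sigma> = \<psi> \<tau>"
    using locally_constantE[OF \<psi>(2)] by blast
  have "\<exists>z\<in>K. (\<forall>\<nu>\<in>?N. \<nu> z = z) \<and> \<tau> z \<noteq> z"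
  proof (rule ccontr)
    assume "\<not> ?thesis"
    then obtain \<nu> where "\<nu> \<in> ?N" "\<forall>z\<in>A. \<nu> z = \<tau> z"
      using agrees_on_finite_of_fixing_fixed_field[OF subgroup_kernel_additive_on[OF H \<psi>(1)]
          H_G[OF \<tau>(1)] A(1,2)] by blast
    then show False using A(3)[of \<nu> \<tau>] H_G \<tau> by auto
  qed
  then obtain z where z: "z \<in> K" "\<tau> z \<noteq> z" and fixed: "\<And>\<sigma>. \<sigma> \<in> H \<Longrightarrow> \<psi> \<sigma> = 0 \<Longrightarrow> \<sigma> z = z"
    by blast
  have swap: "\<sigma> z = \<tau> z" if \<sigma>: "\<sigma> \<in> H" "\<psi> \<sigma> = 1" for \<sigma>
  proof -
    have \<rho>: "inv \<tau> \<otimes> \<sigma> \<in> H" "\<psi> (inv \<tau> \<otimes> \<sigma>) = 0"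
      using \<tau> \<sigma> H additive_on_inv[OF H \<psi>(1)] additive_onD[OF \<psi>(1)]
      by (simp_all add: subgroup.m_closed subgroup.m_inv_closed)
    have "\<sigma> z = (\<tau> \<otimes> (inv \<tau> \<otimes> \<sigma>)) z"
      using H_G[OF \<tau>(1)] H_G[OF \<sigma>(1)] by (simp flip: m_assoc)
    also have "\<dots> = \<tau> z"
      using act_comp[OF H_G[OF \<tau>(1)] H_G[OF \<rho>(1)] z(1)] fixed[OF \<rho>] by simp
    finally show ?thesis .
  qed
  have comp: "\<sigma> (\<tau> z) = (\<sigma> \<otimes> \<tau>) z" "\<sigma> \<otimes> \<tau> \<in> H" "\<psi> (\<sigma> \<otimes> \<tau>) = \<psi> \<sigma> + 1" if "\<sigma> \<in> H" for \<sigma>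
    using that \<tau> z(1) H_G additive_onD[OF \<psi>(1) that \<tau>(1)]
    by (simp_all add: act_comp subgroup.m_closed[OF H])
  show ?thesis
  proof (rule that[OF z])
    show "\<sigma> z = (if \<psi> \<sigma> = 0 then z else \<tau> z)" if "\<sigma> \<in> H" for \<sigma>
      using that fixed swap by (cases "\<psi> \<sigma>") auto
    show "\<sigma> (\<tau> z) = (if \<psi> \<sigma> = 0 then \<tau> z else z)" if "\<sigma> \<in> H" for \<sigma>
      using comp[OF that] fixed swap by (cases "\<psi> \<sigma>") auto
  qed
qed

lemma hilbert90_character:
  assumes H: "subgroup H G" and \<psi>: "additive_on H \<psi>" "locally_constant \<psi>"
  obtains y where "y \<in> K" "y \<noteq> 0" "\<And>\<sigma>. \<sigma> \<in> H \<Longrightarrow> \<sigma> y = bit_sign (\<psi> \<sigma>) * y"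
proof (cases "\<exists>\<tau>\<in>H. \<psi> \<tau> = 1")
  case True
  then obtain \<tau> z where \<tau>: "\<tau> \<in> H" and z: "z \<in> K" "\<tau> z \<noteq> z"
    "\<And>\<sigma>. \<sigma> \<in> H \<Longrightarrow> \<sigma> z = (if \<psi> \<sigma> = 0 then z else \<tau> z)"
    "\<And>\<sigma>. \<sigma> \<in> H \<Longrightarrow> \<sigma> (\<tau> z) = (if \<psi> \<sigma> = 0 then \<tau> z else z)"
    using ex_moved_by_character[OF H \<psi>] by metis
  note H_G = subgroup.mem_carrier[OF H]
  have \<tau>z: "\<tau> z \<in> K" using act_closed H_G \<tau> z(1) by blast
  show ?thesis
  proof (rule that[of "z + - \<tau> z"])
    show "\<sigma> (z + - \<tau> z) = bit_sign (\<psi> \<sigma>) * (z + - \<tau> z)" if "\<sigma> \<in> H" for \<sigma>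
      using that z(1) \<tau>z z(3,4)[OF that] H_G
      by (simp add: act_add act_uminus K_uminus bit_sign_def del: add_uminus_conv_diff)
    show "z + - \<tau> z \<in> K" by (intro K_add K_uminus z(1) \<tau>z)
    show "z + - \<tau> z \<noteq> 0" using z(2) by simp
  qed
next
  case False
  then have "\<sigma> 1 = bit_sign (\<psi> \<sigma>) * 1" if "\<sigma> \<in> H" for \<sigma>
    using that act_unit subgroup.mem_carrier[OF H] by (cases "\<psi> \<sigma>") auto
  then show ?thesis using that K_one by force
qed

lemma additive_hilbert90_character:
  assumes two: "(2::'a) = 0" and H: "subgroup H G"
    and \<psi>: "additive_on H \<psi>" "locally_constant \<psi>"
  obtains y where "y \<in> K" "\<And>\<sigma>. \<sigma> \<in> H \<Longrightarrow> \<sigma> y = y + of_bit (\<psi> \<sigma>)"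
proof (cases "\<exists>\<tau>\<in>H. \<psi> \<tau> = 1")
  case True
  then obtain \<tau> z where \<tau>: "\<tau> \<in> H" and z: "z \<in> K" "\<tau> z \<noteq> z"
    "\<And>\<sigma>. \<sigma> \<in> H \<Longrightarrow> \<sigma> z = (if \<psi> \<sigma> = 0 then z else \<tau> z)"
    "\<And>\<sigma>. \<sigma> \<in> H \<Longrightarrow> \<sigma> (\<tau> z) = (if \<psi> \<sigma> = 0 then \<tau> z else z)"
    using ex_moved_by_character[OF H \<psi>] by metis
  note H_G = subgroup.mem_carrier[OF H]
  define w where "w = z + \<tau> z"
  have \<tau>z: "\<tau> z \<in> K" using act_closed H_G \<tau> z(1) by blast
  then have w_K: "w \<in> K" using z(1) by (simp add: w_def K_add)
  have w_act: "\<sigma> w = w" if "\<sigma> \<in> H" for \<sigma>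
    using that z(1) \<tau>z z(3,4)[OF that] H_G by (simp add: w_def act_add add.commute)
  have \<tau>z_eq: "\<tau> z = z + w"
    by (simp add: w_def add_self_char_2[OF two])
  then have "w \<noteq> 0" using z(2) by auto
  show ?thesis
  proof (rule that[of "z * inverse w"])
    fix \<sigma> assume "\<sigma> \<in> H"
    then have "\<sigma> (z * inverse w) = \<sigma> z * inverse w"
      using z(1) w_K w_act H_G by (simp add: act_mult act_inverse K_inverse)
    also have "\<dots> = z * inverse w + of_bit (\<psi> \<sigma>)"
      using z(3)[OF \<open>\<sigma> \<in> H\<close>] \<tau>z_eq \<open>w \<noteq> 0\<close> by (cases "\<psi> \<sigma>") (simp_all add: field_simps)
    finally show "\<sigma> (z * inverse w) = z * inverse w + of_bit (\<psi> \<sigma>)" .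
  qed (intro K_mult K_inverse z(1) w_K)
next
  case False
  then have "\<sigma> 0 = 0 + of_bit (\<psi> \<sigma>)" if "\<sigma> \<in> H" for \<sigma>
    using that act_zero subgroup.mem_carrier[OF H] by (cases "\<psi> \<sigma>") auto
  then show ?thesis using that K_zero by blast
qed

lemma act_kernel_eigenvector:
  assumes \<beta>: "additive_on (carrier G) \<beta>" and \<gamma>: "trivializes_cup \<gamma> \<alpha> \<beta>"
    and y: "y \<in> K" "\<And>\<rho>. \<rho> \<in> carrier G \<Longrightarrow> \<beta> \<rho> = 0 \<Longrightarrow> \<rho> y = bit_sign (\<gamma> \<rho>) * y"
    and \<sigma>: "\<sigma> \<in> carrier G" "\<beta> \<sigma> = 1" and \<tau>: "\<tau> \<in> carrier G" "\<beta> \<tau> = 1"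
  shows "\<sigma> y = bit_sign (\<gamma> \<sigma> + \<gamma> \<tau>) * \<tau> y"
proof -
  define \<rho> where "\<rho> = inv \<tau> \<otimes> \<sigma>"
  have \<tau>\<rho>: "\<tau> \<otimes> \<rho> = \<sigma>" and \<rho>: "\<rho> \<in> carrier G"
    using \<sigma> \<tau> by (simp_all add: \<rho>_def flip: m_assoc)
  have "\<beta> \<rho> = 0"
    using additive_onD[OF \<beta> \<tau>(1) \<rho>] \<tau>\<rho> \<sigma>(2) \<tau>(2) by (cases "\<beta> \<rho>") simp_all
  moreover have "\<sigma> y = \<tau> (\<rho> y)" using act_comp[OF \<tau>(1) \<rho> y(1)] \<tau>\<rho> by simp
  ultimately have "\<sigma> y = bit_sign (\<gamma> \<rho>) * \<tau> y"
    using y(1) y(2)[OF \<rho>] \<tau>(1) by (simp add: act_bit_sign)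
  also have "\<gamma> \<rho> = \<gamma> \<sigma> + \<gamma> \<tau>"
    using trivializes_cupD[OF \<gamma> \<tau>(1) \<rho>] \<tau>\<rho> \<open>\<beta> \<rho> = 0\<close> by (simp add: algebra_simps)
  finally show ?thesis .
qed

text \<open>A trivialization \<open>\<gamma>\<close> of \<open>\<alpha> \<union> \<beta>\<close> is a quadratic character on the kernel of \<open>\<beta>\<close>; the pair below
  realizes the representation that it induces.\<close>

lemma ex_signed_pair:
  assumes \<beta>: "additive_on (carrier G) \<beta>" and \<gamma>: "trivializes_cup \<gamma> \<alpha> \<beta>" "locally_constant \<gamma>"
    and \<tau>: "\<tau> \<in> carrier G" "\<beta> \<tau> = 1"
  obtains y :: "bit \<Rightarrow> 'a" where "\<And>q. y q \<in> K" "\<And>q. y q \<noteq> 0"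
    "\<And>\<sigma> q. \<sigma> \<in> carrier G \<Longrightarrow> \<sigma> (y q) = bit_sign (\<gamma> \<sigma> + \<alpha> \<sigma> * q) * y (q + \<beta> \<sigma>)"
proof -
  let ?H = "{\<sigma> \<in> carrier G. \<beta> \<sigma> = 0}"
  have H: "subgroup ?H G" by (rule subgroup_kernel_additive_on[OF subgroup_self \<beta>])
  have "additive_on ?H \<gamma>" using trivializes_cupD[OF \<gamma>(1)] by (simp add: additive_on_def)
  then obtain y0 where y0: "y0 \<in> K" "y0 \<noteq> 0" "\<And>\<sigma>. \<sigma> \<in> ?H \<Longrightarrow> \<sigma> y0 = bit_sign (\<gamma> \<sigma>) * y0"
    using hilbert90_character[OF H _ \<gamma>(2)] by blast
  define y :: "bit \<Rightarrow> 'a" where "y q = (if q = 0 then y0 else bit_sign (\<gamma> \<tau>) * \<tau> y0)" for q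
  have \<tau>y0: "\<tau> y0 \<in> K" "\<tau> y0 \<noteq> 0" using y0 \<tau> by (simp_all add: act_closed act_eq_0_iff)
  have act_y0: "\<sigma> y0 = bit_sign (\<gamma> \<sigma>) * y (\<beta> \<sigma>)" if \<sigma>: "\<sigma> \<in> carrier G" for \<sigma>
  proof (cases "\<beta> \<sigma>")
    case zero
    then show ?thesis using y0(3)[of \<sigma>] \<sigma> by (simp add: y_def)
  next
    case one
    then show ?thesis
      using act_kernel_eigenvector[OF \<beta> \<gamma>(1) y0(1) _ \<sigma> one \<tau>] y0(3)
      by (simp add: y_def bit_sign_add mult.assoc)
  qed
  have act_y1: "\<sigma> (y 1) = bit_sign (\<gamma> \<sigma> + \<alpha> \<sigma>) * y (1 + \<beta> \<sigma>)" if \<sigma>: "\<sigma> \<in> carrier G" for \<sigma>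
  proof -
    have "\<sigma> (y 1) = bit_sign (\<gamma> \<tau>) * (\<sigma> \<otimes> \<tau>) y0"
      using \<sigma> \<tau>(1) \<tau>y0(1) y0(1) by (simp add: y_def act_bit_sign act_comp)
    also have "\<dots> = bit_sign (\<gamma> \<tau> + \<gamma> (\<sigma> \<otimes> \<tau>)) * y (\<beta> (\<sigma> \<otimes> \<tau>))"
      using act_y0[of "\<sigma> \<otimes> \<tau>"] \<sigma> \<tau>(1) by (simp add: bit_sign_add mult.assoc)
    also have "\<gamma> \<tau> + \<gamma> (\<sigma> \<otimes> \<tau>) = \<gamma> \<sigma> + \<alpha> \<sigma>"
      using trivializes_cupD[OF \<gamma>(1) \<sigma> \<tau>(1)] \<tau>(2) by (simp add: algebra_simps)
    finally show ?thesis
      using additive_onD[OF \<beta> \<sigma> \<tau>(1)] \<tau>(2) by (simp add: add.commute)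
  qed
  show ?thesis
  proof (rule that[of y])
    show "y q \<in> K" "y q \<noteq> 0" for q
      using y0 \<tau>y0 by (simp_all add: y_def K_mult bit_sign_K)
    show "\<sigma> (y q) = bit_sign (\<gamma> \<sigma> + \<alpha> \<sigma> * q) * y (q + \<beta> \<sigma>)" if "\<sigma> \<in> carrier G" for \<sigma> q
      using act_y0[OF that] act_y1[OF that] by (cases q) (simp_all add: y_def)
  qed
qed

end

section \<open>The Massey product of \<open>\<alpha>, \<alpha>, \<beta>\<close> over a field\<close>

definition (in group) sign_cocycle ::
    "('a \<Rightarrow> bit) \<Rightarrow> ('a \<Rightarrow> bit) \<Rightarrow> ('a \<Rightarrow> bit \<Rightarrow> bit \<Rightarrow> bit) \<Rightarrow> bool" where
  "sign_cocycle \<alpha> \<beta> e \<longleftrightarrow>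
     (\<forall>\<sigma>\<in>carrier G. e \<sigma> 0 0 + e \<sigma> 0 1 + (e \<sigma> 1 0 + e \<sigma> 1 1) = \<alpha> \<sigma>) \<and>
     (\<forall>\<sigma>\<in>carrier G. \<forall>\<tau>\<in>carrier G. \<forall>p q.
        e (\<sigma> \<otimes> \<tau>) p q = e \<tau> p q + e \<sigma> (p + \<alpha> \<tau>) (q + \<beta> \<tau>))"

text \<open>The coefficients of \<open>e\<close> as a polynomial in \<open>p, q\<close>, with the coboundary of \<open>\<alpha>\<close> and the product
  with \<open>\<alpha>\<close> added so that the cocycle identity becomes matrix multiplication.\<close>

definition U4_of_signs :: "bit \<Rightarrow> bit \<Rightarrow> (bit \<Rightarrow> bit \<Rightarrow> bit) \<Rightarrow> (bit \<times> bit \<times> bit) \<times> (bit \<times> bit) \<times> bit"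
  where
  "U4_of_signs a b e =
     ((a, a, b), (e 0 1 + e 0 0 + a, e 1 0 + e 0 0), e 0 0 + a * (e 1 0 + e 0 0))"

lemma (in group) U4_of_signs_hom:
  assumes \<alpha>: "additive_on (carrier G) \<alpha>" and \<beta>: "additive_on (carrier G) \<beta>"
    and e: "sign_cocycle \<alpha> \<beta> e"
  shows "(\<lambda>\<sigma>. U4_of_signs (\<alpha> \<sigma>) (\<beta> \<sigma>) (e \<sigma>)) \<in> hom G U4"
proof (rule homI)
  fix \<sigma> \<tau> assume \<sigma>: "\<sigma> \<in> carrier G" and \<tau>: "\<tau> \<in> carrier G"
  have total: "\<alpha> \<sigma> = e \<sigma> 0 0 + e \<sigma> 0 1 + (e \<sigma> 1 0 + e \<sigma> 1 1)" if "\<sigma> \<in> carrier G" for \<sigma>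
    using e that by (simp add: sign_cocycle_def)
  have "e (\<sigma> \<otimes> \<tau>) p q = e \<tau> p q + e \<sigma> (p + \<alpha> \<tau>) (q + \<beta> \<tau>)" for p q
    using e \<sigma> \<tau> by (simp add: sign_cocycle_def)
  then show "U4_of_signs (\<alpha> (\<sigma> \<otimes> \<tau>)) (\<beta> (\<sigma> \<otimes> \<tau>)) (e (\<sigma> \<otimes> \<tau>)) =
      U4_of_signs (\<alpha> \<sigma>) (\<beta> \<sigma>) (e \<sigma>) \<otimes>\<^bsub>U4\<^esub> U4_of_signs (\<alpha> \<tau>) (\<beta> \<tau>) (e \<tau>)"
    using total[OF \<sigma>] additive_onD[OF \<alpha> \<sigma> \<tau>] additive_onD[OF \<beta> \<sigma> \<tau>]
    by (cases "\<alpha> \<tau>"; cases "\<beta> \<tau>") (simp_all add: U4_of_signs_def mult_U4 algebra_simps)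
qed simp

definition (in galois_action) has_U4_lift ::
    "(('a \<Rightarrow> 'a) \<Rightarrow> bit) \<Rightarrow> (('a \<Rightarrow> 'a) \<Rightarrow> bit) \<Rightarrow> bool" where
  "has_U4_lift \<alpha> \<beta> \<longleftrightarrow>
     (\<exists>\<rho>\<in>hom G U4. locally_constant \<rho> \<and> (\<forall>\<sigma>\<in>carrier G. fst (\<rho> \<sigma>) = (\<alpha> \<sigma>, \<alpha> \<sigma>, \<beta> \<sigma>)))"

locale signed_roots = galois_action +
  fixes M :: "'a monoid" and s :: 'a and Y :: "bit \<Rightarrow> bit \<Rightarrow> 'a"
    and \<alpha> \<beta> :: "('a \<Rightarrow> 'a) \<Rightarrow> bit"
  assumes M: "comm_group M" "carrier M \<subseteq> K"
    and act_hom: "\<And>\<sigma>. \<sigma> \<in> carrier G \<Longrightarrow> \<sigma> \<in> hom M M"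
    and s: "s \<in> carrier M" "s \<otimes>\<^bsub>M\<^esub> s = \<one>\<^bsub>M\<^esub>" "s \<noteq> \<one>\<^bsub>M\<^esub>" "\<And>\<sigma>. \<sigma> \<in> carrier G \<Longrightarrow> \<sigma> s = s"
    and \<alpha>: "additive_on (carrier G) \<alpha>" "locally_constant \<alpha>"
    and \<beta>: "additive_on (carrier G) \<beta>" "locally_constant \<beta>"
    and Y: "\<And>p q. Y p q \<in> carrier M"
    and act_Y: "\<And>\<sigma> p q. \<sigma> \<in> carrier G \<Longrightarrow>
      \<sigma> (Y p q) = Y (p + \<alpha> \<sigma>) (q + \<beta> \<sigma>) \<or> \<sigma> (Y p q) = s \<otimes>\<^bsub>M\<^esub> Y (p + \<alpha> \<sigma>) (q + \<beta> \<sigma>)"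
    and act_prod: "\<And>\<sigma>. \<sigma> \<in> carrier G \<Longrightarrow>
      \<sigma> (Y 0 0 \<otimes>\<^bsub>M\<^esub> Y 0 1 \<otimes>\<^bsub>M\<^esub> (Y 1 0 \<otimes>\<^bsub>M\<^esub> Y 1 1)) =
        (if \<alpha> \<sigma> = 0 then \<one>\<^bsub>M\<^esub> else s) \<otimes>\<^bsub>M\<^esub> (Y 0 0 \<otimes>\<^bsub>M\<^esub> Y 0 1 \<otimes>\<^bsub>M\<^esub> (Y 1 0 \<otimes>\<^bsub>M\<^esub> Y 1 1))"
begin

sublocale M: comm_group M
  by (rule M(1))

definition sign :: "bit \<Rightarrow> 'a" where
  "sign b = (if b = 0 then \<one>\<^bsub>M\<^esub> else s)"

definition exponent :: "('a \<Rightarrow> 'a) \<Rightarrow> bit \<Rightarrow> bit \<Rightarrow> bit" where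
  "exponent \<sigma> p q = (if \<sigma> (Y p q) = Y (p + \<alpha> \<sigma>) (q + \<beta> \<sigma>) then 0 else 1)"

lemma sign_closed [simp]: "sign b \<in> carrier M"
  using s(1) by (simp add: sign_def)

lemma sign_add: "sign (b + c) = sign b \<otimes>\<^bsub>M\<^esub> sign c"
  using s(1,2) by (cases b; cases c) (simp_all add: sign_def)

lemma sign_eqD: "u \<in> carrier M \<Longrightarrow> sign b \<otimes>\<^bsub>M\<^esub> u = sign c \<otimes>\<^bsub>M\<^esub> u \<Longrightarrow> b = c"
  using s(1,3) by (cases b; cases c) (auto simp: sign_def)

lemma act_M_mult: "\<sigma> \<in> carrier G \<Longrightarrow> u \<in> carrier M \<Longrightarrow> v \<in> carrier M \<Longrightarrow>
    \<sigma> (u \<otimes>\<^bsub>M\<^esub> v) = \<sigma> u \<otimes>\<^bsub>M\<^esub> \<sigma> v"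
  using act_hom by (auto simp: hom_def)

lemma act_sign: "\<sigma> \<in> carrier G \<Longrightarrow> \<sigma> (sign b) = sign b"
  using s(4) hom_one[OF act_hom M.is_group M.is_group] by (simp add: sign_def)

lemma act_Y_exponent:
  "\<sigma> \<in> carrier G \<Longrightarrow> \<sigma> (Y p q) = sign (exponent \<sigma> p q) \<otimes>\<^bsub>M\<^esub> Y (p + \<alpha> \<sigma>) (q + \<beta> \<sigma>)"
  using act_Y[of \<sigma> p q] Y by (auto simp: exponent_def sign_def)

lemma exponent_mult:
  assumes \<sigma>: "\<sigma> \<in> carrier G" and \<tau>: "\<tau> \<in> carrier G"
  shows "exponent (\<sigma> \<otimes> \<tau>) p q = exponent \<tau> p q + exponent \<sigma> (p + \<alpha> \<tau>) (q + \<beta> \<tau>)"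
proof (rule sign_eqD)
  let ?u = "Y (p + \<alpha> (\<sigma> \<otimes> \<tau>)) (q + \<beta> (\<sigma> \<otimes> \<tau>))"
  have "sign (exponent (\<sigma> \<otimes> \<tau>) p q) \<otimes>\<^bsub>M\<^esub> ?u = (\<sigma> \<otimes> \<tau>) (Y p q)"
    using \<sigma> \<tau> by (simp add: act_Y_exponent)
  also have "\<dots> = \<sigma> (\<tau> (Y p q))"
    using \<sigma> \<tau> Y M(2) by (intro act_comp) auto
  also have "\<dots> = sign (exponent \<tau> p q) \<otimes>\<^bsub>M\<^esub>
      (sign (exponent \<sigma> (p + \<alpha> \<tau>) (q + \<beta> \<tau>)) \<otimes>\<^bsub>M\<^esub> Y (p + \<alpha> \<tau> + \<alpha> \<sigma>) (q + \<beta> \<tau> + \<beta> \<sigma>))"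
    using \<sigma> \<tau> Y by (simp add: act_Y_exponent act_M_mult act_sign)
  also have "\<dots> = sign (exponent \<tau> p q + exponent \<sigma> (p + \<alpha> \<tau>) (q + \<beta> \<tau>)) \<otimes>\<^bsub>M\<^esub> ?u"
    using additive_onD[OF \<alpha>(1) \<sigma> \<tau>] additive_onD[OF \<beta>(1) \<sigma> \<tau>] Y
    by (simp add: sign_add M.m_assoc add_ac)
  finally show "sign (exponent (\<sigma> \<otimes> \<tau>) p q) \<otimes>\<^bsub>M\<^esub> ?u =
      sign (exponent \<tau> p q + exponent \<sigma> (p + \<alpha> \<tau>) (q + \<beta> \<tau>)) \<otimes>\<^bsub>M\<^esub> ?u" .
qed (rule Y)

lemma exponent_total:
  assumes \<sigma>: "\<sigma> \<in> carrier G"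
  shows "exponent \<sigma> 0 0 + exponent \<sigma> 0 1 + (exponent \<sigma> 1 0 + exponent \<sigma> 1 1) = \<alpha> \<sigma>"
proof (rule sign_eqD)
  let ?P = "Y 0 0 \<otimes>\<^bsub>M\<^esub> Y 0 1 \<otimes>\<^bsub>M\<^esub> (Y 1 0 \<otimes>\<^bsub>M\<^esub> Y 1 1)"
  have "sign (\<alpha> \<sigma>) \<otimes>\<^bsub>M\<^esub> ?P = \<sigma> ?P"
    using act_prod[OF \<sigma>] by (simp add: sign_def)
  also have "\<dots> = \<sigma> (Y 0 0) \<otimes>\<^bsub>M\<^esub> \<sigma> (Y 0 1) \<otimes>\<^bsub>M\<^esub> (\<sigma> (Y 1 0) \<otimes>\<^bsub>M\<^esub> \<sigma> (Y 1 1))"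
    using \<sigma> Y by (simp add: act_M_mult)
  also have "\<dots> = sign (exponent \<sigma> 0 0 + exponent \<sigma> 0 1 + (exponent \<sigma> 1 0 + exponent \<sigma> 1 1)) \<otimes>\<^bsub>M\<^esub> ?P"
    unfolding act_Y_exponent[OF \<sigma>] sign_add using Y
    by (cases "\<alpha> \<sigma>"; cases "\<beta> \<sigma>") (simp_all add: M.m_ac)
  finally show "sign (exponent \<sigma> 0 0 + exponent \<sigma> 0 1 + (exponent \<sigma> 1 0 + exponent \<sigma> 1 1)) \<otimes>\<^bsub>M\<^esub> ?P =
      sign (\<alpha> \<sigma>) \<otimes>\<^bsub>M\<^esub> ?P" by simp
qed (simp add: Y)

lemma locally_constant_exponent: "locally_constant exponent"
proof -
  have Y_K: "case_prod Y v \<in> K" for v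
    using Y M(2) by (cases v) auto
  have "locally_constant (\<lambda>\<sigma>. (\<alpha> \<sigma>, \<beta> \<sigma>, \<lambda>v. \<sigma> (case_prod Y v)))"
    by (intro locally_constant_Pair \<alpha>(2) \<beta>(2) locally_constant_apply Y_K)
  from locally_constant_comp[OF this,
      of "\<lambda>(a, b, h) p q. if h (p, q) = Y (p + a) (q + b) then 0 else 1"]
  show ?thesis
    by (simp add: exponent_def[abs_def])
qed

lemma has_U4_lift: "has_U4_lift \<alpha> \<beta>"
  unfolding has_U4_lift_def
proof (intro bexI conjI ballI)
  have "sign_cocycle \<alpha> \<beta> exponent"
    by (simp add: sign_cocycle_def exponent_mult exponent_total)
  then show "(\<lambda>\<sigma>. U4_of_signs (\<alpha> \<sigma>) (\<beta> \<sigma>) (exponent \<sigma>)) \<in> hom G U4"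
    by (rule U4_of_signs_hom[OF \<alpha>(1) \<beta>(1)])
  have "locally_constant (\<lambda>\<sigma>. (\<alpha> \<sigma>, \<beta> \<sigma>, exponent \<sigma>))"
    by (intro locally_constant_Pair \<alpha>(2) \<beta>(2) locally_constant_exponent)
  from locally_constant_comp[OF this, of "\<lambda>(a, b, e). U4_of_signs a b e"]
  show "locally_constant (\<lambda>\<sigma>. U4_of_signs (\<alpha> \<sigma>) (\<beta> \<sigma>) (exponent \<sigma>))" by simp
qed (simp add: U4_of_signs_def)

end

lemma artin_schreier_root_cases_char_2:
  fixes u v :: "'a::idom"
  assumes two: "(2::'a) = 0" and eq: "u * u + u = v * v + v"
  shows "u = v \<or> u = 1 + v"
proof -
  note double = add_self_char_2[OF two]
  have "(u + v) * (u + v + 1) = (u * u + u) + (v * v + v) + (u * v + u * v)"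
    by (simp add: algebra_simps)
  also have "\<dots> = 0" unfolding eq by (simp only: double add_0)
  finally have "u + v = 0 \<or> u + v + 1 = 0" by simp
  moreover have "u = (u + v) + v" "u = (u + v + 1) + (1 + v)"
    using two by (simp_all add: add_ac double)
  ultimately show ?thesis by (metis add_0)
qed

context galois_action
begin

lemma has_U4_lift_dependent:
  assumes \<alpha>: "additive_on (carrier G) \<alpha>" "locally_constant \<alpha>"
    and \<beta>: "additive_on (carrier G) \<beta>" "locally_constant \<beta>"
    and \<gamma>: "trivializes_cup \<gamma> \<alpha> \<alpha>" "locally_constant \<gamma>"
    and dep: "(\<forall>\<sigma>\<in>carrier G. \<alpha> \<sigma> = 0) \<or> (\<forall>\<sigma>\<in>carrier G. \<beta> \<sigma> = 0) \<or> (\<forall>\<sigma>\<in>carrier G. \<beta> \<sigma> = \<alpha> \<sigma>)"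
  shows "has_U4_lift \<alpha> \<beta>"
proof -
  have lift: "has_U4_lift \<alpha> \<beta>" if hom: "(\<lambda>\<sigma>. ((\<alpha> \<sigma>, \<alpha> \<sigma>, \<beta> \<sigma>), h (\<alpha> \<sigma>) (\<gamma> \<sigma>))) \<in> hom G U4" for h
  proof -
    have "locally_constant (\<lambda>\<sigma>. (\<alpha> \<sigma>, \<beta> \<sigma>, \<gamma> \<sigma>))"
      by (intro locally_constant_Pair \<alpha>(2) \<beta>(2) \<gamma>(2))
    from locally_constant_comp[OF this, of "\<lambda>(a, b, c). ((a, a, b), h a c)"]
    show ?thesis
      unfolding has_U4_lift_def by (intro bexI[OF _ hom]) simp
  qed
  note mult = additive_onD[OF \<alpha>(1)] additive_onD[OF \<beta>(1)] trivializes_cupD[OF \<gamma>(1)] mult_U4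
  from dep show ?thesis
  proof (elim disjE)
    assume "\<forall>\<sigma>\<in>carrier G. \<alpha> \<sigma> = 0"
    then show ?thesis
      by (intro lift[of "\<lambda>_ _. ((0, 0), 0)"] homI) (simp_all add: mult)
  next
    assume "\<forall>\<sigma>\<in>carrier G. \<beta> \<sigma> = 0"
    then show ?thesis
      by (intro lift[of "\<lambda>_ c. ((c, 0), 0)"] homI) (simp_all add: mult)
  next
    assume "\<forall>\<sigma>\<in>carrier G. \<beta> \<sigma> = \<alpha> \<sigma>"
    then show ?thesis
      by (intro lift[of "\<lambda>a c. ((c, c), a * c)"] homI) (simp_all add: mult algebra_simps)
  qed
qed

definition mult_group :: "'a monoid" where
  "mult_group = \<lparr>carrier = K - {0}, monoid.mult = (*), one = 1\<rparr>"

definition add_group :: "'a monoid" where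
  "add_group = \<lparr>carrier = K, monoid.mult = (+), one = 0\<rparr>"

lemma comm_group_mult_group: "comm_group mult_group"
proof (rule comm_groupI)
  show "\<exists>y\<in>carrier mult_group. y \<otimes>\<^bsub>mult_group\<^esub> x = \<one>\<^bsub>mult_group\<^esub>"
    if "x \<in> carrier mult_group" for x
    using that by (intro bexI[of _ "inverse x"]) (auto simp: mult_group_def K_inverse)
qed (auto simp: mult_group_def K_one K_mult mult_ac)

lemma comm_group_add_group: "comm_group add_group"
proof (rule comm_groupI)
  show "\<exists>y\<in>carrier add_group. y \<otimes>\<^bsub>add_group\<^esub> x = \<one>\<^bsub>add_group\<^esub>"
    if "x \<in> carrier add_group" for x
    using that by (intro bexI[of _ "- x"]) (auto simp: add_group_def K_uminus)
qed (auto simp: add_group_def K_zero K_add add_ac)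

lemma act_hom_mult_group: "\<sigma> \<in> carrier G \<Longrightarrow> \<sigma> \<in> hom mult_group mult_group"
  by (auto simp: hom_def mult_group_def act_closed act_mult act_eq_0_iff)

lemma act_hom_add_group: "\<sigma> \<in> carrier G \<Longrightarrow> \<sigma> \<in> hom add_group add_group"
  by (auto simp: hom_def add_group_def act_closed act_add)

lemma has_U4_lift_of_square_roots:
  fixes \<eta> :: "bit \<Rightarrow> bit \<Rightarrow> 'a"
  assumes two: "(2::'a) \<noteq> 0" and sqrt: "\<And>z. z \<in> K \<Longrightarrow> \<exists>y\<in>K. y * y = z"
    and \<alpha>: "additive_on (carrier G) \<alpha>" "locally_constant \<alpha>"
    and \<beta>: "additive_on (carrier G) \<beta>" "locally_constant \<beta>"
    and \<eta>: "\<And>p q. \<eta> p q \<in> K" "\<And>p q. \<eta> p q \<noteq> 0"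
      "\<And>\<sigma> p q. \<sigma> \<in> carrier G \<Longrightarrow> \<sigma> (\<eta> p q) = \<eta> (p + \<alpha> \<sigma>) (q + \<beta> \<sigma>)"
    and c: "c \<in> K" "c * c = \<eta> 0 0 * \<eta> 0 1 * (\<eta> 1 0 * \<eta> 1 1)"
      "\<And>\<sigma>. \<sigma> \<in> carrier G \<Longrightarrow> \<sigma> c = bit_sign (\<alpha> \<sigma>) * c"
  shows "has_U4_lift \<alpha> \<beta>"
proof -
  have "\<exists>y. y \<in> K \<and> y * y = \<eta> p q" for p q
    using sqrt[OF \<eta>(1)[of p q]] by blast
  then obtain Y where Y: "\<And>p q. Y p q \<in> K" "\<And>p q. Y p q * Y p q = \<eta> p q"
    by metis
  have Y_nonzero: "Y p q \<noteq> 0" for p q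
    using Y(2)[of p q] \<eta>(2)[of p q] by auto
  define P where "P = Y 0 0 * Y 0 1 * (Y 1 0 * Y 1 1)"
  have "P * P = c * c"
    by (simp add: P_def c(2) mult_ac flip: Y(2))
  then have "P = c \<or> P = - c" by (simp add: square_eq_iff)
  then have act_P: "\<sigma> P = bit_sign (\<alpha> \<sigma>) * P" if "\<sigma> \<in> carrier G" for \<sigma>
    using that c(1) c(3)[OF that] by (auto simp: act_uminus)
  interpret signed_roots G K mult_group "- 1" Y \<alpha> \<beta>
  proof (intro signed_roots.intro signed_roots_axioms.intro galois_action_axioms)
    show "comm_group mult_group" by (rule comm_group_mult_group)
    show "\<sigma> \<in> hom mult_group mult_group" if "\<sigma> \<in> carrier G" for \<sigma>
      by (rule act_hom_mult_group[OF that])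
    show "\<sigma> (- 1) = - 1" if "\<sigma> \<in> carrier G" for \<sigma>
      using act_uminus[OF that K_one] act_unit[OF that] by simp
    show "\<sigma> (Y p q) = Y (p + \<alpha> \<sigma>) (q + \<beta> \<sigma>) \<or>
        \<sigma> (Y p q) = - 1 \<otimes>\<^bsub>mult_group\<^esub> Y (p + \<alpha> \<sigma>) (q + \<beta> \<sigma>)" if "\<sigma> \<in> carrier G" for \<sigma> p q
    proof -
      have "\<sigma> (Y p q) * \<sigma> (Y p q) = Y (p + \<alpha> \<sigma>) (q + \<beta> \<sigma>) * Y (p + \<alpha> \<sigma>) (q + \<beta> \<sigma>)"
        using act_mult[OF that Y(1) Y(1), of p q p q] \<eta>(3)[OF that] Y(2) by simp
      then show ?thesis by (simp add: mult_group_def square_eq_iff)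
    qed
    show "\<sigma> (Y 0 0 \<otimes>\<^bsub>mult_group\<^esub> Y 0 1 \<otimes>\<^bsub>mult_group\<^esub> (Y 1 0 \<otimes>\<^bsub>mult_group\<^esub> Y 1 1)) =
        (if \<alpha> \<sigma> = 0 then \<one>\<^bsub>mult_group\<^esub> else - 1) \<otimes>\<^bsub>mult_group\<^esub>
          (Y 0 0 \<otimes>\<^bsub>mult_group\<^esub> Y 0 1 \<otimes>\<^bsub>mult_group\<^esub> (Y 1 0 \<otimes>\<^bsub>mult_group\<^esub> Y 1 1))"
      if "\<sigma> \<in> carrier G" for \<sigma>
      using act_P[OF that] by (simp add: mult_group_def bit_sign_def P_def)
    show "- 1 \<noteq> \<one>\<^bsub>mult_group\<^esub>"
      using two by (simp add: mult_group_def)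
  qed (use Y(1) Y_nonzero \<alpha> \<beta> K_one K_uminus in \<open>auto simp: mult_group_def\<close>)
  show ?thesis by (rule has_U4_lift)
qed

lemma has_U4_lift_of_artin_schreier_roots:
  fixes \<eta> :: "bit \<Rightarrow> bit \<Rightarrow> 'a"
  assumes two: "(2::'a) = 0" and artin_schreier: "\<And>z. z \<in> K \<Longrightarrow> \<exists>y\<in>K. y * y + y = z"
    and \<alpha>: "additive_on (carrier G) \<alpha>" "locally_constant \<alpha>"
    and \<beta>: "additive_on (carrier G) \<beta>" "locally_constant \<beta>"
    and \<eta>: "\<And>p q. \<eta> p q \<in> K"
      "\<And>\<sigma> p q. \<sigma> \<in> carrier G \<Longrightarrow> \<sigma> (\<eta> p q) = \<eta> (p + \<alpha> \<sigma>) (q + \<beta> \<sigma>)"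
    and c: "c \<in> K" "c * c + c = \<eta> 0 0 + \<eta> 0 1 + (\<eta> 1 0 + \<eta> 1 1)"
      "\<And>\<sigma>. \<sigma> \<in> carrier G \<Longrightarrow> \<sigma> c = c + of_bit (\<alpha> \<sigma>)"
  shows "has_U4_lift \<alpha> \<beta>"
proof -
  note double = add_self_char_2[OF two]
  note roots = artin_schreier_root_cases_char_2[OF two]
  have "\<exists>y. y \<in> K \<and> y * y + y = \<eta> p q" for p q
    using artin_schreier[OF \<eta>(1)[of p q]] by blast
  then obtain Y where Y: "\<And>p q. Y p q \<in> K" "\<And>p q. Y p q * Y p q + Y p q = \<eta> p q"
    by metis
  define P where "P = Y 0 0 + Y 0 1 + (Y 1 0 + Y 1 1)"
  have "P * P + P = (Y 0 0 * Y 0 0 + Y 0 0) + (Y 0 1 * Y 0 1 + Y 0 1) +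
      ((Y 1 0 * Y 1 0 + Y 1 0) + (Y 1 1 * Y 1 1 + Y 1 1))"
    by (simp add: P_def algebra_simps double)
  also have "\<dots> = c * c + c" unfolding Y(2) c(2) ..
  finally have "P = c \<or> P = 1 + c" by (rule roots)
  then have act_P: "\<sigma> P = of_bit (\<alpha> \<sigma>) + P" if "\<sigma> \<in> carrier G" for \<sigma>
    using that c(1) c(3)[OF that] by (auto simp: act_add act_unit K_one add_ac)
  interpret signed_roots G K add_group 1 Y \<alpha> \<beta>
  proof (intro signed_roots.intro signed_roots_axioms.intro galois_action_axioms)
    show "comm_group add_group" by (rule comm_group_add_group)
    show "\<sigma> \<in> hom add_group add_group" if "\<sigma> \<in> carrier G" for \<sigma>
      by (rule act_hom_add_group[OF that])
    show "\<sigma> (Y p q) = Y (p + \<alpha> \<sigma>) (q + \<beta> \<sigma>) \<or>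
        \<sigma> (Y p q) = 1 \<otimes>\<^bsub>add_group\<^esub> Y (p + \<alpha> \<sigma>) (q + \<beta> \<sigma>)" if "\<sigma> \<in> carrier G" for \<sigma> p q
    proof -
      have "\<sigma> (Y p q) * \<sigma> (Y p q) + \<sigma> (Y p q) = \<sigma> (\<eta> p q)"
        using that Y(1) by (simp add: act_add act_mult K_mult flip: Y(2))
      then have "\<sigma> (Y p q) * \<sigma> (Y p q) + \<sigma> (Y p q) =
          Y (p + \<alpha> \<sigma>) (q + \<beta> \<sigma>) * Y (p + \<alpha> \<sigma>) (q + \<beta> \<sigma>) + Y (p + \<alpha> \<sigma>) (q + \<beta> \<sigma>)"
        using \<eta>(2)[OF that] Y(2) by simp
      then show ?thesis using roots by (simp add: add_group_def)
    qed
    show "\<sigma> (Y 0 0 \<otimes>\<^bsub>add_group\<^esub> Y 0 1 \<otimes>\<^bsub>add_group\<^esub> (Y 1 0 \<otimes>\<^bsub>add_group\<^esub> Y 1 1)) =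
        (if \<alpha> \<sigma> = 0 then \<one>\<^bsub>add_group\<^esub> else 1) \<otimes>\<^bsub>add_group\<^esub>
          (Y 0 0 \<otimes>\<^bsub>add_group\<^esub> Y 0 1 \<otimes>\<^bsub>add_group\<^esub> (Y 1 0 \<otimes>\<^bsub>add_group\<^esub> Y 1 1))"
      if "\<sigma> \<in> carrier G" for \<sigma>
      using act_P[OF that] by (cases "\<alpha> \<sigma>") (simp_all add: add_group_def P_def)
  qed (use Y(1) \<alpha> \<beta> act_unit K_one two in \<open>auto simp: add_group_def\<close>)
  show ?thesis by (rule has_U4_lift)
qed

lemma ex_sign_traces_nonzero:
  fixes \<theta> \<omega> :: "bit \<Rightarrow> 'a"
  assumes two: "(2::'a) \<noteq> 0" and K: "\<theta> 0 \<in> K" "\<omega> 0 \<in> K" and "\<theta> 0 \<noteq> 0"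
    and norms: "\<theta> 0 * \<theta> 1 = \<omega> 0 * \<omega> 1"
    and \<sigma>: "\<sigma> \<in> carrier G" "\<sigma> (\<theta> 0) = \<theta> 1" "\<sigma> (\<omega> 0) = \<omega> 0"
  shows "\<exists>b. \<theta> 0 + \<theta> 1 + bit_sign b * (\<omega> 0 + \<omega> 1) \<noteq> 0"
proof (rule ccontr)
  assume "\<not> ?thesis"
  then have zero: "\<theta> 0 + \<theta> 1 + bit_sign b * (\<omega> 0 + \<omega> 1) = 0" for b
    by blast
  have "2 * (\<theta> 0 + \<theta> 1) =
      (\<theta> 0 + \<theta> 1 + bit_sign 0 * (\<omega> 0 + \<omega> 1)) + (\<theta> 0 + \<theta> 1 + bit_sign 1 * (\<omega> 0 + \<omega> 1))"
    by (simp add: bit_sign_def)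
  also have "\<dots> = 0" unfolding zero by simp
  finally have trace_\<theta>: "\<theta> 0 + \<theta> 1 = 0" using two mult_eq_0_iff by blast
  then have "\<omega> 0 + \<omega> 1 = 0" using zero[of 0] by simp
  then have "\<theta> 1 = - \<theta> 0" "\<omega> 1 = - \<omega> 0"
    using trace_\<theta> by (simp_all add: eq_neg_iff_add_eq_0 add.commute)
  then have "\<theta> 0 * \<theta> 0 = \<omega> 0 * \<omega> 0" using norms by simp
  then have "\<theta> 0 = \<omega> 0 \<or> \<theta> 0 = - \<omega> 0" by (simp add: square_eq_iff)
  then have "\<sigma> (\<theta> 0) = \<theta> 0" using \<sigma> K by (auto simp: act_uminus)
  then have "\<theta> 0 + \<theta> 0 = 0" using \<sigma>(2) trace_\<theta> by simp
  then show False using two \<open>\<theta> 0 \<noteq> 0\<close> by (simp flip: mult_2)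
qed

text \<open>With \<open>y\<close> and \<open>z\<close> the pairs induced by \<open>\<gamma>\<close> and \<open>\<delta>\<close>, the elements \<open>y\<^sub>p\<^sup>2\<close> and \<open>z\<^sub>q\<^sup>2\<close>
  have the norms \<open>(y\<^sub>0 y\<^sub>1)\<^sup>2\<close> and \<open>(z\<^sub>0 z\<^sub>1)\<^sup>2\<close>. Rescaling \<open>z\<^sub>q\<^sup>2\<close> by either sign of the invariant
  \<open>y\<^sub>0 y\<^sub>1 / (z\<^sub>0 z\<^sub>1)\<close> makes the norms agree, and at least one of the signs makes the sum of the
  traces nonzero.\<close>

lemma ex_norm_equation:
  assumes two: "(2::'a) \<noteq> 0"
    and \<alpha>: "additive_on (carrier G) \<alpha>" and \<beta>: "additive_on (carrier G) \<beta>"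
    and \<gamma>: "trivializes_cup \<gamma> \<alpha> \<alpha>" "locally_constant \<gamma>"
    and \<delta>: "trivializes_cup \<delta> \<alpha> \<beta>" "locally_constant \<delta>"
    and \<sigma>0: "\<sigma>0 \<in> carrier G" "\<alpha> \<sigma>0 = 1" "\<beta> \<sigma>0 = 0" and \<tau>0: "\<tau>0 \<in> carrier G" "\<beta> \<tau>0 = 1"
  obtains \<theta> \<omega> :: "bit \<Rightarrow> 'a" and \<nu> where
    "\<And>p. \<theta> p \<in> K" "\<And>\<sigma> p. \<sigma> \<in> carrier G \<Longrightarrow> \<sigma> (\<theta> p) = \<theta> (p + \<alpha> \<sigma>)"
    "\<And>q. \<omega> q \<in> K" "\<And>\<sigma> q. \<sigma> \<in> carrier G \<Longrightarrow> \<sigma> (\<omega> q) = \<omega> (q + \<beta> \<sigma>)"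
    "\<nu> \<in> K" "\<nu> \<noteq> 0" "\<And>\<sigma>. \<sigma> \<in> carrier G \<Longrightarrow> \<sigma> \<nu> = bit_sign (\<alpha> \<sigma>) * \<nu>"
    "\<theta> 0 * \<theta> 1 = \<nu> * \<nu>" "\<omega> 0 * \<omega> 1 = \<nu> * \<nu>" "\<theta> 0 + \<theta> 1 + (\<omega> 0 + \<omega> 1) \<noteq> 0"
proof -
  obtain y :: "bit \<Rightarrow> 'a" where y: "\<And>p. y p \<in> K" "\<And>p. y p \<noteq> 0"
    "\<And>\<sigma> p. \<sigma> \<in> carrier G \<Longrightarrow> \<sigma> (y p) = bit_sign (\<gamma> \<sigma> + \<alpha> \<sigma> * p) * y (p + \<alpha> \<sigma>)"
    using ex_signed_pair[OF \<alpha> \<gamma> \<sigma>0(1,2)] by blast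
  obtain z :: "bit \<Rightarrow> 'a" where z: "\<And>q. z q \<in> K" "\<And>q. z q \<noteq> 0"
    "\<And>\<sigma> q. \<sigma> \<in> carrier G \<Longrightarrow> \<sigma> (z q) = bit_sign (\<delta> \<sigma> + \<alpha> \<sigma> * q) * z (q + \<beta> \<sigma>)"
    using ex_signed_pair[OF \<beta> \<delta> \<tau>0] by blast
  define \<nu> where "\<nu> = y 0 * y 1"
  define \<mu> where "\<mu> = \<nu> * inverse (z 0 * z 1)"
  have \<mu>: "\<mu> \<in> K" "\<mu> \<noteq> 0" and \<nu>: "\<nu> \<in> K" "\<nu> \<noteq> 0"
    using y(1,2) z(1,2) by (simp_all add: \<mu>_def \<nu>_def K_mult K_inverse del: inverse_mult_distrib)
  have act_\<nu>: "\<sigma> \<nu> = bit_sign (\<alpha> \<sigma>) * \<nu>" if "\<sigma> \<in> carrier G" for \<sigma>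
    using y(1) y(3)[OF that] that
    by (cases "\<alpha> \<sigma>") (simp_all add: \<nu>_def act_mult bit_sign_def mult_ac)
  have "\<sigma> (z 0 * z 1) = bit_sign (\<alpha> \<sigma>) * (z 0 * z 1)" if "\<sigma> \<in> carrier G" for \<sigma>
    using z(1) z(3)[OF that] that
    by (cases "\<beta> \<sigma>") (simp_all add: act_mult bit_sign_def mult_ac)
  then have act_\<mu>: "\<sigma> \<mu> = \<mu>" if "\<sigma> \<in> carrier G" for \<sigma>
    using that act_\<nu>[OF that] \<nu>(1) z(1)
    by (simp add: \<mu>_def act_mult act_inverse K_mult K_inverse bit_sign_def
        del: inverse_mult_distrib)
  have act_\<theta>: "\<sigma> (y p * y p) = y (p + \<alpha> \<sigma>) * y (p + \<alpha> \<sigma>)" if "\<sigma> \<in> carrier G" for \<sigma> p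
    using y(1) y(3)[OF that] that by (simp add: act_mult bit_sign_def)
  define \<omega> where "\<omega> q = \<mu> * (z q * z q)" for q
  have \<omega>_K: "\<omega> q \<in> K" for q using \<mu> z(1) by (simp add: \<omega>_def K_mult)
  have act_\<omega>: "\<sigma> (\<omega> q) = \<omega> (q + \<beta> \<sigma>)" if "\<sigma> \<in> carrier G" for \<sigma> q
    using \<mu> z(1) z(3)[OF that] act_\<mu>[OF that] that
    by (simp add: \<omega>_def act_mult K_mult bit_sign_def)
  have norm_\<omega>: "\<omega> 0 * \<omega> 1 = \<nu> * \<nu>"
    using z(2) by (simp add: \<omega>_def \<mu>_def field_simps)
  obtain b where b: "y 0 * y 0 + y 1 * y 1 + bit_sign b * (\<omega> 0 + \<omega> 1) \<noteq> 0"
    using ex_sign_traces_nonzero[OF two, of "\<lambda>p. y p * y p" \<omega> \<sigma>0]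
      y(1,2) \<omega>_K norm_\<omega> \<sigma>0 act_\<theta>[OF \<sigma>0(1), of 0] act_\<omega>[OF \<sigma>0(1), of 0]
    by (auto simp: \<nu>_def K_mult mult_ac)
  show ?thesis
  proof (rule that[of "\<lambda>p. y p * y p" "\<lambda>q. bit_sign b * \<omega> q" \<nu>])
    show "bit_sign b * \<omega> 0 * (bit_sign b * \<omega> 1) = \<nu> * \<nu>"
      using norm_\<omega> by (simp add: bit_sign_def)
    show "y 0 * y 0 * (y 1 * y 1) = \<nu> * \<nu>" by (simp add: \<nu>_def mult_ac)
    show "y 0 * y 0 + y 1 * y 1 + (bit_sign b * \<omega> 0 + bit_sign b * \<omega> 1) \<noteq> 0"
      using b by (simp add: algebra_simps)
  qed (use y(1) \<omega>_K \<nu> act_\<theta> act_\<nu> act_\<omega> in \<open>auto simp: act_bit_sign intro: K_mult bit_sign_K\<close>)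
qed

lemma has_U4_lift_char_not_2:
  assumes two: "(2::'a) \<noteq> 0" and sqrt: "\<And>z. z \<in> K \<Longrightarrow> \<exists>y\<in>K. y * y = z"
    and \<alpha>: "additive_on (carrier G) \<alpha>" "locally_constant \<alpha>"
    and \<beta>: "additive_on (carrier G) \<beta>" "locally_constant \<beta>"
    and \<gamma>: "trivializes_cup \<gamma> \<alpha> \<alpha>" "locally_constant \<gamma>"
    and \<delta>: "trivializes_cup \<delta> \<alpha> \<beta>" "locally_constant \<delta>"
    and \<sigma>0: "\<sigma>0 \<in> carrier G" "\<alpha> \<sigma>0 = 1" "\<beta> \<sigma>0 = 0" and \<tau>0: "\<tau>0 \<in> carrier G" "\<beta> \<tau>0 = 1"
  shows "has_U4_lift \<alpha> \<beta>"
proof -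
  obtain \<theta> \<omega> :: "bit \<Rightarrow> 'a" and \<nu> where
    \<theta>: "\<And>p. \<theta> p \<in> K" "\<And>\<sigma> p. \<sigma> \<in> carrier G \<Longrightarrow> \<sigma> (\<theta> p) = \<theta> (p + \<alpha> \<sigma>)" and
    \<omega>: "\<And>q. \<omega> q \<in> K" "\<And>\<sigma> q. \<sigma> \<in> carrier G \<Longrightarrow> \<sigma> (\<omega> q) = \<omega> (q + \<beta> \<sigma>)" and
    \<nu>: "\<nu> \<in> K" "\<nu> \<noteq> 0" "\<And>\<sigma>. \<sigma> \<in> carrier G \<Longrightarrow> \<sigma> \<nu> = bit_sign (\<alpha> \<sigma>) * \<nu>" and
    norms: "\<theta> 0 * \<theta> 1 = \<nu> * \<nu>" "\<omega> 0 * \<omega> 1 = \<nu> * \<nu>" and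
    traces: "\<theta> 0 + \<theta> 1 + (\<omega> 0 + \<omega> 1) \<noteq> 0"
    using ex_norm_equation[OF two \<alpha>(1) \<beta>(1) \<gamma> \<delta> \<sigma>0 \<tau>0] by blast
  define t where "t = \<theta> 0 + \<theta> 1 + (\<omega> 0 + \<omega> 1)"
  have t_K: "t \<in> K" using \<theta>(1) \<omega>(1) by (simp add: t_def K_add)
  have act_t: "\<sigma> t = t" if "\<sigma> \<in> carrier G" for \<sigma>
    using that \<theta>(1) \<theta>(2)[OF that] \<omega>(1) \<omega>(2)[OF that]
    by (cases "\<alpha> \<sigma>"; cases "\<beta> \<sigma>") (simp_all add: t_def act_add K_add add_ac)
  have factor: "(\<theta> p + \<omega> 0) * (\<theta> p + \<omega> 1) = \<theta> p * t" for p
    using norms by (cases p) (simp_all add: t_def algebra_simps)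
  have "\<theta> p \<noteq> 0" for p
    using norms(1) \<nu>(2) by (cases p) auto
  then have nonzero: "\<theta> p + \<omega> q \<noteq> 0" for p q
    using factor[of p] traces by (cases q) (auto simp: t_def)
  show ?thesis
  proof (rule has_U4_lift_of_square_roots[OF two sqrt \<alpha> \<beta>, of "\<lambda>p q. \<theta> p + \<omega> q" "\<nu> * t"])
    show "\<sigma> (\<theta> p + \<omega> q) = \<theta> (p + \<alpha> \<sigma>) + \<omega> (q + \<beta> \<sigma>)" if "\<sigma> \<in> carrier G" for \<sigma> p q
      using act_add[OF that \<theta>(1) \<omega>(1)] \<theta>(2)[OF that] \<omega>(2)[OF that] by simp
    show "\<nu> * t * (\<nu> * t) = (\<theta> 0 + \<omega> 0) * (\<theta> 0 + \<omega> 1) * ((\<theta> 1 + \<omega> 0) * (\<theta> 1 + \<omega> 1))"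
      unfolding factor using norms(1) by (simp add: algebra_simps)
    show "\<sigma> (\<nu> * t) = bit_sign (\<alpha> \<sigma>) * (\<nu> * t)" if "\<sigma> \<in> carrier G" for \<sigma>
      using act_mult[OF that \<nu>(1) t_K] \<nu>(3)[OF that] act_t[OF that] by (simp add: mult.assoc)
  qed (use \<theta>(1) \<omega>(1) \<nu>(1) t_K nonzero in \<open>auto intro: K_add K_mult\<close>)
qed

lemma has_U4_lift_char_2:
  assumes two: "(2::'a) = 0" and artin_schreier: "\<And>z. z \<in> K \<Longrightarrow> \<exists>y\<in>K. y * y + y = z"
    and \<alpha>: "additive_on (carrier G) \<alpha>" "locally_constant \<alpha>"
    and \<beta>: "additive_on (carrier G) \<beta>" "locally_constant \<beta>"
  shows "has_U4_lift \<alpha> \<beta>"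
proof -
  note double = add_self_char_2[OF two]
  obtain u where u: "u \<in> K" "\<And>\<sigma>. \<sigma> \<in> carrier G \<Longrightarrow> \<sigma> u = u + of_bit (\<alpha> \<sigma>)"
    using additive_hilbert90_character[OF two subgroup_self \<alpha>] by blast
  obtain v where v: "v \<in> K" "\<And>\<sigma>. \<sigma> \<in> carrier G \<Longrightarrow> \<sigma> v = v + of_bit (\<beta> \<sigma>)"
    using additive_hilbert90_character[OF two subgroup_self \<beta>] by blast
  have shift: "\<sigma> (w + of_bit p) = w + of_bit (p + b)"
    if "\<sigma> \<in> carrier G" "w \<in> K" "\<sigma> w = w + of_bit b" for \<sigma> w p b
    using that two
    by (cases p; cases b) (simp_all add: act_add act_unit K_one add_ac double)
  define U where "U p = u + of_bit p" for p
  define V where "V q = v + of_bit q" for q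
  have UV_K: "U p \<in> K" "V p \<in> K" for p
    using u(1) v(1) by (cases p; simp add: U_def V_def K_add K_one)+
  have act_U: "\<sigma> (U p) = U (p + \<alpha> \<sigma>)" if "\<sigma> \<in> carrier G" for \<sigma> p
    unfolding U_def by (rule shift[OF that u(1) u(2)[OF that]])
  have act_V: "\<sigma> (V q) = V (q + \<beta> \<sigma>)" if "\<sigma> \<in> carrier G" for \<sigma> q
    unfolding V_def by (rule shift[OF that v(1) v(2)[OF that]])
  define d where "d = u * u + u"
  have d_K: "d \<in> K" using u(1) by (simp add: d_def K_add K_mult)
  have act_d: "\<sigma> d = d" if "\<sigma> \<in> carrier G" for \<sigma>
    using u(1) u(2)[OF that] that
    by (cases "\<alpha> \<sigma>") (simp_all add: d_def act_add act_mult K_mult algebra_simps double)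
  show ?thesis
  proof (rule has_U4_lift_of_artin_schreier_roots[OF two artin_schreier \<alpha> \<beta>,
        of "\<lambda>p q. d * (U p * V q)" u])
    show "\<sigma> (d * (U p * V q)) = d * (U (p + \<alpha> \<sigma>) * V (q + \<beta> \<sigma>))" if "\<sigma> \<in> carrier G" for \<sigma> p q
      using act_mult[OF that d_K K_mult[OF UV_K]] act_mult[OF that UV_K]
        act_d[OF that] act_U[OF that] act_V[OF that] by simp
    show "u * u + u = d * (U 0 * V 0) + d * (U 0 * V 1) + (d * (U 1 * V 0) + d * (U 1 * V 1))"
      unfolding d_def[symmetric] U_def V_def by (simp add: algebra_simps double)
  qed (use u d_K UV_K in \<open>simp_all add: K_mult\<close>)
qed

theorem has_U4_lift_of_cup_products_trivial:
  assumes sqrt: "\<And>z. (2::'a) \<noteq> 0 \<Longrightarrow> z \<in> K \<Longrightarrow> \<exists>y\<in>K. y * y = z"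
    and artin_schreier: "\<And>z. (2::'a) = 0 \<Longrightarrow> z \<in> K \<Longrightarrow> \<exists>y\<in>K. y * y + y = z"
    and \<alpha>: "additive_on (carrier G) \<alpha>" "locally_constant \<alpha>"
    and \<beta>: "additive_on (carrier G) \<beta>" "locally_constant \<beta>"
    and \<gamma>: "trivializes_cup \<gamma> \<alpha> \<alpha>" "locally_constant \<gamma>"
    and \<delta>: "trivializes_cup \<delta> \<alpha> \<beta>" "locally_constant \<delta>"
  shows "has_U4_lift \<alpha> \<beta>"
proof -
  consider (char_2) "(2::'a) = 0"
    | (dependent) "(\<forall>\<sigma>\<in>carrier G. \<alpha> \<sigma> = 0) \<or> (\<forall>\<sigma>\<in>carrier G. \<beta> \<sigma> = 0) \<or> (\<forall>\<sigma>\<in>carrier G. \<beta> \<sigma> = \<alpha> \<sigma>)"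
    | (independent) \<sigma>0 \<tau>0 where "(2::'a) \<noteq> 0" "\<sigma>0 \<in> carrier G" "\<alpha> \<sigma>0 = 1" "\<beta> \<sigma>0 = 0"
        "\<tau>0 \<in> carrier G" "\<beta> \<tau>0 = 1"
  proof (cases "\<exists>\<sigma>\<in>carrier G. \<alpha> \<sigma> = 1 \<and> \<beta> \<sigma> = 0")
    case True
    then show ?thesis using that by (metis bit_not_one_iff)
  next
    case False
    then have le: "\<beta> \<rho> = 1" if "\<rho> \<in> carrier G" "\<alpha> \<rho> = 1" for \<rho>
      using that by (metis bit_not_one_iff)
    have "\<beta> \<tau> = \<alpha> \<tau>" if "\<sigma> \<in> carrier G" "\<alpha> \<sigma> = 1" "\<tau> \<in> carrier G" for \<sigma> \<tau>
      using that le[of \<sigma>] le[of \<tau>] le[of "\<sigma> \<otimes> \<tau>"]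
        additive_onD[OF \<alpha>(1) that(1,3)] additive_onD[OF \<beta>(1) that(1,3)]
      by (cases "\<alpha> \<tau>"; cases "\<beta> \<tau>") simp_all
    then show ?thesis using that(2) bit_not_one_iff by metis
  qed
  then show ?thesis
  proof cases
    case char_2
    then show ?thesis by (intro has_U4_lift_char_2 artin_schreier \<alpha> \<beta>)
  next
    case dependent
    then show ?thesis by (rule has_U4_lift_dependent[OF \<alpha> \<beta> \<gamma>])
  next
    case independent
    then show ?thesis by (intro has_U4_lift_char_not_2[OF _ sqrt \<alpha> \<beta> \<gamma> \<delta>])
  qed
qed

end

section \<open>Continuous homomorphisms to discrete groups\<close>

definition continuous_hom ::
    "('a, 'm) monoid_scheme \<Rightarrow> 'a topology \<Rightarrow> ('b, 'n) monoid_scheme \<Rightarrow> ('a \<Rightarrow> 'b) \<Rightarrow> bool" where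
  "continuous_hom G T Q \<phi> \<longleftrightarrow>
     \<phi> \<in> hom G Q \<and> continuous_map T (discrete_topology (carrier Q)) \<phi>"

lemma continuous_hom_comp_hom:
  assumes "continuous_hom G T Q \<phi>" and "\<psi> \<in> hom Q Q'"
  shows "continuous_hom G T Q' (\<psi> \<circ> \<phi>)"
  using assms hom_compose[of \<phi> G Q \<psi> Q']
  by (auto simp: continuous_hom_def hom_def intro!: continuous_map_compose)

lemma continuous_hom_comp_continuous:
  assumes "continuous_hom G T Q \<phi>" and "f \<in> hom G' G" and "continuous_map T' T f"
  shows "continuous_hom G' T' Q (\<phi> \<circ> f)"
  using assms hom_compose[of f G' G \<phi> Q] continuous_map_compose
  by (auto simp: continuous_hom_def)

lemma continuous_hom_group_hom:
  "continuous_hom G T Q \<phi> \<Longrightarrow> group G \<Longrightarrow> group Q \<Longrightarrow> group_hom G Q \<phi>"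
  by (simp add: continuous_hom_def group_hom_def group_hom_axioms_def)

locale topologized_group = group G for G (structure) +
  fixes T :: "'a topology"
  assumes topspace_eq_carrier: "topspace T = carrier G"
begin

lemma continuous_hom_iff_openin:
  "continuous_hom G T Q \<phi> \<longleftrightarrow> \<phi> \<in> hom G Q \<and> (\<forall>A. openin T {x \<in> carrier G. \<phi> x \<in> A})"
proof (cases "\<phi> \<in> hom G Q")
  case True
  then have restrict: "{x \<in> carrier G. \<phi> x \<in> A} = {x \<in> carrier G. \<phi> x \<in> A \<inter> carrier Q}" for A
    by (auto simp: hom_def)
  have "continuous_map T (discrete_topology (carrier Q)) \<phi> \<longleftrightarrow>
      (\<forall>A. A \<subseteq> carrier Q \<longrightarrow> openin T {x \<in> carrier G. \<phi> x \<in> A})"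
    using True by (simp add: continuous_map_def topspace_eq_carrier hom_def)
  also have "\<dots> \<longleftrightarrow> (\<forall>A. openin T {x \<in> carrier G. \<phi> x \<in> A})"
  proof (intro iffI allI)
    fix A assume "\<forall>A. A \<subseteq> carrier Q \<longrightarrow> openin T {x \<in> carrier G. \<phi> x \<in> A}"
    then show "openin T {x \<in> carrier G. \<phi> x \<in> A}"
      unfolding restrict[of A] by (meson Int_lower2)
  qed simp
  finally show ?thesis using True by (simp add: continuous_hom_def)
qed (simp add: continuous_hom_def)

lemma closedin_continuous_hom_preimage:
  assumes "continuous_hom G T Q \<phi>"
  shows "closedin T {x \<in> carrier G. \<phi> x \<in> A}"
proof -
  have "topspace T - {x \<in> carrier G. \<phi> x \<in> A} = {x \<in> carrier G. \<phi> x \<in> - A}"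
    by (auto simp: topspace_eq_carrier)
  moreover have "openin T {x \<in> carrier G. \<phi> x \<in> - A}"
    using assms unfolding continuous_hom_iff_openin by blast
  ultimately show ?thesis by (auto simp: closedin_def topspace_eq_carrier)
qed

lemma topologized_group_quotient:
  assumes "N \<lhd> G"
  shows "topologized_group (G Mod N) (quotient_group_topology G T N)"
proof -
  have "\<Union>(carrier (G Mod N)) = carrier G"
    using rcosets_part_G[OF normal_imp_subgroup[OF assms]] by (simp add: FactGroup_def)
  then have "openin (quotient_group_topology G T N) (carrier (G Mod N))"
    using openin_topspace[of T]
    by (simp add: openin_quotient_group_topology[OF is_group assms] topspace_eq_carrier)
  moreover have "topspace (quotient_group_topology G T N) \<subseteq> carrier (G Mod N)"
    using openin_topspace[of "quotient_group_topology G T N"]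
    unfolding openin_quotient_group_topology[OF is_group assms] by blast
  ultimately show ?thesis
    using normal.factorgroup_is_group[OF assms]
    by (simp add: topologized_group_def topologized_group_axioms_def openin_subset subset_antisym)
qed

lemma Union_cosets_preimage:
  assumes "N \<lhd> G"
  shows "\<Union>{C \<in> carrier (G Mod N). \<psi> C \<in> A} = {x \<in> carrier G. \<psi> (N #> x) \<in> A}"
proof -
  interpret N: normal N G by (rule assms)
  show ?thesis
  proof (intro equalityI subsetI)
    fix x assume "x \<in> \<Union>{C \<in> carrier (G Mod N). \<psi> C \<in> A}"
    then obtain g where g: "g \<in> carrier G" "\<psi> (N #> g) \<in> A" "x \<in> N #> g"
      by (auto simp: carrier_FactGroup)
    then have "N #> x = N #> g"
      using repr_independence[OF g(3,1) N.is_subgroup] by simp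
    then show "x \<in> {x \<in> carrier G. \<psi> (N #> x) \<in> A}"
      using g r_coset_subset_G[OF N.subset g(1)] by auto
  next
    fix x assume "x \<in> {x \<in> carrier G. \<psi> (N #> x) \<in> A}"
    then show "x \<in> \<Union>{C \<in> carrier (G Mod N). \<psi> C \<in> A}"
      using rcos_self[OF _ N.is_subgroup, of x] by (auto simp: carrier_FactGroup)
  qed
qed

lemma continuous_hom_quotient_iff:
  assumes N: "N \<lhd> G" and \<psi>: "\<psi> \<in> hom (G Mod N) Q"
  shows "continuous_hom (G Mod N) (quotient_group_topology G T N) Q \<psi> \<longleftrightarrow>
           continuous_hom G T Q (\<lambda>x. \<psi> (N #> x))"
proof -
  have "(\<lambda>x. \<psi> (N #> x)) \<in> hom G Q"
    using Group.hom_compose[OF normal.r_coset_hom_Mod[OF N] \<psi>] by (simp add: o_def)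
  then show ?thesis
    using \<psi>
    by (simp add: continuous_hom_iff_openin openin_quotient_group_topology[OF is_group N]
        topologized_group.continuous_hom_iff_openin[OF topologized_group_quotient[OF N]]
        Union_cosets_preimage[OF N] subset_iff)
qed

lemma continuous_hom_factor:
  assumes N: "N \<lhd> G" and Q: "group Q" and \<phi>: "continuous_hom G T Q \<phi>" "N \<subseteq> kernel G Q \<phi>"
  obtains \<psi> where "continuous_hom (G Mod N) (quotient_group_topology G T N) Q \<psi>"
    "\<And>x. x \<in> carrier G \<Longrightarrow> \<psi> (N #> x) = \<phi> x"
proof -
  interpret group_hom G Q \<phi> by (rule continuous_hom_group_hom[OF \<phi>(1) is_group Q])
  obtain \<psi> where \<psi>: "\<psi> \<in> hom (G Mod N) Q" "\<And>x. x \<in> carrier G \<Longrightarrow> \<psi> (N #> x) = \<phi> x"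
    using FactGroup_universal_kernel[OF N \<phi>(2)] by blast
  have "continuous_hom G T Q (\<lambda>x. \<psi> (N #> x))"
    using \<phi>(1) \<psi> Group.hom_compose[OF normal.r_coset_hom_Mod[OF N] \<psi>(1)]
    by (simp add: continuous_hom_iff_openin o_def cong: conj_cong)
  then show ?thesis
    using \<psi> by (intro that[of \<psi>]) (simp_all add: continuous_hom_quotient_iff[OF N])
qed

lemma normal_Inter:
  assumes "\<N> \<noteq> {}" and "\<And>N. N \<in> \<N> \<Longrightarrow> N \<lhd> G"
  shows "\<Inter>\<N> \<lhd> G"
proof -
  have "subgroup (\<Inter>\<N>) G"
    by (rule subgroups_Inter) (use assms normal_imp_subgroup in auto)
  then show ?thesis
    unfolding normal_inv_iff using assms(2) by (auto simp: normal_inv_iff)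
qed

lemma normal_carrier: "carrier G \<lhd> G"
  by (simp add: normal_inv_iff subgroup_self)

lemma openin_carrier: "openin T (carrier G)" and closedin_carrier: "closedin T (carrier G)"
  using openin_topspace[of T] closedin_topspace[of T] by (simp_all add: topspace_eq_carrier)

lemma closed_normal_subgroup_generated_normal:
  assumes "R \<subseteq> carrier G"
  shows "closed_normal_subgroup_generated G T R \<lhd> G"
  unfolding closed_normal_subgroup_generated_def
  by (rule normal_Inter) (use normal_carrier closedin_carrier assms in auto)

lemma subset_closed_normal_subgroup_generated: "R \<subseteq> closed_normal_subgroup_generated G T R"
  unfolding closed_normal_subgroup_generated_def by blast

lemma closed_normal_subgroup_generated_subset_kernel:
  assumes Q: "group Q" and \<phi>: "continuous_hom G T Q \<phi>" and R: "R \<subseteq> kernel G Q \<phi>"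
  shows "closed_normal_subgroup_generated G T R \<subseteq> kernel G Q \<phi>"
proof -
  interpret group_hom G Q \<phi> by (rule continuous_hom_group_hom[OF \<phi> is_group Q])
  have "closedin T (kernel G Q \<phi>)"
    using closedin_continuous_hom_preimage[OF \<phi>, of "{\<one>\<^bsub>Q\<^esub>}"] by (simp add: kernel_def)
  then show ?thesis
    unfolding closed_normal_subgroup_generated_def using normal_kernel R by blast
qed

lemma pro_p_kernel_normal: "pro_p_kernel p G T \<lhd> G"
  unfolding pro_p_kernel_def
proof (rule normal_Inter)
  have "rcosets\<^bsub>G\<^esub> (carrier G) = {carrier G}"
    using coset_join2[OF _ subgroup_self] one_closed unfolding RCOSETS_def by blast
  then have "card (rcosets\<^bsub>G\<^esub> (carrier G)) = p ^ 0" by simp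
  then show "{N. N \<lhd> G \<and> openin T N \<and> (\<exists>k. card (rcosets\<^bsub>G\<^esub> N) = p ^ k)} \<noteq> {}"
    using normal_carrier openin_carrier by blast
qed blast

lemma pro_p_kernel_subset_kernel:
  assumes Q: "group Q" "card (carrier Q) = p ^ n" and p: "prime p" and \<phi>: "continuous_hom G T Q \<phi>"
  shows "pro_p_kernel p G T \<subseteq> kernel G Q \<phi>"
proof -
  interpret group_hom G Q \<phi> by (rule continuous_hom_group_hom[OF \<phi> is_group Q(1)])
  have "openin T (kernel G Q \<phi>)"
    using \<phi>[unfolded continuous_hom_iff_openin, THEN conjunct2, THEN spec, of "{\<one>\<^bsub>Q\<^esub>}"]
    by (simp add: kernel_def)
  moreover have "\<exists>k. card (rcosets\<^bsub>G\<^esub> (kernel G Q \<phi>)) = p ^ k"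
  proof -
    let ?I = "Q\<lparr>carrier := \<phi> ` carrier G\<rparr>"
    have "group_hom G ?I \<phi>"
      using H.subgroup_imp_group[OF img_is_subgroup] homh is_group
      by (auto simp: group_hom_def group_hom_axioms_def hom_def)
    then have "(\<lambda>C. the_elem (\<phi> ` C)) \<in> iso (G Mod kernel G ?I \<phi>) ?I"
      by (rule group_hom.FactGroup_iso_set) simp
    then have "card (carrier (G Mod kernel G Q \<phi>)) = card (\<phi> ` carrier G)"
      by (auto simp: iso_def kernel_def dest: bij_betw_same_card)
    also have "\<dots> dvd p ^ n"
      using H.lagrange[OF img_is_subgroup] Q(2) by (metis Coset.order_def dvd_triv_right)
    finally show ?thesis
      using divides_primepow_nat[OF p] by (auto simp: FactGroup_def)
  qed
  ultimately show ?thesis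
    unfolding pro_p_kernel_def using normal_kernel by blast
qed

end

text \<open>In cohomological terms: the triple Massey product of characters \<open>\<alpha>, \<alpha>, \<beta>\<close> contains \<open>0\<close>
  whenever it is defined.\<close>

definition vanishing_massey_aab :: "('a, 'm) monoid_scheme \<Rightarrow> 'a topology \<Rightarrow> bool" where
  "vanishing_massey_aab G T \<longleftrightarrow>
     (\<forall>\<phi> \<alpha> \<beta>. continuous_hom G T U4_mod_center \<phi> \<and> (\<forall>g\<in>carrier G. fst (\<phi> g) = (\<alpha> g, \<alpha> g, \<beta> g)) \<longrightarrow>
        (\<exists>\<rho>. continuous_hom G T U4 \<rho> \<and> (\<forall>g\<in>carrier G. fst (\<rho> g) = fst (\<phi> g))))"

lemma vanishing_massey_aabD:
  assumes "vanishing_massey_aab G T" and "continuous_hom G T U4_mod_center \<phi>"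
    and "\<And>g. g \<in> carrier G \<Longrightarrow> fst (\<phi> g) = (\<alpha> g, \<alpha> g, \<beta> g)"
  obtains \<rho> where "continuous_hom G T U4 \<rho>" "\<And>g. g \<in> carrier G \<Longrightarrow> fst (\<rho> g) = fst (\<phi> g)"
  using assms unfolding vanishing_massey_aab_def by blast

lemma (in topologized_group) vanishing_massey_aab_quotient:
  assumes N: "N \<lhd> G" and killed: "\<And>\<rho>. continuous_hom G T U4 \<rho> \<Longrightarrow> N \<subseteq> kernel G U4 \<rho>"
    and massey: "vanishing_massey_aab G T"
  shows "vanishing_massey_aab (G Mod N) (quotient_group_topology G T N)"
  unfolding vanishing_massey_aab_def
proof (intro allI impI, elim conjE)
  fix \<phi> \<alpha> \<beta>
  assume \<phi>: "continuous_hom (G Mod N) (quotient_group_topology G T N) U4_mod_center \<phi>"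
    and diag: "\<forall>C\<in>carrier (G Mod N). fst (\<phi> C) = (\<alpha> C, \<alpha> C, \<beta> C)"
  have "\<phi> \<in> hom (G Mod N) U4_mod_center"
    using \<phi> by (simp add: continuous_hom_def)
  then have "continuous_hom G T U4_mod_center (\<lambda>x. \<phi> (N #> x))"
    using \<phi> by (simp only: continuous_hom_quotient_iff[OF N])
  then obtain \<rho> where \<rho>: "continuous_hom G T U4 \<rho>"
    "\<And>x. x \<in> carrier G \<Longrightarrow> fst (\<rho> x) = fst (\<phi> (N #> x))"
    by (rule vanishing_massey_aabD[OF massey, of _ "\<lambda>x. \<alpha> (N #> x)" "\<lambda>x. \<beta> (N #> x)"])
      (use diag in \<open>auto simp: carrier_FactGroup\<close>)
  obtain \<rho>' where \<rho>': "continuous_hom (G Mod N) (quotient_group_topology G T N) U4 \<rho>'"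
    "\<And>x. x \<in> carrier G \<Longrightarrow> \<rho>' (N #> x) = \<rho> x"
    using continuous_hom_factor[OF N group_U4 \<rho>(1) killed[OF \<rho>(1)]] by blast
  then show "\<exists>\<rho>. continuous_hom (G Mod N) (quotient_group_topology G T N) U4 \<rho> \<and>
      (\<forall>C\<in>carrier (G Mod N). fst (\<rho> C) = fst (\<phi> C))"
    using \<rho>(2) by (auto simp: carrier_FactGroup)
qed

lemma vanishing_massey_aab_iso:
  assumes "topologized_group G T" and "topologized_group H U"
    and iso: "topologically_isomorphic G T H U" and massey: "vanishing_massey_aab H U"
  shows "vanishing_massey_aab G T"
  unfolding vanishing_massey_aab_def
proof (intro allI impI, elim conjE)
  interpret G: topologized_group G T by fact
  interpret H: topologized_group H U by fact
  fix \<phi> \<alpha> \<beta>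
  assume \<phi>: "continuous_hom G T U4_mod_center \<phi>"
    and diag: "\<forall>g\<in>carrier G. fst (\<phi> g) = (\<alpha> g, \<alpha> g, \<beta> g)"
  obtain h k where h: "h \<in> iso G H" and hk: "homeomorphic_maps T U h k"
    using iso unfolding topologically_isomorphic_def homeomorphic_map_maps by blast
  have kh: "k (h g) = g" if "g \<in> carrier G" for g
    using hk that by (simp add: homeomorphic_maps_def G.topspace_eq_carrier)
  have k: "k y \<in> carrier G" "h (k y) = y" if "y \<in> carrier H" for y
    using hk that
    by (auto simp: homeomorphic_maps_def continuous_map_def
        H.topspace_eq_carrier G.topspace_eq_carrier)
  have k_hom: "k \<in> hom H G"
  proof (rule homI)
    fix y z assume yz: "y \<in> carrier H" "z \<in> carrier H"
    have "h (k y \<otimes>\<^bsub>G\<^esub> k z) = y \<otimes>\<^bsub>H\<^esub> z"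
      using h k yz by (auto simp: iso_def hom_def)
    then show "k (y \<otimes>\<^bsub>H\<^esub> z) = k y \<otimes>\<^bsub>G\<^esub> k z"
      using kh[of "k y \<otimes>\<^bsub>G\<^esub> k z"] k yz by simp
  qed (rule k(1))
  have "continuous_hom H U U4_mod_center (\<phi> \<circ> k)"
    using hk by (intro continuous_hom_comp_continuous[OF \<phi> k_hom]) (simp add: homeomorphic_maps_def)
  then obtain \<rho> where \<rho>: "continuous_hom H U U4 \<rho>"
    "\<And>y. y \<in> carrier H \<Longrightarrow> fst (\<rho> y) = fst ((\<phi> \<circ> k) y)"
    by (rule vanishing_massey_aabD[OF massey, of _ "\<alpha> \<circ> k" "\<beta> \<circ> k"]) (use diag k(1) in auto)
  have "continuous_hom G T U4 (\<rho> \<circ> h)"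
    using hk h
    by (intro continuous_hom_comp_continuous[OF \<rho>(1)]) (auto simp: homeomorphic_maps_def iso_def)
  moreover have "fst ((\<rho> \<circ> h) g) = fst (\<phi> g)" if "g \<in> carrier G" for g
    using \<rho>(2)[of "h g"] kh[OF that] h that by (auto simp: iso_def hom_def)
  ultimately show "\<exists>\<rho>. continuous_hom G T U4 \<rho> \<and> (\<forall>g\<in>carrier G. fst (\<rho> g) = fst (\<phi> g))"
    by blast
qed

section \<open>The absolute Galois group\<close>

lemma absolute_galois_group_simps:
  "\<sigma> \<in> carrier (absolute_galois_group F) \<longleftrightarrow> \<sigma> \<in> extensional separable_closure \<and>
     bij_betw \<sigma> separable_closure separable_closure \<and>
     (\<forall>y\<in>separable_closure. \<forall>z\<in>separable_closure. \<sigma> (y + z) = \<sigma> y + \<sigma> z \<and> \<sigma> (y * z) = \<sigma> y * \<sigma> z) \<and>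
     (\<forall>c. \<sigma> (to_ac c) = to_ac c)"
  "\<sigma> \<otimes>\<^bsub>absolute_galois_group F\<^esub> \<tau> = compose separable_closure \<sigma> \<tau>"
  "\<one>\<^bsub>absolute_galois_group F\<^esub> = restrict (\<lambda>z. z) separable_closure"
  by (simp_all add: absolute_galois_group_def)

lemma absolute_galois_groupD:
  assumes "\<sigma> \<in> carrier (absolute_galois_group F)"
  shows "\<sigma> \<in> extensional separable_closure"
    and "\<And>z. z \<in> separable_closure \<Longrightarrow> \<sigma> z \<in> separable_closure"
    and "\<And>y z. y \<in> separable_closure \<Longrightarrow> z \<in> separable_closure \<Longrightarrow> \<sigma> (y + z) = \<sigma> y + \<sigma> z"
    and "\<And>y z. y \<in> separable_closure \<Longrightarrow> z \<in> separable_closure \<Longrightarrow> \<sigma> (y * z) = \<sigma> y * \<sigma> z"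
    and "\<And>c. \<sigma> (to_ac c) = to_ac c"
  using assms by (auto simp: absolute_galois_group_simps dest: bij_betwE)

lemma absolute_galois_group_inverse:
  assumes \<sigma>: "\<sigma> \<in> carrier (absolute_galois_group F)"
  defines "\<tau> \<equiv> restrict (inv_into separable_closure \<sigma>) separable_closure"
  shows "\<tau> \<in> carrier (absolute_galois_group F)"
    and "\<tau> \<otimes>\<^bsub>absolute_galois_group F\<^esub> \<sigma> = \<one>\<^bsub>absolute_galois_group F\<^esub>"
proof -
  have bij: "bij_betw \<sigma> separable_closure separable_closure"
    using \<sigma> by (simp add: absolute_galois_group_simps)
  have \<tau>: "\<tau> z \<in> separable_closure" "\<sigma> (\<tau> z) = z" "\<tau> (\<sigma> z) = z" if "z \<in> separable_closure" for z
    using that bij absolute_galois_groupD(2)[OF \<sigma>]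
    by (auto simp: \<tau>_def bij_betw_def inv_into_into f_inv_into_f)
  have inj: "y = z" if "\<sigma> y = \<sigma> z" "y \<in> separable_closure" "z \<in> separable_closure" for y z
    using bij that by (auto simp: bij_betw_def inj_on_def)
  show "\<tau> \<in> carrier (absolute_galois_group F)"
    unfolding absolute_galois_group_simps
  proof (intro conjI ballI allI)
    show "\<tau> \<in> extensional separable_closure" by (simp add: \<tau>_def)
    show "bij_betw \<tau> separable_closure separable_closure"
      unfolding \<tau>_def by (rule bij_betw_cong[THEN iffD2, OF _ bij_betw_inv_into[OF bij]]) simp
    show "\<tau> (y + z) = \<tau> y + \<tau> z" "\<tau> (y * z) = \<tau> y * \<tau> z"
      if "y \<in> separable_closure" "z \<in> separable_closure" for y z
      by (rule inj; simp add: that \<tau> absolute_galois_groupD(3,4)[OF \<sigma>]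
          separable_closure_add separable_closure_mult)+
    show "\<tau> (to_ac c) = to_ac c" for c
      using \<tau>(3)[OF separable_closure_to_ac[of c]] absolute_galois_groupD(5)[OF \<sigma>, of c] by simp
  qed
  show "\<tau> \<otimes>\<^bsub>absolute_galois_group F\<^esub> \<sigma> = \<one>\<^bsub>absolute_galois_group F\<^esub>"
    using \<tau>(3) by (auto simp: absolute_galois_group_simps(2,3) compose_def fun_eq_iff)
qed

lemma group_absolute_galois_group: "group (absolute_galois_group F)"
proof (rule groupI)
  fix \<sigma> \<tau>
  assume \<sigma>: "\<sigma> \<in> carrier (absolute_galois_group F)" and \<tau>: "\<tau> \<in> carrier (absolute_galois_group F)"
  then have "bij_betw (compose separable_closure \<sigma> \<tau>) separable_closure separable_closure"
    by (auto simp: absolute_galois_group_simps intro: bij_betw_compose)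
  then show "\<sigma> \<otimes>\<^bsub>absolute_galois_group F\<^esub> \<tau> \<in> carrier (absolute_galois_group F)"
    using absolute_galois_groupD[OF \<sigma>] absolute_galois_groupD[OF \<tau>]
    by (auto simp: absolute_galois_group_simps compose_def separable_closure_add separable_closure_mult
        separable_closure_to_ac)
next
  show "\<one>\<^bsub>absolute_galois_group F\<^esub> \<in> carrier (absolute_galois_group F)"
    by (auto simp: absolute_galois_group_simps bij_betw_def inj_on_def separable_closure_add
        separable_closure_mult separable_closure_to_ac)
next
  fix \<sigma> \<tau> \<rho> assume "\<tau> \<in> carrier (absolute_galois_group F)" "\<rho> \<in> carrier (absolute_galois_group F)"
  then show "\<sigma> \<otimes>\<^bsub>absolute_galois_group F\<^esub> \<tau> \<otimes>\<^bsub>absolute_galois_group F\<^esub> \<rho> =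
      \<sigma> \<otimes>\<^bsub>absolute_galois_group F\<^esub> (\<tau> \<otimes>\<^bsub>absolute_galois_group F\<^esub> \<rho>)"
    using absolute_galois_groupD(2)[of \<rho> F]
    by (auto simp: absolute_galois_group_simps(2) compose_def fun_eq_iff)
next
  fix \<sigma> assume \<sigma>: "\<sigma> \<in> carrier (absolute_galois_group F)"
  then show "\<one>\<^bsub>absolute_galois_group F\<^esub> \<otimes>\<^bsub>absolute_galois_group F\<^esub> \<sigma> = \<sigma>"
    using absolute_galois_groupD(1,2)[OF \<sigma>]
    by (auto simp: absolute_galois_group_simps(2,3) compose_def fun_eq_iff extensional_def)
  show "\<exists>\<tau>\<in>carrier (absolute_galois_group F).
      \<tau> \<otimes>\<^bsub>absolute_galois_group F\<^esub> \<sigma> = \<one>\<^bsub>absolute_galois_group F\<^esub>"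
    using absolute_galois_group_inverse[OF \<sigma>] by blast
qed

lemma absolute_galois_group_ac_eval:
  assumes \<sigma>: "\<sigma> \<in> carrier (absolute_galois_group F)" and u: "u \<in> separable_closure"
  shows "ac_eval p u \<in> separable_closure" and "\<sigma> (ac_eval p u) = ac_eval p (\<sigma> u)"
proof -
  have "ac_eval p u \<in> separable_closure \<and> \<sigma> (ac_eval p u) = ac_eval p (\<sigma> u)"
  proof (induction p)
    case 0
    show ?case
      using separable_closure_to_ac[of 0] absolute_galois_groupD(5)[OF \<sigma>, of 0] by simp
  next
    case (pCons a p)
    then show ?case
      using u absolute_galois_groupD(3-5)[OF \<sigma>]
      by (simp add: separable_closure_add separable_closure_mult separable_closure_to_ac)
  qed
  then show "ac_eval p u \<in> separable_closure" and "\<sigma> (ac_eval p u) = ac_eval p (\<sigma> u)" by blast+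
qed

lemma finite_absolute_galois_orbit:
  assumes u: "u \<in> separable_closure"
  shows "finite ((\<lambda>\<sigma>. \<sigma> u) ` carrier (absolute_galois_group F))"
proof -
  obtain m where m: "is_min_poly m u" using ex_is_min_poly by blast
  have "(\<lambda>\<sigma>. \<sigma> u) ` carrier (absolute_galois_group F) \<subseteq> {z. poly (map_poly to_ac m) z = 0}"
  proof safe
    fix \<sigma> assume \<sigma>: "\<sigma> \<in> carrier (absolute_galois_group F)"
    show "poly (map_poly to_ac m) (\<sigma> u) = 0"
      using absolute_galois_group_ac_eval(2)[OF \<sigma> u, of m] absolute_galois_groupD(5)[OF \<sigma>, of 0]
        is_min_polyD(2)[OF m] by (simp add: ac_eval_def)
  qed
  moreover have "map_poly to_ac m \<noteq> 0"
    using is_min_polyD(1)[OF m] by (simp add: map_poly_eq_0_iff)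
  ultimately show ?thesis using poly_roots_finite finite_subset by blast
qed

lemma galois_action_absolute_galois_group:
  fixes F :: "'f::field itself"
  shows "galois_action (absolute_galois_group F) separable_closure"
proof (intro galois_action.intro galois_action_axioms.intro group_absolute_galois_group
    finite_absolute_galois_orbit)
  show "1 \<in> (separable_closure :: 'f alg_closure set)"
    using separable_closure_to_ac[of 1] by simp
qed (simp_all add: separable_closure_add separable_closure_mult separable_closure_minus
    separable_closure_inverse absolute_galois_groupD absolute_galois_group_simps(2,3) compose_def)

lemma topologized_absolute_galois_group:
  "topologized_group (absolute_galois_group F) (krull_topology F)"
proof -
  have "topspace (krull_topology F) = carrier (absolute_galois_group F)"
    using absolute_galois_groupD(1,2)[of _ F] by (auto simp: krull_topology_def PiE_def)
  then show ?thesis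
    by (simp add: topologized_group_def topologized_group_axioms_def group_absolute_galois_group)
qed

lemma openin_krull_agree:
  fixes F :: "'f::field itself"
  assumes "finite A" and A: "A \<subseteq> separable_closure"
  shows "openin (krull_topology F) {\<tau> \<in> carrier (absolute_galois_group F). \<forall>z\<in>A. \<tau> z = \<sigma> z}"
proof -
  interpret topologized_group "absolute_galois_group F" "krull_topology F"
    by (rule topologized_absolute_galois_group)
  have "openin (krull_topology F) {\<tau> \<in> carrier (absolute_galois_group F). \<tau> z = \<sigma> z}"
    if "z \<in> A" for z
  proof -
    have "continuous_map (krull_topology F) (discrete_topology separable_closure) (\<lambda>\<tau>. \<tau> z)"
      unfolding krull_topology_def using that A
      by (intro continuous_map_from_subtopology continuous_map_product_projection) blast
    then have "openin (krull_topology F)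
        {\<tau> \<in> topspace (krull_topology F). \<tau> z \<in> {\<sigma> z} \<inter> separable_closure}"
      by (rule openin_continuous_map_preimage) simp
    moreover have "{\<tau> \<in> topspace (krull_topology F). \<tau> z \<in> {\<sigma> z} \<inter> separable_closure} =
        {\<tau> \<in> carrier (absolute_galois_group F). \<tau> z = \<sigma> z}"
      using that A absolute_galois_groupD(2)[of _ F z] by (auto simp: topspace_eq_carrier)
    ultimately show ?thesis by simp
  qed
  with \<open>finite A\<close> show ?thesis
  proof (induction A)
    case (insert z A)
    have "{\<tau> \<in> carrier (absolute_galois_group F). \<forall>z\<in>insert z A. \<tau> z = \<sigma> z} =
        {\<tau> \<in> carrier (absolute_galois_group F). \<tau> z = \<sigma> z} \<inter>
        {\<tau> \<in> carrier (absolute_galois_group F). \<forall>z\<in>A. \<tau> z = \<sigma> z}" by auto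
    then show ?case using insert by auto
  qed (simp add: openin_carrier)
qed

lemma krull_neighbourhood_one:
  fixes F :: "'f::field itself"
  assumes V: "openin (krull_topology F) V" "\<one>\<^bsub>absolute_galois_group F\<^esub> \<in> V"
  obtains A where "finite A" "A \<subseteq> separable_closure"
    "\<And>\<sigma>. \<sigma> \<in> carrier (absolute_galois_group F) \<Longrightarrow> (\<forall>z\<in>A. \<sigma> z = z) \<Longrightarrow> \<sigma> \<in> V"
proof -
  let ?K = "separable_closure :: 'f alg_closure set"
  obtain W where W: "openin (product_topology (\<lambda>_. discrete_topology ?K) ?K) W"
    "V = W \<inter> carrier (absolute_galois_group F)"
    using V(1) unfolding krull_topology_def openin_subtopology by blast
  then obtain U where U: "finite {z \<in> ?K. U z \<noteq> ?K}" "restrict (\<lambda>z. z) ?K \<in> PiE ?K U" "PiE ?K U \<subseteq> W"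
    using V(2) unfolding openin_product_topology_alt by (auto simp: absolute_galois_group_simps(3))
  show ?thesis
  proof (rule that[of "{z \<in> ?K. U z \<noteq> ?K}"])
    fix \<sigma> assume \<sigma>: "\<sigma> \<in> carrier (absolute_galois_group F)" "\<forall>z\<in>{z \<in> ?K. U z \<noteq> ?K}. \<sigma> z = z"
    have "\<sigma> z \<in> U z" if "z \<in> ?K" for z
      using that \<sigma>(2) U(2) absolute_galois_groupD(2)[OF \<sigma>(1) that]
      by (cases "U z = ?K") (auto simp: PiE_iff)
    then have "\<sigma> \<in> PiE ?K U"
      using absolute_galois_groupD(1)[OF \<sigma>(1)] by (auto simp: PiE_iff)
    then show "\<sigma> \<in> V" using U(3) W(2) \<sigma>(1) by blast
  qed (use U(1) in auto)
qed

lemma continuous_hom_imp_locally_constant: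
  fixes F :: "'f::field itself"
  assumes Q: "group Q" and \<phi>: "continuous_hom (absolute_galois_group F) (krull_topology F) Q \<phi>"
  shows "galois_action.locally_constant (absolute_galois_group F) separable_closure \<phi>"
proof -
  let ?G = "absolute_galois_group F"
  interpret galois_action ?G separable_closure by (rule galois_action_absolute_galois_group)
  interpret topologized_group ?G "krull_topology F" by (rule topologized_absolute_galois_group)
  interpret \<phi>: group_hom ?G Q \<phi> by (rule continuous_hom_group_hom[OF \<phi> is_group Q])
  have "openin (krull_topology F) {\<sigma> \<in> carrier ?G. \<phi> \<sigma> \<in> {\<one>\<^bsub>Q\<^esub>}}"
    using \<phi> unfolding continuous_hom_iff_openin by blast
  then obtain A where A: "finite A" "A \<subseteq> separable_closure"
    "\<And>\<sigma>. \<sigma> \<in> carrier ?G \<Longrightarrow> \<forall>z\<in>A. \<sigma> z = z \<Longrightarrow> \<sigma> \<in> {\<sigma> \<in> carrier ?G. \<phi> \<sigma> \<in> {\<one>\<^bsub>Q\<^esub>}}"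
    by (rule krull_neighbourhood_one) auto
  show ?thesis
    unfolding locally_constant_def
  proof (intro exI[of _ A] conjI ballI impI A(1,2))
    fix \<sigma> \<tau> assume \<sigma>: "\<sigma> \<in> carrier ?G" and \<tau>: "\<tau> \<in> carrier ?G" and agree: "\<forall>z\<in>A. \<sigma> z = \<tau> z"
    have "(inv\<^bsub>?G\<^esub> \<sigma> \<otimes>\<^bsub>?G\<^esub> \<tau>) z = z" if "z \<in> A" for z
      using that agree A(2) act_inv_cancel[OF \<sigma>, of z] act_comp[OF inv_closed[OF \<sigma>] \<tau>, of z] by auto
    then have "\<phi> (inv\<^bsub>?G\<^esub> \<sigma> \<otimes>\<^bsub>?G\<^esub> \<tau>) = \<one>\<^bsub>Q\<^esub>"
      using A(3)[of "inv\<^bsub>?G\<^esub> \<sigma> \<otimes>\<^bsub>?G\<^esub> \<tau>"] \<sigma> \<tau> by simp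
    then have "inv\<^bsub>Q\<^esub> (\<phi> \<sigma>) \<otimes>\<^bsub>Q\<^esub> \<phi> \<tau> = \<one>\<^bsub>Q\<^esub>" using \<sigma> \<tau> by simp
    then show "\<phi> \<sigma> = \<phi> \<tau>"
      using \<sigma> \<tau> by (metis \<phi>.H.inv_closed \<phi>.H.inv_equality \<phi>.H.inv_inv \<phi>.hom_closed)
  qed
qed

lemma locally_constant_imp_continuous_hom:
  fixes F :: "'f::field itself"
  assumes \<phi>: "\<phi> \<in> hom (absolute_galois_group F) Q"
    and lc: "galois_action.locally_constant (absolute_galois_group F) separable_closure \<phi>"
  shows "continuous_hom (absolute_galois_group F) (krull_topology F) Q \<phi>"
proof -
  let ?G = "absolute_galois_group F"
  interpret galois_action ?G separable_closure by (rule galois_action_absolute_galois_group)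
  interpret topologized_group ?G "krull_topology F" by (rule topologized_absolute_galois_group)
  from lc obtain A where A: "finite A" "A \<subseteq> separable_closure"
    "\<And>\<sigma> \<tau>. \<sigma> \<in> carrier ?G \<Longrightarrow> \<tau> \<in> carrier ?G \<Longrightarrow> (\<forall>z\<in>A. \<sigma> z = \<tau> z) \<Longrightarrow> \<phi> \<sigma> = \<phi> \<tau>"
    by (rule locally_constantE) blast
  have "openin (krull_topology F) {\<sigma> \<in> carrier ?G. \<phi> \<sigma> \<in> B}" for B
  proof (subst openin_subopen, intro ballI)
    fix \<sigma> assume \<sigma>: "\<sigma> \<in> {\<sigma> \<in> carrier ?G. \<phi> \<sigma> \<in> B}"
    have "{\<tau> \<in> carrier ?G. \<forall>z\<in>A. \<tau> z = \<sigma> z} \<subseteq> {\<tau> \<in> carrier ?G. \<phi> \<tau> \<in> B}"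
    proof
      fix \<tau> assume "\<tau> \<in> {\<tau> \<in> carrier ?G. \<forall>z\<in>A. \<tau> z = \<sigma> z}"
      then show "\<tau> \<in> {\<tau> \<in> carrier ?G. \<phi> \<tau> \<in> B}" using A(3)[of \<tau> \<sigma>] \<sigma> by simp
    qed
    then show "\<exists>U. openin (krull_topology F) U \<and> \<sigma> \<in> U \<and> U \<subseteq> {\<sigma> \<in> carrier ?G. \<phi> \<sigma> \<in> B}"
      using \<sigma> openin_krull_agree[OF A(1,2), of F \<sigma>] by blast
  qed
  then show ?thesis
    using \<phi> by (simp add: continuous_hom_iff_openin)
qed

lemma separable_closure_ex_sqrt:
  assumes "(2 :: 'f::field alg_closure) \<noteq> 0" and z: "z \<in> (separable_closure :: 'f alg_closure set)"
  shows "\<exists>y\<in>separable_closure. y * y = z"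
proof -
  have "CHAR('f) \<noteq> 2"
    using assms(1) of_nat_CHAR[where 'a = "'f alg_closure"] by auto
  moreover obtain y where "y ^ 2 = z" using nth_root_exists[of 2 z] by auto
  ultimately show ?thesis
    using separable_closure_sqrt[of y] z by (auto simp: power2_eq_square)
qed

lemma separable_closure_ex_artin_schreier_root:
  assumes "(2 :: 'f::field alg_closure) = 0" and z: "z \<in> (separable_closure :: 'f alg_closure set)"
  shows "\<exists>y\<in>separable_closure. y * y + y = z"
proof -
  have "CHAR('f) dvd 2"
    using assms(1) of_nat_eq_0_iff_char_dvd[where 'a = "'f alg_closure", of 2] by simp
  then have "CHAR('f) = 2"
    using CHAR_not_1'[where 'a = 'f] two_is_prime_nat by (auto simp: prime_nat_iff)
  moreover obtain y where "poly [:-z, 1, 1:] y = 0"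
    using alg_closed_imp_poly_has_root[of "[:-z, 1, 1:]"] by auto
  then have "y * y + y = z" by (simp add: algebra_simps eq_neg_iff_add_eq_0)
  ultimately show ?thesis
    using separable_closure_artin_schreier[of y] z by auto
qed

theorem vanishing_massey_aab_absolute_galois_group:
  fixes F :: "'f::field itself"
  shows "vanishing_massey_aab (absolute_galois_group F) (krull_topology F)"
  unfolding vanishing_massey_aab_def
proof (intro allI impI, elim conjE)
  let ?G = "absolute_galois_group F"
  interpret galois_action ?G separable_closure by (rule galois_action_absolute_galois_group)
  fix \<phi> \<alpha>' \<beta>'
  assume \<phi>: "continuous_hom ?G (krull_topology F) U4_mod_center \<phi>"
    and diag: "\<forall>g\<in>carrier ?G. fst (\<phi> g) = (\<alpha>' g, \<alpha>' g, \<beta>' g)"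
  have "locally_constant \<phi>"
    by (rule continuous_hom_imp_locally_constant[OF group_U4_mod_center \<phi>])
  then have lc: "locally_constant (\<lambda>\<sigma>. g (\<phi> \<sigma>))" for g :: "_ \<Rightarrow> bit"
    by (rule locally_constant_comp)
  define \<alpha> where "\<alpha> \<sigma> = fst (fst (\<phi> \<sigma>))" for \<sigma>
  define \<beta> where "\<beta> \<sigma> = snd (snd (fst (\<phi> \<sigma>)))" for \<sigma>
  define \<gamma> where "\<gamma> \<sigma> = fst (snd (\<phi> \<sigma>))" for \<sigma>
  define \<delta> where "\<delta> \<sigma> = snd (snd (\<phi> \<sigma>))" for \<sigma>
  have \<phi>_eq: "\<phi> \<sigma> = ((\<alpha> \<sigma>, \<alpha> \<sigma>, \<beta> \<sigma>), (\<gamma> \<sigma>, \<delta> \<sigma>))" if "\<sigma> \<in> carrier ?G" for \<sigma>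
    using diag that by (simp add: \<alpha>_def \<beta>_def \<gamma>_def \<delta>_def prod_eq_iff)
  have mult: "\<phi> (\<sigma> \<otimes>\<^bsub>?G\<^esub> \<tau>) = \<phi> \<sigma> \<otimes>\<^bsub>U4_mod_center\<^esub> \<phi> \<tau>" if "\<sigma> \<in> carrier ?G" "\<tau> \<in> carrier ?G" for \<sigma> \<tau>
    using \<phi> that by (auto simp: continuous_hom_def hom_def)
  have "has_U4_lift \<alpha> \<beta>"
  proof (rule has_U4_lift_of_cup_products_trivial)
    show "additive_on (carrier ?G) \<alpha>" "additive_on (carrier ?G) \<beta>"
      "trivializes_cup \<gamma> \<alpha> \<alpha>" "trivializes_cup \<delta> \<alpha> \<beta>"
      using mult by (auto simp: additive_on_def trivializes_cup_def \<phi>_eq mult_U4_mod_center)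
    show "locally_constant \<alpha>" "locally_constant \<beta>" "locally_constant \<gamma>" "locally_constant \<delta>"
      unfolding \<alpha>_def[abs_def] \<beta>_def[abs_def] \<gamma>_def[abs_def] \<delta>_def[abs_def] by (rule lc)+
  qed (rule separable_closure_ex_sqrt separable_closure_ex_artin_schreier_root; assumption)+
  then obtain \<rho> where "\<rho> \<in> hom ?G U4" "locally_constant \<rho>"
    "\<And>\<sigma>. \<sigma> \<in> carrier ?G \<Longrightarrow> fst (\<rho> \<sigma>) = (\<alpha> \<sigma>, \<alpha> \<sigma>, \<beta> \<sigma>)"
    unfolding has_U4_lift_def by blast
  then show "\<exists>\<rho>. continuous_hom ?G (krull_topology F) U4 \<rho> \<and> (\<forall>\<sigma>\<in>carrier ?G. fst (\<rho> \<sigma>) = fst (\<phi> \<sigma>))"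
    using \<phi>_eq by (intro exI[of _ \<rho>]) (simp add: locally_constant_imp_continuous_hom)
qed

section \<open>The Zassenhaus filtration and canonical decompositions\<close>

lemma (in group_hom) hom_commutator:
  "x \<in> carrier G \<Longrightarrow> y \<in> carrier G \<Longrightarrow> h (commutator G x y) = commutator H (h x) (h y)"
  by (simp add: commutator_def)

lemma (in group) commutator_closed [simp, intro]:
  "x \<in> carrier G \<Longrightarrow> y \<in> carrier G \<Longrightarrow> commutator G x y \<in> carrier G"
  by (simp add: commutator_def)

context topologized_group
begin

lemma closed_subgroup_generated_subset_preimage:
  assumes Q: "group Q" and \<phi>: "continuous_hom G T Q \<phi>" and P: "subgroup P Q"
    and A: "A \<subseteq> {x \<in> carrier G. \<phi> x \<in> P}"
  shows "closed_subgroup_generated G T A \<subseteq> {x \<in> carrier G. \<phi> x \<in> P}"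
proof -
  interpret \<phi>: group_hom G Q \<phi> by (rule continuous_hom_group_hom[OF \<phi> is_group Q])
  have "subgroup {x \<in> carrier G. \<phi> x \<in> P} G"
    by (rule subgroupI)
      (use P subgroup.one_closed subgroup.m_closed subgroup.m_inv_closed in \<open>fastforce+\<close>)
  then show ?thesis
    unfolding closed_subgroup_generated_def
    using closedin_continuous_hom_preimage[OF \<phi>] A by blast
qed

lemma closed_square_subgroup_subset_preimage:
  assumes Q: "group Q" and \<phi>: "continuous_hom G T Q \<phi>" and P: "subgroup P Q"
    and A: "A \<subseteq> {x \<in> carrier G. \<phi> x \<in> P'}" and square: "\<And>y. y \<in> P' \<Longrightarrow> y \<otimes>\<^bsub>Q\<^esub> y \<in> P"
  shows "closed_square_subgroup G T A \<subseteq> {x \<in> carrier G. \<phi> x \<in> P}"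
  unfolding closed_square_subgroup_def
proof (rule closed_subgroup_generated_subset_preimage[OF Q \<phi> P])
  interpret group_hom G Q \<phi> by (rule continuous_hom_group_hom[OF \<phi> is_group Q])
  show "{h [^] (2::nat) | h. h \<in> A} \<subseteq> {x \<in> carrier G. \<phi> x \<in> P}"
    using A square by (auto simp: numeral_2_eq_2 subset_iff)
qed

lemma closed_commutator_subgroup_subset_preimage:
  assumes Q: "group Q" and \<phi>: "continuous_hom G T Q \<phi>" and P: "subgroup P Q"
    and A: "A \<subseteq> {x \<in> carrier G. \<phi> x \<in> P'}" and B: "B \<subseteq> {x \<in> carrier G. \<phi> x \<in> P''}"
    and comm: "\<And>y z. y \<in> P' \<Longrightarrow> z \<in> P'' \<Longrightarrow> commutator Q y z \<in> P"
  shows "closed_commutator_subgroup G T A B \<subseteq> {x \<in> carrier G. \<phi> x \<in> P}"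
  unfolding closed_commutator_subgroup_def
proof (rule closed_subgroup_generated_subset_preimage[OF Q \<phi> P])
  interpret group_hom G Q \<phi> by (rule continuous_hom_group_hom[OF \<phi> is_group Q])
  show "{commutator G h k | h k. h \<in> A \<and> k \<in> B} \<subseteq> {x \<in> carrier G. \<phi> x \<in> P}"
    using A B comm by (auto simp: hom_commutator subset_iff)
qed

lemma foldl_set_mult_subset_preimage:
  assumes \<phi>: "group_hom G Q \<phi>" and P: "subgroup P Q"
    and "A \<subseteq> {x \<in> carrier G. \<phi> x \<in> P}" and "\<And>B. B \<in> set Bs \<Longrightarrow> B \<subseteq> {x \<in> carrier G. \<phi> x \<in> P}"
  shows "foldl (\<lambda>A B. A <#> B) A Bs \<subseteq> {x \<in> carrier G. \<phi> x \<in> P}"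
  using assms(3,4)
proof (induction Bs arbitrary: A)
  case (Cons B Bs)
  interpret group_hom G Q \<phi> by (rule \<phi>)
  have "A <#> B \<subseteq> {x \<in> carrier G. \<phi> x \<in> P}"
    using Cons.prems(1) Cons.prems(2)[of B] subgroup.m_closed[OF P]
    by (fastforce simp: set_mult_def)
  then show ?case using Cons by simp
qed simp

lemma zassenhaus_subset_preimage:
  assumes Q: "group Q" and \<phi>: "continuous_hom G T Q \<phi>"
    and subgroup: "\<And>n. subgroup (P n) Q" and top: "P 1 = carrier Q"
    and square: "\<And>m n y. y \<in> P m \<Longrightarrow> n \<le> 2 * m \<Longrightarrow> y \<otimes>\<^bsub>Q\<^esub> y \<in> P n"
    and comm: "\<And>m n y z. y \<in> P m \<Longrightarrow> z \<in> P n \<Longrightarrow> 0 < m \<Longrightarrow> 0 < n \<Longrightarrow> commutator Q y z \<in> P (m + n)"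
    and "0 < n"
  shows "zassenhaus G T n \<subseteq> {x \<in> carrier G. \<phi> x \<in> P n}"
  using \<open>0 < n\<close>
proof (induction n rule: less_induct)
  case (less n)
  interpret group_hom G Q \<phi> by (rule continuous_hom_group_hom[OF \<phi> is_group Q])
  show ?case
  proof (cases "n = 1")
    case True
    then show ?thesis by (subst zassenhaus.simps) (auto simp: top simp del: One_nat_def)
  next
    case False
    then have n: "\<not> n \<le> 1" using less.prems by simp
    show ?thesis
      unfolding zassenhaus.simps[of G T n] if_not_P[OF n]
    proof (rule foldl_set_mult_subset_preimage[OF group_hom_axioms subgroup])
      show "closed_square_subgroup G T (zassenhaus G T ((n + 1) div 2))
          \<subseteq> {x \<in> carrier G. \<phi> x \<in> P n}"
      proof (rule closed_square_subgroup_subset_preimage[OF Q \<phi> subgroup])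
        show "zassenhaus G T ((n + 1) div 2) \<subseteq> {x \<in> carrier G. \<phi> x \<in> P ((n + 1) div 2)}"
          using n by (intro less.IH) auto
        show "y \<otimes>\<^bsub>Q\<^esub> y \<in> P n" if "y \<in> P ((n + 1) div 2)" for y
          by (rule square[OF that]) linarith
      qed
    next
      fix B assume "B \<in> set (map (\<lambda>i. closed_commutator_subgroup G T (zassenhaus G T i)
        (zassenhaus G T (n - i))) [1..<n])"
      then obtain i where
        B: "B = closed_commutator_subgroup G T (zassenhaus G T i) (zassenhaus G T (n - i))"
        and "i \<in> set [1..<n]"
        unfolding set_map by (elim imageE)
      then have i: "0 < i" "i < n" by auto
      then show "B \<subseteq> {x \<in> carrier G. \<phi> x \<in> P n}"
        unfolding B using comm[of _ i _ "n - i"]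
        by (intro closed_commutator_subgroup_subset_preimage[OF Q \<phi> subgroup,
            of _ "P i" _ "P (n - i)"]
            less.IH) auto
    qed
  qed
qed

lemma zassenhaus_4_killed_by_U4:
  assumes \<rho>: "continuous_hom G T U4 \<rho>" and z: "z \<in> zassenhaus G T 4"
  shows "z \<in> carrier G" and "\<rho> z = \<one>\<^bsub>U4\<^esub>"
proof -
  have "U4_filtration 1 = carrier U4" by (auto simp: U4_filtration_def)
  then have "zassenhaus G T 4 \<subseteq> {x \<in> carrier G. \<rho> x \<in> U4_filtration 4}"
    by (intro zassenhaus_subset_preimage[OF group_U4 \<rho>] subgroup_U4_filtration
        U4_filtration_square U4_filtration_commutator) auto
  then show "z \<in> carrier G" and "\<rho> z = \<one>\<^bsub>U4\<^esub>"
    using z by (auto simp: U4_filtration_4)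
qed

end

lemma (in group_hom) hom_ordered_finite_product:
  assumes L: "irrefl L" "trans L" "total L" and F: "finite F" "F \<subseteq> A"
    and f: "\<And>t. t \<in> A \<Longrightarrow> f t \<in> carrier G"
    and trivial: "\<And>t. t \<in> A \<Longrightarrow> t \<noteq> u \<Longrightarrow> h (f t) = \<one>\<^bsub>H\<^esub>"
  shows "h (ordered_finite_product G L f F) = (if u \<in> F then h (f u) else \<one>\<^bsub>H\<^esub>)"
proof -
  interpret L: linorder "\<lambda>u v. u = v \<or> (u, v) \<in> L" "\<lambda>u v. (u, v) \<in> L"
    by unfold_locales (use L in \<open>auto simp: irrefl_def total_on_def dest: transD\<close>)
  let ?ts = "THE ts. set ts = F \<and> sorted_wrt (\<lambda>u v. (u, v) \<in> L) ts"
  have "\<exists>!ts. set ts = F \<and> sorted_wrt (\<lambda>u v. (u, v) \<in> L) ts"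
    using L.finite_set_strict_sorted[OF F(1)] L.strict_sorted_equal by metis
  then have ts: "set ?ts = F" "sorted_wrt (\<lambda>u v. (u, v) \<in> L) ?ts"
    using theI'[of "\<lambda>ts. set ts = F \<and> sorted_wrt (\<lambda>u v. (u, v) \<in> L) ts"] by blast+
  then have "distinct ?ts" using L.strict_sorted_iff by blast
  have "foldr (\<lambda>t z. f t \<otimes> z) ts \<one> \<in> carrier G \<and>
      h (foldr (\<lambda>t z. f t \<otimes> z) ts \<one>) = (if u \<in> set ts then h (f u) else \<one>\<^bsub>H\<^esub>)"
    if "set ts \<subseteq> A" "distinct ts" for ts
    using that
  proof (induction ts)
    case (Cons t ts)
    then show ?case using f[of t] f[of u] trivial[of t] by (cases "t = u") (auto simp: subset_iff)
  qed simp
  from this[OF _ \<open>distinct ?ts\<close>] show ?thesis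
    unfolding ordered_finite_product_def ts(1) using F(2) by simp
qed

lemma canonical_decomposition_exponents:
  assumes "canonical_decomposition S T x s a b c"
  shows "a l \<in> {0, 1}" and "l < m \<Longrightarrow> b l m \<in> {0, 1}" and "l < m \<Longrightarrow> k \<le> m \<Longrightarrow> c l m k \<in> {0, 1}"
  using assms by (auto simp: canonical_decomposition_def)

context topologized_group
begin

lemma has_ordered_product_image:
  assumes Q: "group Q" and \<phi>: "continuous_hom G T Q \<phi>"
    and prod: "has_ordered_product G T L f A z" and L: "irrefl L" "trans L" "total L"
    and f: "\<And>t. t \<in> A \<Longrightarrow> f t \<in> carrier G"
    and trivial: "\<And>t. t \<in> A \<Longrightarrow> t \<noteq> u \<Longrightarrow> \<phi> (f t) = \<one>\<^bsub>Q\<^esub>"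
  shows "z \<in> carrier G" and "\<phi> z = (if u \<in> A then \<phi> (f u) else \<one>\<^bsub>Q\<^esub>)"
proof -
  interpret group_hom G Q \<phi> by (rule continuous_hom_group_hom[OF \<phi> is_group Q])
  show z: "z \<in> carrier G"
    using prod by (simp add: has_ordered_product_def limitin_def topspace_eq_carrier)
  let ?U = "{x \<in> carrier G. \<phi> x \<in> {\<phi> z}}"
  have "openin T ?U" using \<phi> unfolding continuous_hom_iff_openin by blast
  then have "eventually (\<lambda>F. ordered_finite_product G L f F \<in> ?U) (finite_subsets_at_top A)"
    using prod z unfolding has_ordered_product_def limitin_def by blast
  then obtain B where B: "finite B" "B \<subseteq> A"
    and near: "\<forall>F. finite F \<and> B \<subseteq> F \<and> F \<subseteq> A \<longrightarrow> ordered_finite_product G L f F \<in> ?U"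
    unfolding eventually_finite_subsets_at_top by (elim exE conjE)
  define F where "F = (if u \<in> A then insert u B else B)"
  have F: "finite F" "B \<subseteq> F" "F \<subseteq> A" "u \<in> F \<longleftrightarrow> u \<in> A"
    using B by (auto simp: F_def)
  have "\<phi> z = \<phi> (ordered_finite_product G L f F)" using near[THEN spec, of F] F(1-3) by simp
  also have "\<dots> = (if u \<in> F then \<phi> (f u) else \<one>\<^bsub>Q\<^esub>)"
    by (rule hom_ordered_finite_product[OF L F(1,3) f trivial])
  finally show "\<phi> z = (if u \<in> A then \<phi> (f u) else \<one>\<^bsub>Q\<^esub>)" using F(4) by simp
qed

lemma canonical_decomposition_image:
  fixes x :: "'i::wellorder \<Rightarrow> 'a"
  assumes Q: "group Q" and \<phi>: "continuous_hom G T Q \<phi>" and x: "\<And>l. x l \<in> carrier G"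
    and dec: "canonical_decomposition G T x s a b c"
    and zassenhaus: "\<And>z. z \<in> zassenhaus G T 4 \<Longrightarrow> z \<in> carrier G \<and> \<phi> z = \<one>\<^bsub>Q\<^esub>"
    and squares: "\<And>l. a l = 1 \<Longrightarrow> \<phi> (x l) \<otimes>\<^bsub>Q\<^esub> \<phi> (x l) = \<one>\<^bsub>Q\<^esub>"
    and commutators: "\<And>l m. l < m \<Longrightarrow> b l m = 1 \<Longrightarrow> commutator Q (\<phi> (x l)) (\<phi> (x m)) = \<one>\<^bsub>Q\<^esub>"
    and triples: "\<And>l m k. l < m \<Longrightarrow> k \<le> m \<Longrightarrow> c l m k = 1 \<Longrightarrow> (l, m, k) \<noteq> (l0, m0, k0) \<Longrightarrow>
      commutator Q (commutator Q (\<phi> (x l)) (\<phi> (x m))) (\<phi> (x k)) = \<one>\<^bsub>Q\<^esub>"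
    and less: "l0 < m0" "k0 \<le> m0"
  shows "s \<in> carrier G" and "\<phi> s = (if c l0 m0 k0 = 1
    then commutator Q (commutator Q (\<phi> (x l0)) (\<phi> (x m0))) (\<phi> (x k0)) else \<one>\<^bsub>Q\<^esub>)"
proof -
  interpret group_hom G Q \<phi> by (rule continuous_hom_group_hom[OF \<phi> is_group Q])
  have less_rel: "irrefl (less_rel :: ('i \<times> 'i) set)" "trans (less_rel :: ('i \<times> 'i) set)"
    "total (less_rel :: ('i \<times> 'i) set)"
    by (auto simp: irrefl_def trans_def total_on_def)
  have lex: "irrefl ((less_rel :: ('i \<times> 'i) set) <*lex*> L)" if "irrefl L" for L :: "('j \<times> 'j) set"
    using that by (auto simp: irrefl_def)
  note orders = less_rel lex trans_lex_prod total_lex_prod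
  note exponents = canonical_decomposition_exponents[OF dec]
  obtain z1 z2 z3 r' where
    z1: "has_ordered_product G T less_rel (\<lambda>i. x i [^] (2 * a i)) UNIV z1" and
    z2: "has_ordered_product G T (less_rel <*lex*> less_rel)
          (\<lambda>(i, j). commutator G (x i) (x j) [^] b i j) {(i, j). i < j} z2" and
    z3: "has_ordered_product G T (less_rel <*lex*> less_rel <*lex*> less_rel)
          (\<lambda>(i, j, k). commutator G (commutator G (x i) (x j)) (x k) [^] c i j k)
          {(i, j, k). i < j \<and> k \<le> j} z3" and
    r': "r' \<in> zassenhaus G T 4" and s: "s = z1 \<otimes> z2 \<otimes> z3 \<otimes> r'"
    using dec unfolding canonical_decomposition_def by blast
  have image1: "\<phi> (x l [^] (2 * a l)) = \<one>\<^bsub>Q\<^esub>" for l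
    using exponents(1)[of l] squares[of l] x[of l] by (auto simp: hom_nat_pow numeral_2_eq_2)
  have image2: "\<phi> (commutator G (x l) (x m) [^] b l m) = \<one>\<^bsub>Q\<^esub>" if "l < m" for l m
    using exponents(2)[of l m] commutators[of l m] x that by (auto simp: hom_nat_pow hom_commutator)
  have image3: "\<phi> (commutator G (commutator G (x l) (x m)) (x k) [^] c l m k) =
      (if c l m k = 1 then commutator Q (commutator Q (\<phi> (x l)) (\<phi> (x m))) (\<phi> (x k)) else \<one>\<^bsub>Q\<^esub>)"
    if "l < m" "k \<le> m" for l m k
    using exponents(3)[of l m k] x that by (auto simp: hom_nat_pow hom_commutator)
  have "z1 \<in> carrier G \<and> \<phi> z1 = \<one>\<^bsub>Q\<^esub>"
    using has_ordered_product_image[OF Q \<phi> z1, where u = l0] less_rel x image1 by auto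
  moreover have "z2 \<in> carrier G \<and> \<phi> z2 = \<one>\<^bsub>Q\<^esub>"
    using has_ordered_product_image[OF Q \<phi> z2, where u = "(l0, m0)"] x image2 less
    by (auto simp: orders split: prod.splits)
  moreover have "z3 \<in> carrier G \<and> \<phi> z3 = (if c l0 m0 k0 = 1
    then commutator Q (commutator Q (\<phi> (x l0)) (\<phi> (x m0))) (\<phi> (x k0)) else \<one>\<^bsub>Q\<^esub>)"
    using has_ordered_product_image[OF Q \<phi> z3, where u = "(l0, m0, k0)"] x image3 triples less
    by (auto simp: orders split: prod.splits)
  ultimately show "s \<in> carrier G" and "\<phi> s = (if c l0 m0 k0 = 1
    then commutator Q (commutator Q (\<phi> (x l0)) (\<phi> (x m0))) (\<phi> (x k0)) else \<one>\<^bsub>Q\<^esub>)"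
    using s zassenhaus[OF r'] x by auto
qed

end

section \<open>Free pro-p groups and finite p-groups\<close>

lemma pro_p_group_discrete:
  assumes "group H" and p: "prime p" and card: "card (carrier H) = p ^ n"
  shows "pro_p_group p H (discrete_topology (carrier H))"
  unfolding pro_p_group_def profinite_group_def topological_group_def
    totally_disconnected_topology_def
proof (intro conjI allI impI ballI)
  interpret group H by fact
  let ?T = "discrete_topology (carrier H)"
  have "finite (carrier H)"
    using card p by (metis card.infinite not_prime_0 power_not_zero)
  then show "compact_space ?T" by (simp only: compact_space_discrete_topology)
  show "continuous_map (prod_topology ?T ?T) ?T (\<lambda>(u, v). u \<otimes>\<^bsub>H\<^esub> v)"
    unfolding prod_topology_discrete_topology[symmetric] by auto
  show "continuous_map ?T ?T (\<lambda>u. inv\<^bsub>H\<^esub> u)" by auto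
  show "connected_component_of_set ?T u = {u}" if "u \<in> topspace ?T" for u
    using that by (simp add: connected_component_of_discrete_topology)
  show "\<exists>k. card (rcosets\<^bsub>H\<^esub> N) = p ^ k" if "N \<lhd> H \<and> openin ?T N" for N
  proof -
    have "card (rcosets\<^bsub>H\<^esub> N) dvd p ^ n"
      using lagrange[OF normal_imp_subgroup, of N] that card
      by (metis Coset.order_def dvd_triv_left)
    then show ?thesis using divides_primepow_nat[OF p] by blast
  qed
qed (use assms(1) in \<open>auto simp: Hausdorff_space_discrete_topology\<close>)

lemma free_pro_p_group_hom_to_finite:
  fixes x :: "'i \<Rightarrow> 's" and y :: "'i \<Rightarrow> 'q"
  assumes free: "free_pro_p_group p S T x" and Q: "group Q"
    and p: "prime p" and card: "card (carrier Q) = p ^ n"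
    and y: "\<And>i. y i \<in> carrier Q" "finite {i. y i \<noteq> \<one>\<^bsub>Q\<^esub>}"
  shows "\<exists>\<phi>. continuous_hom S T Q \<phi> \<and> (\<forall>i. \<phi> (x i) = y i)"
proof -
  interpret group Q by (rule Q)
  have "finite (carrier Q)"
    using card p by (metis card.infinite not_prime_0 power_not_zero)
  then obtain f :: "'q \<Rightarrow> nat" where "inj_on f (carrier Q)"
    using finite_imp_inj_to_nat_seg by blast
  define code where "code g = {Inr (f g) :: 'i + nat}" for g
  have inj: "inj_on code (carrier Q)"
    using \<open>inj_on f (carrier Q)\<close> by (auto simp: inj_on_def code_def)
  let ?H = "image_group code Q"
  have H: "group ?H" "carrier ?H = code ` carrier Q"
    by (rule inj_imp_image_group_is_group[OF inj], rule image_group_carrier)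
  have "card (carrier ?H) = p ^ n" using card_image[OF inj] card H(2) by simp
  then have "pro_p_group p ?H (discrete_topology (carrier ?H))"
    by (rule pro_p_group_discrete[OF H(1) p])
  moreover have "family_converges_to_one ?H (discrete_topology (carrier ?H)) (\<lambda>i. code (y i))"
    unfolding family_converges_to_one_def
  proof (intro conjI allI impI)
    fix U assume "openin (discrete_topology (carrier ?H)) U \<and> \<one>\<^bsub>?H\<^esub> \<in> U"
    then show "finite {i. code (y i) \<notin> U}"
      by (intro finite_subset[OF _ y(2)]) (auto simp: image_group_one)
  qed (use y(1) H(2) in auto)
  ultimately obtain \<psi> where "\<psi> \<in> hom S ?H" "continuous_map T (discrete_topology (carrier ?H)) \<psi>"
    and \<psi>: "\<And>i. \<psi> (x i) = code (y i)"
    using free unfolding free_pro_p_group_def by blast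
  then have "continuous_hom S T ?H \<psi>" by (simp add: continuous_hom_def)
  moreover have "inv_into (carrier Q) code \<in> hom ?H Q"
    using iso_set_sym[OF inj_imp_image_group_iso[OF inj]] by (simp add: iso_def)
  ultimately have "continuous_hom S T Q (inv_into (carrier Q) code \<circ> \<psi>)"
    by (rule continuous_hom_comp_hom)
  then show ?thesis
    using inj y(1) \<psi> by (intro exI[of _ "inv_into (carrier Q) code \<circ> \<psi>"]) simp
qed

section \<open>Relators with a triple commutator\<close>

lemma triple_commutator_U4:
  assumes "fst x = (a, b, c)" "fst x' = (a', b', c')" "fst x'' = (a'', b'', c'')"
  shows "commutator U4 (commutator U4 x x') x'' =
    ((0, 0, 0), (0, 0), (a * b' + a' * b) * c'' + a'' * (b * c' + b' * c))"
  using assms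
  by (cases x; cases x'; cases x'') (auto simp: commutator_U4 split_paired_all)

lemma square_U4_eq_one:
  assumes "fst x = (0, 0, 0)"
  shows "x \<otimes>\<^bsub>U4\<^esub> x = \<one>\<^bsub>U4\<^esub>"
  using assms by (cases x) (auto simp: mult_U4 one_U4 split_paired_all)

lemma commutator_U4_eq_one:
  assumes "fst x = (0, 0, 0)" and "fst y = (0, 0, 0)"
  shows "commutator U4 x y = \<one>\<^bsub>U4\<^esub>"
  using assms by (cases x; cases y) (auto simp: commutator_U4 one_U4 split_paired_all)

lemma triple_commutator_U4_mod_center:
  "commutator U4_mod_center (commutator U4_mod_center x y) z = \<one>\<^bsub>U4_mod_center\<^esub>"
  by (cases x; cases y; cases z)
    (auto simp: commutator_U4_mod_center one_U4_mod_center split_paired_all)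

definition U4_aab :: "((bit \<times> bit \<times> bit) \<times> (bit \<times> bit) \<times> bit) monoid" where
  "U4_aab = U4\<lparr>carrier := {((a, a', b), t) | a a' b t. a = a'}\<rparr>"

lemma subgroup_U4_aab: "subgroup (carrier U4_aab) U4"
proof (rule group.subgroupI[OF group_U4])
  show "inv\<^bsub>U4\<^esub> y \<in> carrier U4_aab" if "y \<in> carrier U4_aab" for y
    using that by (auto simp: U4_aab_def split_paired_all inv_U4)
qed (auto simp: U4_aab_def mult_U4)

lemma group_U4_aab: "group U4_aab"
  using group.subgroup_imp_group[OF group_U4 subgroup_U4_aab] by (simp add: U4_aab_def)

lemma card_U4_aab: "\<exists>n. card (carrier U4_aab) = 2 ^ n"
proof -
  have "card (carrier U4_aab) dvd 2 ^ 6"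
    using group.lagrange[OF group_U4 subgroup_U4_aab] card_U4
    by (metis Coset.order_def dvd_triv_right)
  then show ?thesis using divides_primepow_nat[OF two_is_prime_nat] by blast
qed

locale triple_commutator_relator =
  fixes S :: "'s monoid" and T :: "'s topology" and x :: "'i::wellorder \<Rightarrow> 's" and R :: "'s set"
    and a :: "'s \<Rightarrow> 'i \<Rightarrow> nat" and b :: "'s \<Rightarrow> 'i \<Rightarrow> 'i \<Rightarrow> nat"
    and c :: "'s \<Rightarrow> 'i \<Rightarrow> 'i \<Rightarrow> 'i \<Rightarrow> nat"
    and r :: 's and i j p :: 'i
  assumes free: "free_pro_p_group 2 S T x"
    and decomposition: "\<And>s. s \<in> R \<Longrightarrow> canonical_decomposition S T x s (a s) (b s) (c s)"
    and r: "r \<in> R" and less: "i < j" and p: "p = i \<or> p = j"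
    and a_r: "a r i = 0" "a r j = 0" and b_r: "sym_exponent (b r) i j = 0"
      "\<And>l. l \<noteq> i \<Longrightarrow> l \<noteq> j \<Longrightarrow> sym_exponent (b r) i l = 0 \<and> sym_exponent (b r) j l = 0"
    and c_r: "c r i j p \<noteq> 0"
    and others: "\<And>s. s \<in> R \<Longrightarrow> s \<noteq> r \<Longrightarrow> b s i j = 0 \<and> a s p = 0"
begin

sublocale topologized_group S T
  using free by (simp add: topologized_group_def topologized_group_axioms_def free_pro_p_group_def
      pro_p_group_def profinite_group_def topological_group_def)

lemma x_closed: "x l \<in> carrier S"
  using free by (simp add: free_pro_p_group_def family_converges_to_one_def)

definition q :: 'i where
  "q = (if p = i then j else i)"

text \<open>The values at \<open>x\<^sub>l\<close> of the characters \<open>\<alpha>, \<alpha>, \<beta>\<close>, where \<open>\<alpha>\<close> and \<open>\<beta>\<close> are dual to \<open>x\<^sub>p\<close> and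
  \<open>x\<^sub>q\<close>.\<close>

definition dual_characters :: "'i \<Rightarrow> bit \<times> bit \<times> bit" where
  "dual_characters l = (of_bool (l = p), of_bool (l = p), of_bool (l = q))"

lemma dual_characters_eq_0: "l \<noteq> i \<Longrightarrow> l \<noteq> j \<Longrightarrow> dual_characters l = (0, 0, 0)"
  using p by (auto simp: dual_characters_def q_def)

lemma square_p_not_occurring: "s \<in> R \<Longrightarrow> a s p = 0"
  using others[of s] a_r p by (cases "s = r") auto

lemma commutator_ij_not_occurring: "s \<in> R \<Longrightarrow> b s i j = 0"
  using others[of s] b_r(1) less by (cases "s = r") (auto simp: sym_exponent_def)

lemma commutators_at_ij_not_occurring:
  assumes "l < m" and "l \<in> {i, j} \<or> m \<in> {i, j}"
  shows "b r l m = 0"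
proof (cases "l \<in> {i, j} \<and> m \<in> {i, j}")
  case True
  then show ?thesis using assms(1) less b_r(1) by (auto simp: sym_exponent_def)
next
  case False
  then show ?thesis
    using assms b_r(2)[of l] b_r(2)[of m] by (auto simp: sym_exponent_def split: if_splits)
qed

lemma commutator_of_dual_characters:
  assumes "l < m" and "(l, m) \<noteq> (i, j)" and "fst y = dual_characters l" "fst z = dual_characters m"
  shows "commutator U4_mod_center y z = \<one>\<^bsub>U4_mod_center\<^esub>"
proof -
  have "\<not> (l = p \<and> m = q)" "\<not> (l = q \<and> m = p)"
    using assms(1,2) p less by (auto simp: q_def)
  then show ?thesis
    using assms(3,4) by (cases y; cases z)
      (auto simp: dual_characters_def commutator_U4_mod_center one_U4_mod_center split_paired_all)
qed

lemma triple_commutator_of_dual_characters: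
  assumes "l < m"
    and "fst y = dual_characters l" "fst z = dual_characters m" "fst w = dual_characters n"
  shows "commutator U4 (commutator U4 y z) w =
    (if (l, m, n) = (i, j, p) then ((0, 0, 0), (0, 0), 1) else \<one>\<^bsub>U4\<^esub>)"
  using assms triple_commutator_U4[of y _ _ _ z _ _ _ w] p less
  by (auto simp: dual_characters_def q_def one_U4)

lemma ex_dual_hom:
  obtains \<rho> where "continuous_hom S T U4 \<rho>" "\<And>s. s \<in> carrier S \<Longrightarrow> \<exists>a b. fst (\<rho> s) = (a, a, b)"
    "\<And>l. \<rho> (x l) = (dual_characters l, (0, 0), 0)"
proof -
  obtain n where "card (carrier U4_aab) = 2 ^ n"
    using card_U4_aab by blast
  moreover have "finite {l. (dual_characters l, (0, 0), 0) \<noteq> \<one>\<^bsub>U4_aab\<^esub>}"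
    by (rule finite_subset[of _ "{i, j}"])
      (use dual_characters_eq_0 in \<open>auto simp: U4_aab_def one_U4\<close>)
  ultimately obtain \<rho> where \<rho>: "continuous_hom S T U4_aab \<rho>"
    "\<And>l. \<rho> (x l) = (dual_characters l, (0, 0), 0)"
    using free_pro_p_group_hom_to_finite[OF free group_U4_aab two_is_prime_nat,
        where y = "\<lambda>l. (dual_characters l, (0, 0), 0)"]
    by (auto simp: U4_aab_def dual_characters_def)
  have "continuous_hom S T U4 (id \<circ> \<rho>)"
    by (rule continuous_hom_comp_hom[OF \<rho>(1)]) (auto simp: hom_def U4_aab_def)
  moreover have "\<exists>a b. fst (\<rho> s) = (a, a, b)" if "s \<in> carrier S" for s
  proof -
    have "\<rho> s \<in> carrier U4_aab" using \<rho>(1) that by (auto simp: continuous_hom_def hom_def)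
    then show ?thesis by (auto simp: U4_aab_def)
  qed
  ultimately show ?thesis using that \<rho>(2) by simp
qed

lemma relators_in_kernel_mod_center:
  assumes \<rho>: "continuous_hom S T U4 \<rho>" and x: "\<And>l. \<rho> (x l) = (dual_characters l, (0, 0), 0)"
  shows "R \<subseteq> kernel S U4_mod_center (forget_corner \<circ> \<rho>)"
proof
  fix s assume s: "s \<in> R"
  let ?\<phi> = "forget_corner \<circ> \<rho>" and ?c = "commutator U4_mod_center"
  have \<phi>: "continuous_hom S T U4_mod_center ?\<phi>"
    by (rule continuous_hom_comp_hom[OF \<rho> forget_corner_hom])
  have fst_\<phi>: "fst (?\<phi> (x l)) = dual_characters l" for l
    by (simp add: x forget_corner_def)
  have zassenhaus: "z \<in> carrier S \<and> ?\<phi> z = \<one>\<^bsub>U4_mod_center\<^esub>" if "z \<in> zassenhaus S T 4" for z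
    using zassenhaus_4_killed_by_U4[OF \<rho> that]
    by (simp add: one_U4 one_U4_mod_center forget_corner_def)
  have squares: "?\<phi> (x l) \<otimes>\<^bsub>U4_mod_center\<^esub> ?\<phi> (x l) = \<one>\<^bsub>U4_mod_center\<^esub>" if "a s l = 1" for l
  proof -
    have "l \<noteq> p" using that square_p_not_occurring[OF s] by auto
    then show ?thesis
      by (simp add: x dual_characters_def forget_corner_def mult_U4_mod_center one_U4_mod_center)
  qed
  have commutators: "?c (?\<phi> (x l)) (?\<phi> (x m)) = \<one>\<^bsub>U4_mod_center\<^esub>" if "l < m" "b s l m = 1" for l m
    using that commutator_ij_not_occurring[OF s]
    by (intro commutator_of_dual_characters[OF _ _ fst_\<phi> fst_\<phi>]) auto
  have triples: "?c (?c (?\<phi> (x l)) (?\<phi> (x m))) (?\<phi> (x k)) = \<one>\<^bsub>U4_mod_center\<^esub>" for l m k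
    by (rule triple_commutator_U4_mod_center)
  note image = canonical_decomposition_image[OF group_U4_mod_center \<phi> x_closed decomposition[OF s]
      zassenhaus squares commutators triples less less_imp_le[OF less]]
  show "s \<in> kernel S U4_mod_center ?\<phi>"
    using image(1) image(2) triples by (simp add: kernel_def if_split)
qed

lemma relator_image:
  assumes \<rho>: "continuous_hom S T U4 \<rho>" and fst_\<rho>: "\<And>l. fst (\<rho> (x l)) = dual_characters l"
  shows "\<rho> r = ((0, 0, 0), (0, 0), 1)"
proof -
  let ?c = "commutator U4"
  have squares: "\<rho> (x l) \<otimes>\<^bsub>U4\<^esub> \<rho> (x l) = \<one>\<^bsub>U4\<^esub>" if "a r l = 1" for l
  proof (rule square_U4_eq_one)
    have "l \<noteq> i" "l \<noteq> j" using that a_r by auto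
    then show "fst (\<rho> (x l)) = (0, 0, 0)" by (simp add: fst_\<rho> dual_characters_eq_0)
  qed
  have commutators: "?c (\<rho> (x l)) (\<rho> (x m)) = \<one>\<^bsub>U4\<^esub>" if "l < m" "b r l m = 1" for l m
  proof (rule commutator_U4_eq_one)
    have "l \<notin> {i, j}" "m \<notin> {i, j}" using that commutators_at_ij_not_occurring[of l m] by auto
    then show "fst (\<rho> (x l)) = (0, 0, 0)" "fst (\<rho> (x m)) = (0, 0, 0)"
      by (simp_all add: fst_\<rho> dual_characters_eq_0)
  qed
  have triples: "?c (?c (\<rho> (x l)) (\<rho> (x m))) (\<rho> (x n)) = \<one>\<^bsub>U4\<^esub>"
    if "l < m" "(l, m, n) \<noteq> (i, j, p)" for l m n
    unfolding triple_commutator_of_dual_characters[OF that(1) fst_\<rho> fst_\<rho> fst_\<rho>]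
    by (rule if_not_P[OF that(2)])
  have "p \<le> j" using p less by auto
  then have "c r i j p = 1"
    using canonical_decomposition_exponents(3)[OF decomposition[OF r] less, of p] c_r by auto
  then have "\<rho> r = ?c (?c (\<rho> (x i)) (\<rho> (x j))) (\<rho> (x p))"
    using canonical_decomposition_image(2)[OF group_U4 \<rho> x_closed decomposition[OF r]
        _ squares commutators triples less \<open>p \<le> j\<close>] zassenhaus_4_killed_by_U4[OF \<rho>] by simp
  then show ?thesis
    using triple_commutator_of_dual_characters[OF less fst_\<rho> fst_\<rho> fst_\<rho>] by simp
qed

lemma relators_closed: "R \<subseteq> carrier S"
proof -
  obtain \<rho> where "continuous_hom S T U4 \<rho>" "\<And>l. \<rho> (x l) = (dual_characters l, (0, 0), 0)"
    using ex_dual_hom by metis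
  then have "R \<subseteq> kernel S U4_mod_center (forget_corner \<circ> \<rho>)"
    by (rule relators_in_kernel_mod_center)
  then show ?thesis by (auto simp: kernel_def)
qed

lemma ex_dual_hom_mod_center:
  defines "N \<equiv> closed_normal_subgroup_generated S T R"
  obtains \<phi> where
    "continuous_hom (S Mod N) (quotient_group_topology S T N) U4_mod_center \<phi>"
    "\<And>C. C \<in> carrier (S Mod N) \<Longrightarrow> \<exists>a b. fst (\<phi> C) = (a, a, b)"
    "\<And>l. fst (\<phi> (N #>\<^bsub>S\<^esub> x l)) = dual_characters l"
proof -
  obtain \<rho> where \<rho>: "continuous_hom S T U4 \<rho>" "\<And>s. s \<in> carrier S \<Longrightarrow> \<exists>a b. fst (\<rho> s) = (a, a, b)"
    "\<And>l. \<rho> (x l) = (dual_characters l, (0, 0), 0)"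
    using ex_dual_hom by metis
  have mod_center: "continuous_hom S T U4_mod_center (forget_corner \<circ> \<rho>)"
    by (rule continuous_hom_comp_hom[OF \<rho>(1) forget_corner_hom])
  have "N \<subseteq> kernel S U4_mod_center (forget_corner \<circ> \<rho>)"
    unfolding N_def by (rule closed_normal_subgroup_generated_subset_kernel[OF group_U4_mod_center
        mod_center relators_in_kernel_mod_center[OF \<rho>(1,3)]])
  moreover have "N \<lhd> S"
    unfolding N_def by (rule closed_normal_subgroup_generated_normal[OF relators_closed])
  ultimately obtain \<phi> where
    \<phi>: "continuous_hom (S Mod N) (quotient_group_topology S T N) U4_mod_center \<phi>"
    "\<And>s. s \<in> carrier S \<Longrightarrow> \<phi> (N #>\<^bsub>S\<^esub> s) = (forget_corner \<circ> \<rho>) s"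
    using continuous_hom_factor[OF _ group_U4_mod_center mod_center] by blast
  have fst_\<phi>: "fst (\<phi> (N #>\<^bsub>S\<^esub> s)) = fst (\<rho> s)" if "s \<in> carrier S" for s
    using \<phi>(2)[OF that] by (cases "\<rho> s") (auto simp: forget_corner_def)
  show ?thesis
  proof (rule that[OF \<phi>(1)])
    show "\<exists>a b. fst (\<phi> C) = (a, a, b)" if "C \<in> carrier (S Mod N)" for C
      using that \<rho>(2) fst_\<phi> by (fastforce simp: carrier_FactGroup)
    show "fst (\<phi> (N #>\<^bsub>S\<^esub> x l)) = dual_characters l" for l
      by (simp add: fst_\<phi>[OF x_closed] \<rho>(3))
  qed
qed

theorem not_vanishing_massey_aab:
  "\<not> vanishing_massey_aab (S Mod closed_normal_subgroup_generated S T R)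
       (quotient_group_topology S T (closed_normal_subgroup_generated S T R))"
proof
  define N where "N = closed_normal_subgroup_generated S T R"
  have N: "N \<lhd> S" unfolding N_def
    by (rule closed_normal_subgroup_generated_normal[OF relators_closed])
  assume massey: "vanishing_massey_aab (S Mod closed_normal_subgroup_generated S T R)
       (quotient_group_topology S T (closed_normal_subgroup_generated S T R))"
  obtain \<phi> where
    \<phi>: "continuous_hom (S Mod N) (quotient_group_topology S T N) U4_mod_center \<phi>"
    and aab: "\<And>C. C \<in> carrier (S Mod N) \<Longrightarrow> \<exists>a b. fst (\<phi> C) = (a, a, b)"
    and fst_\<phi>: "\<And>l. fst (\<phi> (N #>\<^bsub>S\<^esub> x l)) = dual_characters l"
    using ex_dual_hom_mod_center unfolding N_def by metis
  have "fst (\<phi> C) = (fst (fst (\<phi> C)), fst (fst (\<phi> C)), snd (snd (fst (\<phi> C))))"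
    if "C \<in> carrier (S Mod N)" for C
    using aab[OF that] by auto
  then obtain \<rho> where \<rho>: "continuous_hom (S Mod N) (quotient_group_topology S T N) U4 \<rho>"
    and lift: "\<And>C. C \<in> carrier (S Mod N) \<Longrightarrow> fst (\<rho> C) = fst (\<phi> C)"
    by (rule vanishing_massey_aabD[OF massey[folded N_def] \<phi>]) blast+
  then have \<rho>_hom: "\<rho> \<in> hom (S Mod N) U4" by (simp add: continuous_hom_def)
  then have "continuous_hom S T U4 (\<lambda>s. \<rho> (N #>\<^bsub>S\<^esub> s))"
    using \<rho> by (simp only: continuous_hom_quotient_iff[OF N])
  moreover have "fst (\<rho> (N #>\<^bsub>S\<^esub> x l)) = dual_characters l" for l
    using lift[of "N #>\<^bsub>S\<^esub> x l"] fst_\<phi> x_closed by (auto simp: carrier_FactGroup)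
  ultimately have "\<rho> (N #>\<^bsub>S\<^esub> r) = ((0, 0, 0), (0, 0), 1)"
    by (rule relator_image)
  moreover have "N #>\<^bsub>S\<^esub> r = \<one>\<^bsub>S Mod N\<^esub>"
    using coset_join2[OF _ normal_imp_subgroup[OF N]] subset_closed_normal_subgroup_generated[of R]
      relators_closed r by (auto simp: N_def)
  moreover have "\<rho> \<one>\<^bsub>S Mod N\<^esub> = \<one>\<^bsub>U4\<^esub>"
    by (rule Group.hom_one[OF \<rho>_hom normal.factorgroup_is_group[OF N] group_U4])
  ultimately show False by (simp add: one_U4)
qed

end

theorem theorem1p4:
  fixes S :: "'s monoid" and T :: "'s topology"
    and x :: "'i::wellorder \<Rightarrow> 's"
    and R :: "'s set"
    and a :: "'s \<Rightarrow> 'i \<Rightarrow> nat"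
    and b :: "'s \<Rightarrow> 'i \<Rightarrow> 'i \<Rightarrow> nat"
    and c :: "'s \<Rightarrow> 'i \<Rightarrow> 'i \<Rightarrow> 'i \<Rightarrow> nat"
    and r :: 's and i j :: 'i
  assumes "free_pro_p_group 2 S T x"
    and "R \<subseteq> zassenhaus S T 2"
    and "\<And>s. s \<in> R \<Longrightarrow> canonical_decomposition S T x s (a s) (b s) (c s)"
    and "r \<in> R" and "i < j"
    and "a r i = 0" and "a r j = 0" and "sym_exponent (b r) i j = 0"
    and "\<And>l. l \<noteq> i \<Longrightarrow> l \<noteq> j \<Longrightarrow> sym_exponent (b r) i l = 0 \<and> sym_exponent (b r) j l = 0"
    and "(c r i j i \<noteq> 0 \<and> (\<forall>s\<in>R. s \<noteq> r \<longrightarrow> b s i j = 0 \<and> a s i = 0)) \<or>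
         (c r i j j \<noteq> 0 \<and> (\<forall>s\<in>R. s \<noteq> r \<longrightarrow> b s i j = 0 \<and> a s j = 0))"
  shows "\<not> topologically_isomorphic
           (S Mod closed_normal_subgroup_generated S T R)
           (quotient_group_topology S T (closed_normal_subgroup_generated S T R))
           (galois_group_maximal_pro_p 2 TYPE('f::field))
           (galois_group_maximal_pro_p_topology 2 TYPE('f))"
proof -
  obtain p where "p = i \<or> p = j" "c r i j p \<noteq> 0" "\<And>s. s \<in> R \<Longrightarrow> s \<noteq> r \<Longrightarrow> b s i j = 0 \<and> a s p = 0"
    using assms(10) by blast
  then interpret triple_commutator_relator S T x R a b c r i j p
    using assms(1,3-9) by unfold_locales
  interpret galois: topologized_group "absolute_galois_group TYPE('f)" "krull_topology TYPE('f)"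
    by (rule topologized_absolute_galois_group)
  note kernel_normal = galois.pro_p_kernel_normal[of 2]
  have "vanishing_massey_aab (galois_group_maximal_pro_p 2 TYPE('f))
      (galois_group_maximal_pro_p_topology 2 TYPE('f))"
    unfolding galois_group_maximal_pro_p_def galois_group_maximal_pro_p_topology_def
      maximal_pro_p_quotient_def maximal_pro_p_quotient_topology_def
    by (rule galois.vanishing_massey_aab_quotient[OF kernel_normal
          galois.pro_p_kernel_subset_kernel[OF group_U4 card_U4 two_is_prime_nat]
          vanishing_massey_aab_absolute_galois_group])
  then show ?thesis
    using not_vanishing_massey_aab vanishing_massey_aab_iso
      topologized_group_quotient[OF closed_normal_subgroup_generated_normal[OF relators_closed]]
      galois.topologized_group_quotient[OF kernel_normal]
    unfolding galois_group_maximal_pro_p_def galois_group_maximal_pro_p_topology_def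
      maximal_pro_p_quotient_def maximal_pro_p_quotient_topology_def by blast
qed

end
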